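(* Let $\mathcal{D}_{red}=\mathcal{D}(\Gamma,(L_i)_{1\le i\le\theta},(K_i)_{1\le i\le\theta},(\chi_i)_{1\le i\le\theta},(a_{ij}))$ be a generic, regular reduced YD-datum of Cartan type with linking parameter $\ell$. Then $\mathbf{U}=\mathcal{U}(\mathcal{D}_{red},\ell)$ is $\Gamma$-reductive, i.e. every finite-dimensional left $\mathbf{U}$-module whose restriction to $\Bbbk\Gamma$ is semisimple is a semisimple $\mathbf{U}$-module.
   Context: $\Bbbk$ is an algebraically closed field of characteristic zero, $\mathbb{N}=\{0,1,\dots\}$, $\widehat{\Gamma}=\mathrm{Hom}(\Gamma,\Bbbk^\times)$. Yetter-Drinfeld modules and Nichols algebras. A Yetter-Drinfeld module over $\Bbbk\Gamma$ ($\Gamma$ abelian) is a $\Gamma$-graded vector space $V=\bigoplus_g V_g$ with a $\Gamma$-action stabilizing each $V_g$; $V_g^\chi=\{v\in V_g\mid hv=\chi(h)v\ \forall h\in\Gamma\}$; the braiding is $c(v\otimes w)=g\cdot w\otimes v$ for $v\in V_g$. $T(V)$ is a Hopf algebra in the braided category of Yetter-Drinfeld modules with the elements of $V$ primitive; $I(V)$ is the largest $\mathbb{N}$-graded ideal and coideal $I\subset T(V)$ with $I\cap V=0$. $T(V)\#\Bbbk\Gamma$ is the bosonization: $gv=(g\cdot v)g$, $\Delta(v)=g\otimes v+v\otimes1$ for $v\in V_g$, and elements of $\Gamma$ are group-like. Reduced data. A reduced YD-datum consists of an abelian group $\Gamma$, an integer $\theta\ge1$, $K_i,L_i\in\Gamma$,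 $\chi_i\in\widehat\Gamma$ ($1\le i\le\theta$) with $\chi_j(K_i)=\chi_i(L_j)$ for all $i,j$ and $K_iL_i\ne1$ for all $i$. Put $q_{ij}=\chi_j(K_i)$. It is generic if no $q_{ii}$ is a root of unity; regular if $\chi_1,\dots,\chi_\theta$ are $\mathbb{Z}$-linearly independent in $\widehat\Gamma$; (when generic) of Cartan type if $(a_{ij})$ is a generalized Cartan matrix with $q_{ij}q_{ji}=q_{ii}^{a_{ij}}$ for all $i,j$. A linking parameter is a family $\ell=(\ell_i)$ of non-zero elements of $\Bbbk$. $\mathbf{U}=\mathcal{U}(\mathcal{D}_{red},\ell)$ is the quotient Hopf algebra of $T(V\oplus W)\#\Bbbk\Gamma$, where $V$ has basis $v_i\in V_{K_i}^{\chi_i}$ and $W$ has basis $w_i\in W_{L_i}^{\chi_i^{-1}}$, by the ideal generated by $I(V)$, $I(W)$ and $v_iw_j-\chi_j^{-1}(K_i)w_jv_i-\delta_{ij}\ell_i(K_iL_i-1)$ for all $1\le i,j\le\theta$. The group algebra $\Bbbk\Gamma$ embeds in $\mathbf{U}$. *)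

theory Defs
  imports
    "HOL-Computational_Algebra.Polynomial"
    "HOL-Library.Poly_Mapping"
    "HOL-Algebra.QuotRing"
    "HOL-Algebra.Module"
begin

section \<open>Algebras with a distinguished basis\<close>

text \<open>
  A vector space with basis \<open>'b\<close> is the type of finitely supported functions from \<open>'b\<close> to the
  ground field.  Algebras are represented by the record type \<open>('k, 'a) module\<close>, which extends the
  ring record by a scalar multiplication; its locales are not used, as they require
  commutativity.
\<close>

definition pm_scale :: "'k \<Rightarrow> ('b \<Rightarrow>\<^sub>0 'k) \<Rightarrow> ('b \<Rightarrow>\<^sub>0 'k::field)"
  where "pm_scale c p = Poly_Mapping.map ((*) c) p"

lemma lookup_pm_scale [simp]:
  "Poly_Mapping.lookup (pm_scale c p) x = c * Poly_Mapping.lookup p x"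
  by (auto simp: pm_scale_def Poly_Mapping.map.rep_eq when_def)

global_interpretation pm: vector_space "pm_scale :: 'k::field \<Rightarrow> ('b \<Rightarrow>\<^sub>0 'k) \<Rightarrow> ('b \<Rightarrow>\<^sub>0 'k)"
  by unfold_locales (auto intro!: poly_mapping_eqI simp: lookup_add algebra_simps)

text \<open>
  The algebra with basis \<open>'b\<close>, unit the basis element \<open>e\<close> and product
  \<open>a \<cdot> b = \<sigma> a b \<cdot> (m a b)\<close> of basis elements.
\<close>

definition twisted_algebra ::
    "('b \<Rightarrow> 'b \<Rightarrow> 'b) \<Rightarrow> 'b \<Rightarrow> ('b \<Rightarrow> 'b \<Rightarrow> 'k::field) \<Rightarrow> ('k, 'b \<Rightarrow>\<^sub>0 'k) module"
  where "twisted_algebra m e \<sigma> =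
    \<lparr>carrier = UNIV,
     mult = (\<lambda>p q. \<Sum>a\<in>Poly_Mapping.keys p. \<Sum>b\<in>Poly_Mapping.keys q.
       Poly_Mapping.single (m a b) (\<sigma> a b * Poly_Mapping.lookup p a * Poly_Mapping.lookup q b)),
     one = Poly_Mapping.single e 1,
     zero = 0,
     add = (+),
     smult = pm_scale\<rparr>"

lemma twisted_algebra_sel [simp]:
  "carrier (twisted_algebra m e \<sigma>) = UNIV"
  "\<one>\<^bsub>twisted_algebra m e \<sigma>\<^esub> = Poly_Mapping.single e 1"
  "\<zero>\<^bsub>twisted_algebra m e \<sigma>\<^esub> = 0"
  "p \<oplus>\<^bsub>twisted_algebra m e \<sigma>\<^esub> q = p + q"
  "c \<odot>\<^bsub>twisted_algebra m e \<sigma>\<^esub> p = pm_scale c p"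
  by (simp_all add: twisted_algebra_def)

definition linear_extension :: "('a \<Rightarrow> ('b \<Rightarrow>\<^sub>0 'k)) \<Rightarrow> ('a \<Rightarrow>\<^sub>0 'k::field) \<Rightarrow> ('b \<Rightarrow>\<^sub>0 'k)"
  where "linear_extension f p =
    (\<Sum>a\<in>Poly_Mapping.keys p. pm_scale (Poly_Mapping.lookup p a) (f a))"

definition group_algebra :: "('k, 'g::ab_group_add \<Rightarrow>\<^sub>0 'k::field) module"
  where "group_algebra =
    \<lparr>carrier = UNIV, mult = (*), one = 1, zero = 0, add = (+), smult = pm_scale\<rparr>"

definition quotient_algebra :: "('k, 'a) module \<Rightarrow> 'a set \<Rightarrow> ('k, 'a set) module"
  where "quotient_algebra A J =
    \<lparr>carrier = carrier (A Quot J), mult = mult (A Quot J), one = \<one>\<^bsub>A Quot J\<^esub>,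
     zero = \<zero>\<^bsub>A Quot J\<^esub>, add = add (A Quot J),
     smult = (\<lambda>c X. \<Union>x\<in>X. J +>\<^bsub>A\<^esub> (c \<odot>\<^bsub>A\<^esub> x))\<rparr>"

section \<open>Modules over an algebra\<close>

locale alg_module = vector_space scale
  for scale :: "'k::field \<Rightarrow> 'm::ab_group_add \<Rightarrow> 'm" +
  fixes A :: "('k, 'a) module" and act :: "'a \<Rightarrow> 'm \<Rightarrow> 'm"
  assumes act_add_right: "a \<in> carrier A \<Longrightarrow> act a (x + y) = act a x + act a y"
    and act_scale_right: "a \<in> carrier A \<Longrightarrow> act a (scale c x) = scale c (act a x)"
    and act_add_left:
      "a \<in> carrier A \<Longrightarrow> b \<in> carrier A \<Longrightarrow> act (a \<oplus>\<^bsub>A\<^esub> b) x = act a x + act b x"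
    and act_scale_left: "a \<in> carrier A \<Longrightarrow> act (c \<odot>\<^bsub>A\<^esub> a) x = scale c (act a x)"
    and act_mult: "a \<in> carrier A \<Longrightarrow> b \<in> carrier A \<Longrightarrow> act (a \<otimes>\<^bsub>A\<^esub> b) x = act a (act b x)"
    and act_one: "act \<one>\<^bsub>A\<^esub> x = x"
begin

definition is_submodule :: "'m set \<Rightarrow> bool"
  where "is_submodule N \<longleftrightarrow> subspace N \<and> (\<forall>a\<in>carrier A. \<forall>x\<in>N. act a x \<in> N)"

definition simple_submodule :: "'m set \<Rightarrow> bool"
  where "simple_submodule N \<longleftrightarrow> is_submodule N \<and> N \<noteq> {0} \<and>
    (\<forall>N'. is_submodule N' \<and> N' \<subseteq> N \<longrightarrow> N' = {0} \<or> N' = N)"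

text \<open>The module is the internal direct sum of a (possibly empty) family of simple submodules.\<close>

definition semisimple :: bool
  where "semisimple \<longleftrightarrow> (\<exists>\<S>. (\<forall>S\<in>\<S>. simple_submodule S) \<and> span (\<Union>\<S>) = UNIV \<and>
    (\<forall>S\<in>\<S>. S \<inter> span (\<Union>(\<S> - {S})) = {0}))"

definition finite_dimensional :: bool
  where "finite_dimensional \<longleftrightarrow> (\<exists>B. finite B \<and> span B = UNIV)"

end

section \<open>Tensor algebras and Nichols algebras\<close>

text \<open>
  The abelian group \<open>\<Gamma>\<close> is the type \<open>'g\<close>, written additively.  A Yetter-Drinfeld module \<open>V\<close>
  with basis \<open>v\<^sub>i \<in> V\<^bsub>d i\<^esub>\<^bsup>c i\<^esup>\<close>, where \<open>i\<close> ranges over the type \<open>'i\<close>, is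
  given by the families \<open>d\<close> and \<open>c\<close>.  The word \<open>[i\<^sub>1, \<dots>, i\<^sub>n]\<close> stands for
  \<open>v\<^bsub>i\<^sub>1\<^esub> \<cdots> v\<^bsub>i\<^sub>n\<^esub>\<close>; it spans a copy of the Yetter-Drinfeld module with
  degree \<open>word_degree d w\<close> and character \<open>word_character c w\<close>.
\<close>

definition tensor_algebra :: "('k::field, 'i list \<Rightarrow>\<^sub>0 'k) module"
  where "tensor_algebra = twisted_algebra (@) [] (\<lambda>_ _. 1)"

definition word_degree :: "('i \<Rightarrow> 'g::ab_group_add) \<Rightarrow> 'i list \<Rightarrow> 'g"
  where "word_degree d w = sum_list (map d w)"

definition word_character :: "('i \<Rightarrow> 'g \<Rightarrow> 'k::field) \<Rightarrow> 'i list \<Rightarrow> 'g \<Rightarrow> 'k"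
  where "word_character c w g = prod_list (map (\<lambda>i. c i g) w)"

text \<open>
  \<open>T(V) \<otimes> T(V)\<close> with the braided product \<open>(u \<otimes> v)(u' \<otimes> v') = u (g \<cdot> u') \<otimes> v v'\<close> for \<open>v\<close> of
  degree \<open>g\<close>; the basis element \<open>(u, v)\<close> stands for \<open>u \<otimes> v\<close>.
\<close>

definition braided_square ::
    "('i \<Rightarrow> 'g::ab_group_add) \<Rightarrow> ('i \<Rightarrow> 'g \<Rightarrow> 'k::field) \<Rightarrow> ('k, 'i list \<times> 'i list \<Rightarrow>\<^sub>0 'k) module"
  where "braided_square d c = twisted_algebra (\<lambda>(u, v) (u', v'). (u @ u', v @ v')) ([], [])
    (\<lambda>(u, v) (u', v'). word_character c u' (word_degree d v))"

definition pure_tensor ::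
    "('a \<Rightarrow>\<^sub>0 'k) \<Rightarrow> ('b \<Rightarrow>\<^sub>0 'k) \<Rightarrow> ('a \<times> 'b \<Rightarrow>\<^sub>0 'k::field)"
  where "pure_tensor p q = (\<Sum>u\<in>Poly_Mapping.keys p. \<Sum>v\<in>Poly_Mapping.keys q.
    Poly_Mapping.single (u, v) (Poly_Mapping.lookup p u * Poly_Mapping.lookup q v))"

text \<open>The comultiplication is the algebra map into the braided square with all \<open>v\<^sub>i\<close> primitive.\<close>

primrec word_comult ::
    "('i \<Rightarrow> 'g::ab_group_add) \<Rightarrow> ('i \<Rightarrow> 'g \<Rightarrow> 'k::field) \<Rightarrow> 'i list \<Rightarrow> ('i list \<times> 'i list \<Rightarrow>\<^sub>0 'k)"
  where
    "word_comult d c [] = \<one>\<^bsub>braided_square d c\<^esub>"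
  | "word_comult d c (i # w) =
      (Poly_Mapping.single ([i], []) 1 + Poly_Mapping.single ([], [i]) 1)
        \<otimes>\<^bsub>braided_square d c\<^esub> word_comult d c w"

definition comult ::
    "('i \<Rightarrow> 'g::ab_group_add) \<Rightarrow> ('i \<Rightarrow> 'g \<Rightarrow> 'k::field) \<Rightarrow>
      ('i list \<Rightarrow>\<^sub>0 'k) \<Rightarrow> ('i list \<times> 'i list \<Rightarrow>\<^sub>0 'k)"
  where "comult d c = linear_extension (word_comult d c)"

definition counit :: "('i list \<Rightarrow>\<^sub>0 'k::field) \<Rightarrow> 'k"
  where "counit p = Poly_Mapping.lookup p []"

definition homogeneous_component :: "nat \<Rightarrow> ('i list \<Rightarrow>\<^sub>0 'k::field) \<Rightarrow> ('i list \<Rightarrow>\<^sub>0 'k)"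
  where "homogeneous_component n p =
    (\<Sum>w | w \<in> Poly_Mapping.keys p \<and> length w = n. Poly_Mapping.single w (Poly_Mapping.lookup p w))"

definition homogeneous :: "nat \<Rightarrow> ('i list \<Rightarrow>\<^sub>0 'k::field) set"
  where "homogeneous n = {p. \<forall>w\<in>Poly_Mapping.keys p. length w = n}"

definition graded_subspace :: "('i list \<Rightarrow>\<^sub>0 'k::field) set \<Rightarrow> bool"
  where "graded_subspace I \<longleftrightarrow> pm.subspace I \<and> (\<forall>p\<in>I. \<forall>n. homogeneous_component n p \<in> I)"

text \<open>\<open>\<Delta>(I) \<subseteq> I \<otimes> T(V) + T(V) \<otimes> I\<close> and \<open>\<epsilon>(I) = 0\<close>.\<close>

definition coideal ::
    "('i \<Rightarrow> 'g::ab_group_add) \<Rightarrow> ('i \<Rightarrow> 'g \<Rightarrow> 'k::field) \<Rightarrow> ('i list \<Rightarrow>\<^sub>0 'k) set \<Rightarrow> bool"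
  where "coideal d c I \<longleftrightarrow> pm.subspace I \<and> (\<forall>p\<in>I. counit p = 0) \<and>
    (\<forall>p\<in>I. comult d c p \<in> pm.span {pure_tensor x y | x y. x \<in> I \<or> y \<in> I})"

text \<open>The subspace \<open>V \<subseteq> T(V)\<close> is \<open>homogeneous 1\<close>.\<close>

definition nichols_admissible ::
    "('i \<Rightarrow> 'g::ab_group_add) \<Rightarrow> ('i \<Rightarrow> 'g \<Rightarrow> 'k::field) \<Rightarrow> ('i list \<Rightarrow>\<^sub>0 'k) set \<Rightarrow> bool"
  where "nichols_admissible d c I \<longleftrightarrow> ideal I tensor_algebra \<and> graded_subspace I \<and>
    coideal d c I \<and> I \<inter> homogeneous 1 = {0}"

text \<open>The sum of all admissible ideals; it is the largest one, see \<open>nichols_ideal_greatest\<close>.\<close>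

definition nichols_ideal ::
    "('i \<Rightarrow> 'g::ab_group_add) \<Rightarrow> ('i \<Rightarrow> 'g \<Rightarrow> 'k::field) \<Rightarrow> ('i list \<Rightarrow>\<^sub>0 'k) set"
  where "nichols_ideal d c = pm.span (\<Union>{I. nichols_admissible d c I})"

text \<open>
  The algebra \<open>T(V) # \<bbbk>\<Gamma>\<close>; the basis element \<open>(w, g)\<close> stands for \<open>w # g\<close>.
\<close>

definition bosonization ::
    "('i \<Rightarrow> 'g::ab_group_add \<Rightarrow> 'k::field) \<Rightarrow> ('k, 'i list \<times> 'g \<Rightarrow>\<^sub>0 'k) module"
  where "bosonization c = twisted_algebra (\<lambda>(u, g) (v, h). (u @ v, g + h)) ([], 0)
    (\<lambda>(u, g) (v, h). word_character c v g)"

section \<open>Reduced data\<close>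

definition is_character :: "('g::ab_group_add \<Rightarrow> 'k::field) \<Rightarrow> bool"
  where "is_character \<chi> \<longleftrightarrow> \<chi> 0 = 1 \<and> (\<forall>g h. \<chi> (g + h) = \<chi> g * \<chi> h)"

text \<open>The index set \<open>{1, \<dots>, \<theta>}\<close> is the finite type \<open>'n\<close>.\<close>

definition reduced_YD_datum ::
    "('n::finite \<Rightarrow> 'g::ab_group_add) \<Rightarrow> ('n \<Rightarrow> 'g) \<Rightarrow> ('n \<Rightarrow> 'g \<Rightarrow> 'k::field) \<Rightarrow> bool"
  where "reduced_YD_datum L K \<chi> \<longleftrightarrow>
    (\<forall>i. is_character (\<chi> i)) \<and> (\<forall>i j. \<chi> j (K i) = \<chi> i (L j)) \<and> (\<forall>i. K i + L i \<noteq> 0)"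

definition braiding_matrix :: "('n \<Rightarrow> 'g) \<Rightarrow> ('n \<Rightarrow> 'g \<Rightarrow> 'k) \<Rightarrow> 'n \<Rightarrow> 'n \<Rightarrow> 'k"
  where "braiding_matrix K \<chi> i j = \<chi> j (K i)"

definition generic_datum :: "('n \<Rightarrow> 'g) \<Rightarrow> ('n \<Rightarrow> 'g \<Rightarrow> 'k::field) \<Rightarrow> bool"
  where "generic_datum K \<chi> \<longleftrightarrow> (\<forall>i. \<forall>n>0. braiding_matrix K \<chi> i i ^ n \<noteq> 1)"

definition regular_datum :: "('n::finite \<Rightarrow> 'g \<Rightarrow> 'k::field) \<Rightarrow> bool"
  where "regular_datum \<chi> \<longleftrightarrow>
    (\<forall>m :: 'n \<Rightarrow> int. (\<forall>g. (\<Prod>i\<in>UNIV. \<chi> i g powi m i) = 1) \<longrightarrow> (\<forall>i. m i = 0))"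

definition generalized_cartan_matrix :: "('n \<Rightarrow> 'n \<Rightarrow> int) \<Rightarrow> bool"
  where "generalized_cartan_matrix a \<longleftrightarrow> (\<forall>i. a i i = 2) \<and>
    (\<forall>i j. i \<noteq> j \<longrightarrow> a i j \<le> 0) \<and> (\<forall>i j. a i j = 0 \<longrightarrow> a j i = 0)"

definition cartan_type ::
    "('n \<Rightarrow> 'g) \<Rightarrow> ('n \<Rightarrow> 'g \<Rightarrow> 'k::field) \<Rightarrow> ('n \<Rightarrow> 'n \<Rightarrow> int) \<Rightarrow> bool"
  where "cartan_type K \<chi> a \<longleftrightarrow> generalized_cartan_matrix a \<and>
    (\<forall>i j. braiding_matrix K \<chi> i j * braiding_matrix K \<chi> j i = braiding_matrix K \<chi> i i powi a i j)"

definition linking_parameter :: "('n \<Rightarrow> 'k::field) \<Rightarrow> bool"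
  where "linking_parameter l \<longleftrightarrow> (\<forall>i. l i \<noteq> 0)"

section \<open>The algebra of a reduced datum\<close>

text \<open>
  The basis of \<open>V \<oplus> W\<close> is indexed by \<open>'n + 'n\<close>, with \<open>Inl i\<close> for \<open>v\<^sub>i\<close> and \<open>Inr i\<close> for \<open>w\<^sub>i\<close>.
\<close>

definition inverse_characters :: "('n \<Rightarrow> 'g \<Rightarrow> 'k::field) \<Rightarrow> 'n \<Rightarrow> 'g \<Rightarrow> 'k"
  where "inverse_characters \<chi> i g = inverse (\<chi> i g)"

definition VW_bosonization ::
    "('n \<Rightarrow> 'g::ab_group_add \<Rightarrow> 'k::field) \<Rightarrow> ('k, ('n + 'n) list \<times> 'g \<Rightarrow>\<^sub>0 'k) module"
  where "VW_bosonization \<chi> = bosonization (case_sum \<chi> (inverse_characters \<chi>))"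

definition tensor_inclusion :: "('i \<Rightarrow> 'j) \<Rightarrow> ('i list \<Rightarrow>\<^sub>0 'k::field) \<Rightarrow> ('j list \<times> 'g::zero \<Rightarrow>\<^sub>0 'k)"
  where "tensor_inclusion f = linear_extension (\<lambda>w. Poly_Mapping.single (map f w, 0) 1)"

definition group_inclusion :: "('g \<Rightarrow>\<^sub>0 'k::field) \<Rightarrow> ('j list \<times> 'g \<Rightarrow>\<^sub>0 'k)"
  where "group_inclusion = linear_extension (\<lambda>g. Poly_Mapping.single ([], g) 1)"

definition v_gen :: "'n \<Rightarrow> (('n + 'n) list \<times> 'g::zero \<Rightarrow>\<^sub>0 'k::field)"
  where "v_gen i = Poly_Mapping.single ([Inl i], 0) 1"

definition w_gen :: "'n \<Rightarrow> (('n + 'n) list \<times> 'g::zero \<Rightarrow>\<^sub>0 'k::field)"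
  where "w_gen i = Poly_Mapping.single ([Inr i], 0) 1"

definition linking_relation ::
    "('n \<Rightarrow> 'g::ab_group_add) \<Rightarrow> ('n \<Rightarrow> 'g) \<Rightarrow> ('n \<Rightarrow> 'g \<Rightarrow> 'k::field) \<Rightarrow> ('n \<Rightarrow> 'k) \<Rightarrow>
      'n \<Rightarrow> 'n \<Rightarrow> (('n + 'n) list \<times> 'g \<Rightarrow>\<^sub>0 'k)"
  where "linking_relation L K \<chi> l i j =
    v_gen i \<otimes>\<^bsub>VW_bosonization \<chi>\<^esub> w_gen j
    - pm_scale (inverse (\<chi> j (K i))) (w_gen j \<otimes>\<^bsub>VW_bosonization \<chi>\<^esub> v_gen i)
    - (if i = j then pm_scale (l i) (Poly_Mapping.single ([], K i + L i) 1
        - \<one>\<^bsub>VW_bosonization \<chi>\<^esub>) else 0)"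

definition U_relations ::
    "('n \<Rightarrow> 'g::ab_group_add) \<Rightarrow> ('n \<Rightarrow> 'g) \<Rightarrow> ('n \<Rightarrow> 'g \<Rightarrow> 'k::field) \<Rightarrow> ('n \<Rightarrow> 'k) \<Rightarrow>
      (('n + 'n) list \<times> 'g \<Rightarrow>\<^sub>0 'k) set"
  where "U_relations L K \<chi> l =
    tensor_inclusion Inl ` nichols_ideal K \<chi> \<union>
    tensor_inclusion Inr ` nichols_ideal L (inverse_characters \<chi>) \<union>
    {linking_relation L K \<chi> l i j | i j. True}"

definition U_ideal ::
    "('n \<Rightarrow> 'g::ab_group_add) \<Rightarrow> ('n \<Rightarrow> 'g) \<Rightarrow> ('n \<Rightarrow> 'g \<Rightarrow> 'k::field) \<Rightarrow> ('n \<Rightarrow> 'k) \<Rightarrow>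
      (('n + 'n) list \<times> 'g \<Rightarrow>\<^sub>0 'k) set"
  where "U_ideal L K \<chi> l = Idl\<^bsub>VW_bosonization \<chi>\<^esub> (U_relations L K \<chi> l)"

definition U_algebra ::
    "('n \<Rightarrow> 'g::ab_group_add) \<Rightarrow> ('n \<Rightarrow> 'g) \<Rightarrow> ('n \<Rightarrow> 'g \<Rightarrow> 'k::field) \<Rightarrow> ('n \<Rightarrow> 'k) \<Rightarrow>
      ('k, (('n + 'n) list \<times> 'g \<Rightarrow>\<^sub>0 'k) set) module"
  where "U_algebra L K \<chi> l = quotient_algebra (VW_bosonization \<chi>) (U_ideal L K \<chi> l)"

definition group_algebra_to_U ::
    "('n \<Rightarrow> 'g::ab_group_add) \<Rightarrow> ('n \<Rightarrow> 'g) \<Rightarrow> ('n \<Rightarrow> 'g \<Rightarrow> 'k::field) \<Rightarrow> ('n \<Rightarrow> 'k) \<Rightarrow>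
      ('g \<Rightarrow>\<^sub>0 'k) \<Rightarrow> (('n + 'n) list \<times> 'g \<Rightarrow>\<^sub>0 'k) set"
  where "group_algebra_to_U L K \<chi> l p =
    U_ideal L K \<chi> l +>\<^bsub>VW_bosonization \<chi>\<^esub> group_inclusion p"

section \<open>Well-definedness\<close>

text \<open>
  The ideals above live in genuine rings, and \<open>nichols_ideal\<close> is the largest
  \<open>\<nat>\<close>-graded ideal and coideal meeting \<open>V\<close> in \<open>0\<close>.
\<close>

lemma poly_mapping_sum_single:
  fixes p :: "'a \<Rightarrow>\<^sub>0 'b::comm_monoid_add"
  shows "p = (\<Sum>a\<in>Poly_Mapping.keys p. Poly_Mapping.single a (Poly_Mapping.lookup p a))"
proof (rule poly_mapping_eqI)
  fix k
  have "(\<Sum>a\<in>Poly_Mapping.keys p. Poly_Mapping.lookup (Poly_Mapping.single a (Poly_Mapping.lookup p a)) k) = (\<Sum>a\<in>Poly_Mapping.keys p. if a = k then Poly_Mapping.lookup p k else 0)"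
    by (rule sum.cong) (auto simp: lookup_single when_def)
  also have "\<dots> = Poly_Mapping.lookup p k" by (auto simp: in_keys_iff)
  finally show "Poly_Mapping.lookup p k = Poly_Mapping.lookup (\<Sum>a\<in>Poly_Mapping.keys p. Poly_Mapping.single a (Poly_Mapping.lookup p a)) k" by (simp add: lookup_sum)
qed

lemma poly_mapping_additive_induct:
  fixes p :: "'a \<Rightarrow>\<^sub>0 'b::comm_monoid_add"
  assumes "\<And>a c. P (Poly_Mapping.single a c)" "P 0" "\<And>p q. P p \<Longrightarrow> P q \<Longrightarrow> P (p + q)"
  shows "P p"
proof -
  have "P (\<Sum>a\<in>A. Poly_Mapping.single a (Poly_Mapping.lookup p a))" if "finite A" for A
    using that by (induction A) (auto intro: assms)
  then show ?thesis by (subst poly_mapping_sum_single) simp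
qed

lemma twisted_mult_superset:
  assumes "finite A" "finite B" "Poly_Mapping.keys p \<subseteq> A" "Poly_Mapping.keys q \<subseteq> B"
  shows "p \<otimes>\<^bsub>twisted_algebra m e \<sigma>\<^esub> q = (\<Sum>a\<in>A. \<Sum>b\<in>B. Poly_Mapping.single (m a b) (\<sigma> a b * Poly_Mapping.lookup p a * Poly_Mapping.lookup q b))"
proof -
  have "(\<Sum>a\<in>A. \<Sum>b\<in>B. Poly_Mapping.single (m a b) (\<sigma> a b * Poly_Mapping.lookup p a * Poly_Mapping.lookup q b))
     = (\<Sum>a\<in>A. \<Sum>b\<in>Poly_Mapping.keys q. Poly_Mapping.single (m a b) (\<sigma> a b * Poly_Mapping.lookup p a * Poly_Mapping.lookup q b))"
    by (intro sum.cong refl sum.mono_neutral_right assms) (auto simp: in_keys_iff)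
  also have "\<dots> = (\<Sum>a\<in>Poly_Mapping.keys p. \<Sum>b\<in>Poly_Mapping.keys q. Poly_Mapping.single (m a b) (\<sigma> a b * Poly_Mapping.lookup p a * Poly_Mapping.lookup q b))"
    by (intro sum.mono_neutral_right assms) (auto simp: in_keys_iff)
  finally show ?thesis by (simp add: twisted_algebra_def)
qed

lemma twisted_mult_single [simp]:
  "Poly_Mapping.single a x \<otimes>\<^bsub>twisted_algebra m e \<sigma>\<^esub> Poly_Mapping.single b y = Poly_Mapping.single (m a b) (\<sigma> a b * x * y)"
  by (subst twisted_mult_superset[of "{a}" "{b}"]) auto

lemma twisted_mult_add_left:
  "(p + p') \<otimes>\<^bsub>twisted_algebra m e \<sigma>\<^esub> q
    = p \<otimes>\<^bsub>twisted_algebra m e \<sigma>\<^esub> q + p' \<otimes>\<^bsub>twisted_algebra m e \<sigma>\<^esub> q"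
proof -
  let ?A = "Poly_Mapping.keys p \<union> Poly_Mapping.keys p'"
  have "Poly_Mapping.keys (p + p') \<subseteq> ?A" by (rule keys_add)
  then show ?thesis
    by (simp add: twisted_mult_superset[of ?A "Poly_Mapping.keys q"] lookup_add algebra_simps single_add sum.distrib)
qed

lemma twisted_mult_add_right:
  "q \<otimes>\<^bsub>twisted_algebra m e \<sigma>\<^esub> (p + p')
    = q \<otimes>\<^bsub>twisted_algebra m e \<sigma>\<^esub> p + q \<otimes>\<^bsub>twisted_algebra m e \<sigma>\<^esub> p'"
proof -
  let ?A = "Poly_Mapping.keys p \<union> Poly_Mapping.keys p'"
  have "Poly_Mapping.keys (p + p') \<subseteq> ?A" by (rule keys_add)
  then show ?thesis
    by (simp add: twisted_mult_superset[of "Poly_Mapping.keys q" ?A] lookup_add algebra_simps single_add sum.distrib)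
qed

lemma twisted_mult_zero [simp]:
  "0 \<otimes>\<^bsub>twisted_algebra m e \<sigma>\<^esub> q = 0" "q \<otimes>\<^bsub>twisted_algebra m e \<sigma>\<^esub> 0 = 0"
  by (simp_all add: twisted_algebra_def)

lemma twisted_mult_scale:
  "pm_scale c p \<otimes>\<^bsub>twisted_algebra m e \<sigma>\<^esub> q = pm_scale c (p \<otimes>\<^bsub>twisted_algebra m e \<sigma>\<^esub> q)"
  "p \<otimes>\<^bsub>twisted_algebra m e \<sigma>\<^esub> pm_scale c q = pm_scale c (p \<otimes>\<^bsub>twisted_algebra m e \<sigma>\<^esub> q)"
proof -
  have s: "pm_scale c (Poly_Mapping.single x y) = Poly_Mapping.single x (c * y)" for x :: 'a and y
    by (rule poly_mapping_eqI) (simp add: lookup_single when_def)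
  have k: "Poly_Mapping.keys (pm_scale c r) \<subseteq> Poly_Mapping.keys r" for r :: "'a \<Rightarrow>\<^sub>0 'b" by (auto simp: in_keys_iff)
  show "pm_scale c p \<otimes>\<^bsub>twisted_algebra m e \<sigma>\<^esub> q = pm_scale c (p \<otimes>\<^bsub>twisted_algebra m e \<sigma>\<^esub> q)"
    using k[of p] by (simp add: twisted_mult_superset[of "Poly_Mapping.keys p" "Poly_Mapping.keys q"] pm.scale_sum_right s algebra_simps)
  show "p \<otimes>\<^bsub>twisted_algebra m e \<sigma>\<^esub> pm_scale c q = pm_scale c (p \<otimes>\<^bsub>twisted_algebra m e \<sigma>\<^esub> q)"
    using k[of q] by (simp add: twisted_mult_superset[of "Poly_Mapping.keys p" "Poly_Mapping.keys q"] pm.scale_sum_right s algebra_simps)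
qed

lemma twisted_algebra_ring:
  assumes "\<And>a b c. m (m a b) c = m a (m b c)" "\<And>a. m e a = a" "\<And>a. m a e = a"
    and "\<And>a b c. \<sigma> a b * \<sigma> (m a b) c = \<sigma> a (m b c) * \<sigma> b c"
    and "\<And>a. \<sigma> e a = 1" "\<And>a. \<sigma> a e = 1"
  shows "ring (twisted_algebra m e \<sigma>)"
proof -
  let ?R = "twisted_algebra m e \<sigma>"
  have ab: "abelian_group ?R"
    by (rule abelian_groupI) (auto simp: algebra_simps intro: exI[of _ "- _"] add.left_inverse)
  have one_l: "\<one>\<^bsub>?R\<^esub> \<otimes>\<^bsub>?R\<^esub> p = p" for p
    by (induction p rule: poly_mapping_additive_induct) (auto simp: assms twisted_mult_add_right)
  have one_r: "p \<otimes>\<^bsub>?R\<^esub> \<one>\<^bsub>?R\<^esub> = p" for p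
    by (induction p rule: poly_mapping_additive_induct) (auto simp: assms twisted_mult_add_left)
  have assoc0: "\<sigma> (m a b) c * (\<sigma> a b * x * y) * z = \<sigma> a (m b c) * x * (\<sigma> b c * y * z)" for a b c x y z
  proof -
    have "\<sigma> (m a b) c * (\<sigma> a b * x * y) * z = (\<sigma> a b * \<sigma> (m a b) c) * (x * y * z)"
      by (simp only: ac_simps)
    then show ?thesis by (simp only: assms(4) ac_simps)
  qed
  have assoc: "(p \<otimes>\<^bsub>?R\<^esub> q) \<otimes>\<^bsub>?R\<^esub> r = p \<otimes>\<^bsub>?R\<^esub> (q \<otimes>\<^bsub>?R\<^esub> r)" for p q r
  proof (induction p rule: poly_mapping_additive_induct)
    case (1 a x)
    show ?case
    proof (induction q rule: poly_mapping_additive_induct)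
      case (1 b y)
      show ?case
        by (induction r rule: poly_mapping_additive_induct)
          (auto simp: assms(1) assoc0 twisted_mult_add_right)
    qed (auto simp: twisted_mult_add_left twisted_mult_add_right)
  qed (auto simp: twisted_mult_add_left)
  show ?thesis
    by (rule ringI[OF ab]) (auto intro!: monoidI simp del: twisted_algebra_sel(2)
       simp: one_l one_r assoc twisted_mult_add_left twisted_mult_add_right)
qed

lemma tensor_algebra_ring: "ring tensor_algebra"
  unfolding tensor_algebra_def by (rule twisted_algebra_ring) auto

lemma word_character_simps [simp]:
  "word_character c [] g = 1"
  "word_character c (u @ v) g = word_character c u g * word_character c v g"
  by (simp_all add: word_character_def)

lemma word_character_char:
  assumes "\<And>i. is_character (c i)"
  shows "is_character (word_character c w)"
  using assms unfolding is_character_def word_character_def by (induction w) auto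

lemma bosonization_ring:
  assumes "\<And>i. is_character (c i)" shows "ring (bosonization c)"
proof -
  have "word_character c w 0 = 1" "word_character c w (g + h) = word_character c w g * word_character c w h"
    for w g h using word_character_char[of c w] assms by (auto simp: is_character_def)
  then show ?thesis
    unfolding bosonization_def by (intro twisted_algebra_ring) (auto simp: ac_simps)
qed

lemma braided_square_ring:
  assumes "\<And>i. is_character (c i)" shows "ring (braided_square d c)"
proof -
  have "word_character c w 0 = 1" "word_character c w (g + h) = word_character c w g * word_character c w h"
    for w g h using word_character_char[of c w] assms by (auto simp: is_character_def)
  then show ?thesis
    unfolding braided_square_def
    by (intro twisted_algebra_ring) (auto simp: word_degree_def ac_simps)
qed

lemma linear_extension_superset:
  assumes "finite A" "Poly_Mapping.keys p \<subseteq> A"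
  shows "linear_extension f p = (\<Sum>a\<in>A. pm_scale (Poly_Mapping.lookup p a) (f a))"
  unfolding linear_extension_def using assms
  by (intro sum.mono_neutral_left) (auto simp: in_keys_iff)

lemma linear_extension_add: "linear_extension f (p + q) = linear_extension f p + linear_extension f q"
proof -
  have "Poly_Mapping.keys (p + q) \<subseteq> Poly_Mapping.keys p \<union> Poly_Mapping.keys q" by (rule keys_add)
  then show ?thesis
    by (simp add: linear_extension_superset[of "Poly_Mapping.keys p \<union> Poly_Mapping.keys q"] lookup_add
       pm.scale_left_distrib sum.distrib)
qed

lemma linear_extension_scale: "linear_extension f (pm_scale c p) = pm_scale c (linear_extension f p)"
proof -
  have "Poly_Mapping.keys (pm_scale c p) \<subseteq> Poly_Mapping.keys p" by (auto simp: in_keys_iff)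
  then show ?thesis
    by (simp add: linear_extension_superset[of "Poly_Mapping.keys p"] pm.scale_sum_right)
qed

lemma lookup_homogeneous_component [simp]:
  "Poly_Mapping.lookup (homogeneous_component n p) w = (if length w = n then Poly_Mapping.lookup p w else 0)"
proof -
  have "Poly_Mapping.lookup (homogeneous_component n p) w
     = (\<Sum>u | u \<in> Poly_Mapping.keys p \<and> length u = n. if u = w then Poly_Mapping.lookup p w else 0)"
    unfolding homogeneous_component_def lookup_sum
    by (rule sum.cong) (auto simp: lookup_single when_def)
  also have "\<dots> = (if length w = n then Poly_Mapping.lookup p w else 0)"
    by (auto simp: in_keys_iff)
  finally show ?thesis .
qed

lemma homogeneous_component_add:
  "homogeneous_component n (p + q) = homogeneous_component n p + homogeneous_component n q"
  by (rule poly_mapping_eqI) (simp add: lookup_add)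

lemma homogeneous_component_scale:
  "homogeneous_component n (pm_scale c p) = pm_scale c (homogeneous_component n p)"
  by (rule poly_mapping_eqI) simp

lemma homogeneous_component_zero [simp]: "homogeneous_component n 0 = 0"
  by (rule poly_mapping_eqI) simp

lemma homogeneous_component_in: "homogeneous_component n p \<in> homogeneous n"
  by (auto simp: homogeneous_def in_keys_iff split: if_splits)

lemma homogeneous_component_id: "p \<in> homogeneous n \<Longrightarrow> homogeneous_component n p = p"
  by (rule poly_mapping_eqI) (auto simp: homogeneous_def in_keys_iff)

lemma zero_admissible: "nichols_admissible d c {0}"
proof -
  interpret ring tensor_algebra by (rule tensor_algebra_ring)
  have "ideal {0} tensor_algebra" using zeroideal by (simp add: tensor_algebra_def)
  moreover have "comult d c 0 = 0" by (simp add: comult_def linear_extension_def)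
  ultimately show ?thesis
    by (auto simp: nichols_admissible_def graded_subspace_def coideal_def pm.subspace_def
        counit_def pm.span_zero homogeneous_def)
qed

theorem nichols_ideal_greatest:
  "nichols_admissible d c (nichols_ideal d c)"
  "nichols_admissible d c I \<Longrightarrow> I \<subseteq> nichols_ideal d c"
proof -
  let ?N = "nichols_ideal d c" and ?U = "\<Union>{I. nichols_admissible d c I}"
  let ?T = "tensor_algebra :: ('c, 'a list \<Rightarrow>\<^sub>0 'c) module"
  show sub: "I \<subseteq> ?N" if "nichols_admissible d c I" for I
    using that by (auto simp: nichols_ideal_def intro: pm.span_base)
  have sN: "pm.subspace ?N" by (simp add: nichols_ideal_def)
  have hom: "f p \<in> X" if "p \<in> ?N" "pm.subspace X" "\<And>x y. f (x + y) = f x + f y"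
      "\<And>c x. f (pm_scale c x) = pm_scale c (f x)" 
      "\<And>I x. nichols_admissible d c I \<Longrightarrow> x \<in> I \<Longrightarrow> f x \<in> X"
    for f :: "('a list \<Rightarrow>\<^sub>0 'c) \<Rightarrow> ('z \<Rightarrow>\<^sub>0 'c)" and p X
  proof -
    have "f 0 = 0" using that(4)[of 0 0] by simp
    have "p \<in> pm.span ?U" using that(1) by (simp add: nichols_ideal_def)
    then show ?thesis
    proof (induction rule: pm.span_induct_alt)
      case base
      then show ?case using \<open>f 0 = 0\<close> that(2) pm.subspace_0 by simp
    next
      case (step a x y)
      then show ?case using that by (auto simp: pm.subspace_add pm.subspace_scale)
    qed
  qed
  have id: "ideal ?N ?T"
  proof (rule idealI)
    show "ring ?T" by (rule tensor_algebra_ring)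
    then interpret ring ?T .
    show "subgroup ?N (add_monoid ?T)"
    proof (rule add.subgroupI)
      fix p assume p: "p \<in> ?N"
      have "\<ominus>\<^bsub>?T\<^esub> p = - p"
        by (rule minus_equality) (auto simp: tensor_algebra_def)
      then show "\<ominus>\<^bsub>?T\<^esub> p \<in> ?N" using p sN pm.subspace_neg by simp
    qed (use pm.subspace_0[OF sN] pm.subspace_add[OF sN] in \<open>auto simp: tensor_algebra_def\<close>)
    fix p x assume p: "p \<in> ?N"
    show "x \<otimes>\<^bsub>?T\<^esub> p \<in> ?N"
    proof (rule hom[OF p sN])
      fix I y assume *: "nichols_admissible d c I" "y \<in> I"
      then interpret I: ideal I ?T by (simp add: nichols_admissible_def)
      have "x \<otimes>\<^bsub>?T\<^esub> y \<in> I" by (rule I.I_l_closed) (use * in \<open>auto simp: tensor_algebra_def\<close>)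
      then show "x \<otimes>\<^bsub>?T\<^esub> y \<in> ?N" using sub * by blast
    qed (simp_all add: tensor_algebra_def twisted_mult_add_right twisted_mult_scale)
    show "p \<otimes>\<^bsub>?T\<^esub> x \<in> ?N"
    proof (rule hom[OF p sN])
      fix I y assume *: "nichols_admissible d c I" "y \<in> I"
      then interpret I: ideal I ?T by (simp add: nichols_admissible_def)
      have "y \<otimes>\<^bsub>?T\<^esub> x \<in> I" by (rule I.I_r_closed) (use * in \<open>auto simp: tensor_algebra_def\<close>)
      then show "y \<otimes>\<^bsub>?T\<^esub> x \<in> ?N" using sub * by blast
    qed (simp_all add: tensor_algebra_def twisted_mult_add_left twisted_mult_scale)
  qed
  have gr: "homogeneous_component n p \<in> ?N" if "p \<in> ?N" for p n
    by (rule hom[OF that sN])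
      (use sub in \<open>auto simp: homogeneous_component_add homogeneous_component_scale
        nichols_admissible_def graded_subspace_def\<close>)
  have cu: "homogeneous_component 0 p \<in> {0}" if "p \<in> ?N" for p
  proof (rule hom[OF that])
    fix I x assume "nichols_admissible d c I" "x \<in> I"
    then have "Poly_Mapping.lookup x [] = 0" by (simp add: nichols_admissible_def coideal_def counit_def)
    then show "homogeneous_component 0 x \<in> {0}" by (auto intro!: poly_mapping_eqI)
  qed (auto simp: homogeneous_component_add homogeneous_component_scale)
  have cu': "counit p = 0" if "p \<in> ?N" for p
    using cu[OF that] lookup_homogeneous_component[of 0 p "[]"] by (simp add: counit_def)
  have one: "homogeneous_component 1 p \<in> {0}" if "p \<in> ?N" for p
  proof (rule hom[OF that])
    fix I x assume "nichols_admissible d c I" "x \<in> I"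
    then have "homogeneous_component 1 x \<in> I \<inter> homogeneous 1" "I \<inter> homogeneous 1 = {0}"
      using homogeneous_component_in[of 1 x]
      by (auto simp: nichols_admissible_def graded_subspace_def)
    then show "homogeneous_component 1 x \<in> {0}" by blast
  qed (auto simp: homogeneous_component_add homogeneous_component_scale)
  have com: "comult d c p \<in> pm.span {pure_tensor x y | x y. x \<in> ?N \<or> y \<in> ?N}" if "p \<in> ?N" for p
  proof (rule hom[OF that])
    fix I x assume *: "nichols_admissible d c I" "x \<in> I"
    then have "comult d c x \<in> pm.span {pure_tensor x y | x y. x \<in> I \<or> y \<in> I}"
      by (simp add: nichols_admissible_def coideal_def)
    also have "\<dots> \<subseteq> pm.span {pure_tensor x y | x y. x \<in> ?N \<or> y \<in> ?N}"
      using sub[OF *(1)] by (intro pm.span_mono) blast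
    finally show "comult d c x \<in> \<dots>" .
  qed (auto simp: comult_def linear_extension_add linear_extension_scale)
  have "?N \<inter> homogeneous 1 = {0}"
    using one homogeneous_component_id pm.subspace_0[OF sN] by (fastforce simp: homogeneous_def)
  then show "nichols_admissible d c ?N"
    using id sN gr cu' com by (simp add: nichols_admissible_def graded_subspace_def coideal_def)
qed

end

theory Submission
  imports Defs
begin

text \<open>
  Let \<open>q\<^sub>i\<^sub>j = \<chi>\<^sub>j(K\<^sub>i)\<close>.  The Nichols ideals of \<open>V\<close> and \<open>W\<close> contain the radical of one symmetric form on
  words, so a generalised inverse of the Gram matrix of this form is a canonical element of
  \<open>T(W) \<otimes> T(V)\<close> modulo these ideals.  Letting it act on a finite-dimensional weight module gives a
  Casimir operator \<open>\<Omega>\<close>, which fixes singular vectors and commutes with the generators up to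
  scalars that are read off the weights.  Hence \<open>\<Omega>\<close> is a scalar on each weight space of the
  submodule generated by a singular vector \<open>v\<close>.  If the weights of \<open>v\<close> and \<open>F\<^sub>w v\<close> are both dominant, the
  square of this scalar is a product of positive powers of the \<open>q\<^sub>s\<^sub>s\<close>, where \<open>s\<close> runs through \<open>w\<close>.
  As such products can cancel between different components of the diagram (say \<open>q\<close> and \<open>q\<^sup>-\<^sup>1\<close>), there
  is one operator for each class of indices \<open>s\<close> whose \<open>q\<^sub>s\<^sub>s\<close> have a common positive power; its scalar
  is then different from \<open>1\<close>.  It follows that singular vectors generate simple submodules, and that a
  vector which is singular modulo the sum of these can be corrected to a singular one, so that
  this sum is everything.
\<close>

section \<open>The symmetric form on words\<close>

text \<open>The form is degenerate, so its Gram matrix S has no inverse and words have no dual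
  basis. A matrix A with S A S = S suffices, because A is only ever contracted with S or with
  operators that kill the radical; everything stays on the level of words and no basis of a Nichols
  algebra is chosen. If v has weight \<lambda> and F_w v has weight \<mu>, the scalar of \<Omega>
  plays the role of q to the power (\<lambda> + \<rho>, \<lambda> + \<rho>) - (\<mu> + \<rho>, \<mu>
  + \<rho>) = (\<lambda> - \<mu>, \<lambda> + \<mu> + 2 \<rho>). The right-hand side explains the
  square: there \<lambda> and \<mu> enter symmetrically, and every letter s of w contributes a value
  of each of them and one of 2 \<rho>. The last one keeps the exponent positive even if both
  dominant values are trivial. Cartan type enters because \<open>q i j * q j i\<close> is a power of
  both \<open>q i i\<close> and \<open>q j j\<close>, so that letters of different classes are
  orthogonal. Regularity makes the letters of w a function of the weight, so that a letter of one
  word of given weight occurs in all of them.\<close>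

definition letter_word :: "('n \<Rightarrow> 'n \<Rightarrow> 'k::field) \<Rightarrow> 'n \<Rightarrow> 'n list \<Rightarrow> 'k"
  where "letter_word q i u = prod_list (map (\<lambda>j. q i j) u)"

text \<open>For \<open>q i j\<close> = \<chi>_j(K_i), \<open>letter_word q i u\<close> is the
  character of u at K_i and \<open>word_letter q u i\<close> the character of i at the degree of u.
  The matrix is not symmetric, so both occur; their product is the character of u at K_i
  L_i.\<close>

definition word_letter :: "('n \<Rightarrow> 'n \<Rightarrow> 'k::field) \<Rightarrow> 'n list \<Rightarrow> 'n \<Rightarrow> 'k"
  where "word_letter q u i = prod_list (map (\<lambda>j. q j i) u)"

lemma letter_word_simps [simp]:
  "letter_word q i [] = 1"
  "letter_word q i (j # u) = q i j * letter_word q i u"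
  "letter_word q i (u @ v) = letter_word q i u * letter_word q i v"
  by (simp_all add: letter_word_def)

lemma word_letter_simps [simp]:
  "word_letter q [] i = 1"
  "word_letter q (j # u) i = q j i * word_letter q u i"
  "word_letter q (u @ v) i = word_letter q u i * word_letter q v i"
  by (simp_all add: word_letter_def)

lemma prod_list_map_mset_cong:
  fixes f :: "'a \<Rightarrow> 'b::comm_monoid_mult"
  assumes "mset u = mset v"
  shows "prod_list (map f u) = prod_list (map f v)"
  by (metis assms mset_map prod_mset_prod_list)

lemma letter_word_mset_cong: "mset u = mset v \<Longrightarrow> letter_word q i u = letter_word q i v"
  unfolding letter_word_def by (rule prod_list_map_mset_cong)

lemma word_letter_mset_cong: "mset u = mset v \<Longrightarrow> word_letter q u i = word_letter q v i"
  unfolding word_letter_def by (rule prod_list_map_mset_cong)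

lemma letter_word_nonzero: "(\<And>i j. q i j \<noteq> 0) \<Longrightarrow> letter_word q i u \<noteq> 0"
  by (induction u) auto

lemma word_letter_nonzero: "(\<And>i j. q i j \<noteq> 0) \<Longrightarrow> word_letter q u i \<noteq> 0"
  by (induction u) auto

text \<open>
  Applied to a linear functional \<open>f\<close> on the tensor algebra, these are \<open>f \<circ> \<partial>\<close> for the right and
  the left skew derivation \<open>\<partial>\<close> of the letter \<open>i\<close>.
\<close>

primrec right_deriv ::
    "('n \<Rightarrow> 'n \<Rightarrow> 'k::field) \<Rightarrow> ('k \<Rightarrow> 'a \<Rightarrow> 'a::ab_group_add) \<Rightarrow> 'n \<Rightarrow> 'n list \<Rightarrow> ('n list \<Rightarrow> 'a) \<Rightarrow> 'a"
  where
    "right_deriv q s i [] f = 0"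
  | "right_deriv q s i (j # u) f = (if i = j then s (letter_word q i u) (f u) else 0)
      + right_deriv q s i u (\<lambda>y. f (j # y))"

primrec left_deriv ::
    "('n \<Rightarrow> 'n \<Rightarrow> 'k::field) \<Rightarrow> ('k \<Rightarrow> 'a \<Rightarrow> 'a::ab_group_add) \<Rightarrow> 'n \<Rightarrow> 'n list \<Rightarrow> ('n list \<Rightarrow> 'a) \<Rightarrow> 'a"
  where
    "left_deriv q s i [] f = 0"
  | "left_deriv q s i (j # u) f = (if i = j then f u else 0)
      + s (q j i) (left_deriv q s i u (\<lambda>y. f (j # y)))"

text \<open>The derivation evaluates its argument only at u with one i deleted. Restricting the
  hypothesis to such words allows scalars that depend only on the letters to be exchanged under a
  derivation.\<close>

lemma right_deriv_cong:
  assumes "\<And>y. add_mset i (mset y) = mset u \<Longrightarrow> f y = g y"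
  shows "right_deriv q s i u f = right_deriv q s i u g"
  using assms
proof (induction u arbitrary: f g)
  case (Cons j u)
  have "right_deriv q s i u (\<lambda>y. f (j # y)) = right_deriv q s i u (\<lambda>y. g (j # y))"
    by (rule Cons.IH, rule Cons.prems) (simp add: add_mset_commute)
  moreover have "f u = g u" if "i = j" using Cons.prems[of u] that by simp
  ultimately show ?case by simp
qed simp

lemma left_deriv_cong:
  assumes "\<And>y. add_mset i (mset y) = mset u \<Longrightarrow> f y = g y"
  shows "left_deriv q s i u f = left_deriv q s i u g"
  using assms
proof (induction u arbitrary: f g)
  case (Cons j u)
  have "left_deriv q s i u (\<lambda>y. f (j # y)) = left_deriv q s i u (\<lambda>y. g (j # y))"
    by (rule Cons.IH, rule Cons.prems) (simp add: add_mset_commute)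
  moreover have "f u = g u" if "i = j" using Cons.prems[of u] that by simp
  ultimately show ?case by simp
qed simp

context vector_space
begin

lemma deriv_zero [simp]:
  "right_deriv q scale i u (\<lambda>_. 0) = 0" "left_deriv q scale i u (\<lambda>_. 0) = 0"
  by (induction u) auto

lemma deriv_add:
  "right_deriv q scale i u (\<lambda>y. f y + g y) = right_deriv q scale i u f + right_deriv q scale i u g"
  "left_deriv q scale i u (\<lambda>y. f y + g y) = left_deriv q scale i u f + left_deriv q scale i u g"
  by (induction u arbitrary: f g) (simp_all add: scale_right_distrib add_ac)

lemma deriv_sum:
  "right_deriv q scale i u (\<lambda>y. \<Sum>a\<in>A. f a y) = (\<Sum>a\<in>A. right_deriv q scale i u (f a))"
  "left_deriv q scale i u (\<lambda>y. \<Sum>a\<in>A. f a y) = (\<Sum>a\<in>A. left_deriv q scale i u (f a))"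
  by (induction A rule: infinite_finite_induct) (auto simp: deriv_add)

lemma deriv_in_subspace:
  assumes "subspace N" "\<And>y. f y \<in> N"
  shows "right_deriv q scale i u f \<in> N" "left_deriv q scale i u f \<in> N"
  using assms(2) by (induction u arbitrary: f)
    (auto intro!: subspace_add[OF assms(1)] subspace_scale[OF assms(1)] simp: subspace_0[OF assms(1)])

end

lemma (in vector_space_pair) deriv_linear:
  assumes "Vector_Spaces.linear s1 s2 h"
  shows "right_deriv q s2 i u (\<lambda>y. h (f y)) = h (right_deriv q s1 i u f)"
    "left_deriv q s2 i u (\<lambda>y. h (f y)) = h (left_deriv q s1 i u f)"
proof -
  interpret h: Vector_Spaces.linear s1 s2 h by fact
  show "right_deriv q s2 i u (\<lambda>y. h (f y)) = h (right_deriv q s1 i u f)"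
    "left_deriv q s2 i u (\<lambda>y. h (f y)) = h (left_deriv q s1 i u f)"
    by (induction u arbitrary: f) (auto simp: h.add h.scale h.zero)
qed

text \<open>An interpretation would turn associativity of the product into a simplification rule.\<close>

lemma vector_space_field: "vector_space ((*) :: 'k::field \<Rightarrow> 'k \<Rightarrow> 'k)"
  by unfold_locales (auto simp: algebra_simps)

lemmas field_deriv_zero [simp] = vector_space.deriv_zero[OF vector_space_field]
lemmas field_deriv_add = vector_space.deriv_add[OF vector_space_field]

abbreviation rderiv :: "('n \<Rightarrow> 'n \<Rightarrow> 'k::field) \<Rightarrow> 'n \<Rightarrow> 'n list \<Rightarrow> ('n list \<Rightarrow> 'k) \<Rightarrow> 'k"
  where "rderiv q \<equiv> right_deriv q (*)"

abbreviation lderiv :: "('n \<Rightarrow> 'n \<Rightarrow> 'k::field) \<Rightarrow> 'n \<Rightarrow> 'n list \<Rightarrow> ('n list \<Rightarrow> 'k) \<Rightarrow> 'k"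
  where "lderiv q \<equiv> left_deriv q (*)"

lemma deriv_mult_left:
  "rderiv q i u (\<lambda>y. c * f y) = c * rderiv q i u f"
  "lderiv q i u (\<lambda>y. c * f y) = c * lderiv q i u f"
  by (induction u arbitrary: f) (simp_all add: distrib_left mult.left_commute)

lemma (in vector_space) deriv_scale_vector:
  "right_deriv q scale i u (\<lambda>y. scale (f y) z) = scale (rderiv q i u f) z"
  "left_deriv q scale i u (\<lambda>y. scale (f y) z) = scale (lderiv q i u f) z"
  by (induction u arbitrary: f) (simp_all add: scale_left_distrib)

lemma rderiv_interchange:
  "rderiv q j y0 (\<lambda>y. rderiv q i x0 (\<lambda>x. f x y)) = rderiv q i x0 (\<lambda>x. rderiv q j y0 (f x))"
  by (induction y0 arbitrary: f) (auto simp: field_deriv_add deriv_mult_left)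

text \<open>Every word y that is evaluated here lacks one i of u, so
  \<open>q j i * letter_word q j y\<close> is \<open>letter_word q j u\<close>. With the factor on
  this side no division is required.\<close>

lemma lderiv_letter_word:
  "q j i * lderiv q i u (\<lambda>y. letter_word q j y * f y) = letter_word q j u * lderiv q i u f"
proof (induction u arbitrary: f)
  case (Cons k u)
  let ?A = "lderiv q i u (\<lambda>y. letter_word q j y * f (k # y))"
  let ?B = "lderiv q i u (\<lambda>y. f (k # y))"
  have 1: "lderiv q i u (\<lambda>y. letter_word q j (k # y) * f (k # y)) = q j k * ?A"
    by (simp add: deriv_mult_left mult.assoc)
  have "q j i * (q k i * (q j k * ?A)) = q k i * q j k * (q j i * ?A)"
    by (simp only: ac_simps)
  also have "\<dots> = q j k * letter_word q j u * (q k i * ?B)"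
    by (subst Cons) (simp only: ac_simps)
  finally have "q j i * (q k i * (q j k * ?A)) = q j k * letter_word q j u * (q k i * ?B)" .
  then show ?case
    unfolding left_deriv.simps 1 distrib_left by (cases "i = k") (simp_all add: mult.assoc)
qed simp

text \<open>The right derivation counts the letters behind the deleted j, the left one those in
  front of the deleted i. Whichever is applied first, a j in front of an i contributes
  \<open>q j i\<close> exactly once, and a j behind it nothing.\<close>

lemma rderiv_lderiv:
  "rderiv q j w (\<lambda>x. lderiv q i x f) = lderiv q i w (\<lambda>x. rderiv q j x f)"
proof (induction w arbitrary: f)
  case (Cons k w)
  have 1: "rderiv q j w (\<lambda>x. if i = k then f x else 0) = (if i = k then rderiv q j w f else 0)"
    by simp
  have 2: "lderiv q i w (\<lambda>x. if j = k then letter_word q j x * f x else 0)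
      = (if j = k then lderiv q i w (\<lambda>x. letter_word q j x * f x) else 0)"
    by simp
  have "rderiv q j w (\<lambda>x. lderiv q i (k # x) f)
      = (if i = k then rderiv q j w f else 0) + q k i * lderiv q i w (\<lambda>x. rderiv q j x (\<lambda>x. f (k # x)))"
    by (simp add: field_deriv_add deriv_mult_left 1 Cons)
  moreover have "lderiv q i w (\<lambda>x. rderiv q j (k # x) f)
      = (if j = k then lderiv q i w (\<lambda>x. letter_word q j x * f x) else 0)
        + lderiv q i w (\<lambda>x. rderiv q j x (\<lambda>x. f (k # x)))"
    by (simp add: field_deriv_add 2)
  ultimately show ?case
    by (auto simp: lderiv_letter_word distrib_left)
qed simp

text \<open>
  The symmetric form on words of which the Nichols ideal is the radical: \<open>word_form q x y\<close> is the
  sum over all bijections between equal letters of \<open>x\<close> and \<open>y\<close> of the product of \<open>q\<close> over the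
  pairs whose order is preserved.
\<close>

primrec word_form :: "('n \<Rightarrow> 'n \<Rightarrow> 'k::field) \<Rightarrow> 'n list \<Rightarrow> 'n list \<Rightarrow> 'k"
  where
    "word_form q [] y = (if y = [] then 1 else 0)"
  | "word_form q (i # x) y = rderiv q i y (word_form q x)"

lemma word_form_Cons_fun: "word_form q (i # x) = (\<lambda>y. rderiv q i y (word_form q x))"
  by (rule ext) simp

lemma word_form_mset: "word_form q x y \<noteq> 0 \<Longrightarrow> mset x = mset y"
proof (induction x arbitrary: y)
  case (Cons i x)
  then show ?case
    using right_deriv_cong[of i y "word_form q x" "\<lambda>_. 0" q "(*)"] by (metis field_deriv_zero(1) mset.simps(2) word_form.simps(2))
qed (auto split: if_splits)

text \<open>Scalars such as \<open>letter_word\<close> depend only on the multiset of a word; this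
  carries them from one argument of the form to the other.\<close>

lemma word_form_mult_cong:
  "(mset x = mset y \<Longrightarrow> f = g) \<Longrightarrow> f * word_form q x y = g * word_form q x y"
  by (cases "word_form q x y = 0") (auto dest: word_form_mset)

text \<open>Symmetry of the form rests on this mirror image of its recursion. The scalar for moving
  i is computed in x instead of y, which is harmless since the form vanishes unless both words have
  the same letters.\<close>

lemma word_form_Cons_right: "word_form q x (i # y) = rderiv q i x (\<lambda>x. word_form q x y)"
proof (induction x arbitrary: y)
  case (Cons j x)
  have "letter_word q i y * word_form q x y = letter_word q i x * word_form q x y"
    by (rule word_form_mult_cong) (rule letter_word_mset_cong, simp)
  then show ?case
    by (auto simp: Cons rderiv_interchange[of q j y i x])
qed simp

lemma word_form_commute: "word_form q x y = word_form q y x"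
proof (induction y arbitrary: x)
  case Nil
  show ?case by (cases x) auto
next
  case (Cons i y)
  then show ?case by (simp add: word_form_Cons_right)
qed

text \<open>Removing a letter at the other end is dual to the other derivation; the induction step
  is that the two derivations commute.\<close>

lemma word_form_snoc: "word_form q (x @ [i]) y = lderiv q i y (word_form q x)"
proof (induction x arbitrary: y)
  case Nil
  show ?case
  proof (cases y)
    case (Cons j z)
    have *: "rderiv q i z (\<lambda>_. 0) = 0" "lderiv q i z (\<lambda>_. 0) = 0" by simp_all
    show ?thesis by (cases z) (simp_all add: Cons *)
  qed simp
next
  case (Cons j x)
  then have "word_form q (x @ [i]) = (\<lambda>y. lderiv q i y (word_form q x))" by blast
  then show ?case by (simp add: rderiv_lderiv word_form_Cons_fun)
qed

lemma word_form_snoc_right: "word_form q x (y @ [i]) = lderiv q i x (\<lambda>x. word_form q x y)"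
proof -
  have "word_form q y = (\<lambda>x. word_form q x y)" by (rule ext) (rule word_form_commute)
  then show ?thesis by (metis word_form_commute word_form_snoc)
qed

lemma rderiv_append:
  "rderiv q i (w @ x) f = rderiv q i x (\<lambda>y. f (w @ y)) + letter_word q i x * rderiv q i w (\<lambda>y. f (y @ x))"
  by (induction w arbitrary: f) (auto simp: distrib_left mult.assoc)

text \<open>\<open>inverse (q j i)\<close> is the braiding matrix of W. Passing to it turns the
  right derivation into the left one, up to a scalar that depends only on the letters.\<close>

lemma lderiv_inverse:
  assumes "\<And>i j. q i j \<noteq> 0"
  shows "rderiv (\<lambda>i j. inverse (q j i)) i u f = lderiv q i u (\<lambda>y. inverse (word_letter q y i) * f y)"
proof (induction u arbitrary: f)
  case (Cons j u)
  have 1: "letter_word (\<lambda>i j. inverse (q j i)) i u = inverse (word_letter q u i)"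
    by (induction u) auto
  have "rderiv (\<lambda>i j. inverse (q j i)) i u (\<lambda>y. f (j # y))
      = q j i * (inverse (q j i) * lderiv q i u (\<lambda>y. inverse (word_letter q y i) * f (j # y)))"
    using assms[of j i] by (simp add: Cons)
  then show ?case
    using 1 by (auto simp: deriv_mult_left mult.assoc)
qed simp

text \<open>Exchanging the two derivations reads the first word backwards, so the forms of V and W
  differ by this reversal and a nonzero scalar. One form therefore serves both Nichols
  algebras.\<close>

lemma word_form_inverse:
  assumes "\<And>i j. q i j \<noteq> (0 :: 'k::field)"
  shows "\<exists>c. c \<noteq> 0 \<and> (\<forall>y. word_form (\<lambda>i j. inverse (q j i)) x y = c * word_form q (rev x) y)"
proof (induction x)
  case (Cons i x)
  then obtain c where c: "c \<noteq> 0" "\<And>y. word_form (\<lambda>i j. inverse (q j i)) x y = c * word_form q (rev x) y"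
    by blast
  have "word_form (\<lambda>i j. inverse (q j i)) (i # x) y = (inverse (word_letter q x i) * c) * word_form q (rev (i # x)) y" for y
  proof -
    have "word_form (\<lambda>i j. inverse (q j i)) (i # x) y
        = lderiv q i y (\<lambda>y. inverse (word_letter q y i) * (c * word_form q (rev x) y))"
      by (simp add: lderiv_inverse[OF assms] c)
    also have "\<dots> = lderiv q i y (\<lambda>y. (inverse (word_letter q x i) * c) * word_form q (rev x) y)"
    proof (rule left_deriv_cong)
      fix y
      have "inverse (word_letter q y i) * c * word_form q (rev x) y = (inverse (word_letter q x i) * c) * word_form q (rev x) y"
        by (rule word_form_mult_cong) (simp add: word_letter_mset_cong[of x y])
      then show "inverse (word_letter q y i) * (c * word_form q (rev x) y) = (inverse (word_letter q x i) * c) * word_form q (rev x) y"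
        by (simp add: mult.assoc)
    qed
    finally show ?thesis by (simp add: deriv_mult_left word_form_snoc)
  qed
  then show ?case using c(1) word_letter_nonzero[of q x i] assms by (intro exI[of _ "inverse (word_letter q x i) * c"]) auto
qed (auto intro: exI[of _ 1])

section \<open>The radical of the form and the Nichols ideal\<close>

definition functional :: "('b \<Rightarrow> 'k) \<Rightarrow> ('b \<Rightarrow>\<^sub>0 'k::field) \<Rightarrow> 'k"
  where "functional f p = (\<Sum>a\<in>Poly_Mapping.keys p. Poly_Mapping.lookup p a * f a)"

lemma functional_superset:
  assumes "finite A" "Poly_Mapping.keys p \<subseteq> A"
  shows "functional f p = (\<Sum>a\<in>A. Poly_Mapping.lookup p a * f a)"
  unfolding functional_def using assms by (intro sum.mono_neutral_left) (auto simp: in_keys_iff)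

lemma functional_zero [simp]: "functional f 0 = 0" "functional (\<lambda>_. 0) p = 0"
  by (simp_all add: functional_def)

lemma functional_single [simp]: "functional f (Poly_Mapping.single a c) = c * f a"
  by (subst functional_superset[of "{a}"]) auto

lemma functional_add: "functional f (p + q) = functional f p + functional f q"
proof -
  let ?A = "Poly_Mapping.keys p \<union> Poly_Mapping.keys q"
  have "Poly_Mapping.keys (p + q) \<subseteq> ?A" by (rule keys_add)
  then show ?thesis
    by (simp add: functional_superset[of ?A] lookup_add distrib_right sum.distrib)
qed

lemma functional_scale: "functional f (pm_scale c p) = c * functional f p"
proof -
  have "Poly_Mapping.keys (pm_scale c p) \<subseteq> Poly_Mapping.keys p" by (auto simp: in_keys_iff)
  then show ?thesis
    by (simp add: functional_superset[of "Poly_Mapping.keys p"] sum_distrib_left mult.assoc)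
qed

lemma functional_minus: "functional f (p - q) = functional f p - functional f q"
  using functional_add[of f "p - q" q] by simp

lemma functional_sum: "functional f (\<Sum>i\<in>A. p i) = (\<Sum>i\<in>A. functional f (p i))"
  by (induction A rule: infinite_finite_induct) (auto simp: functional_add)

lemma functional_cong: "(\<And>a. a \<in> Poly_Mapping.keys p \<Longrightarrow> f a = g a) \<Longrightarrow> functional f p = functional g p"
  unfolding functional_def by (rule sum.cong) auto

lemma functional_mult_left: "functional (\<lambda>a. c * f a) p = c * functional f p"
  unfolding functional_def by (simp add: sum_distrib_left mult.left_commute)

lemma functional_plus: "functional (\<lambda>a. f a + g a) p = functional f p + functional g p"
  unfolding functional_def by (simp add: distrib_left sum.distrib)

lemma functional_deriv:
  "functional (\<lambda>u. rderiv q i x (\<lambda>x. g x u)) p = rderiv q i x (\<lambda>x. functional (g x) p)"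
  "functional (\<lambda>u. lderiv q i x (\<lambda>x. g x u)) p = lderiv q i x (\<lambda>x. functional (g x) p)"
  by (induction x arbitrary: g) (auto simp: functional_plus functional_mult_left)

lemma functional_twisted_single:
  "functional f (Poly_Mapping.single a c \<otimes>\<^bsub>twisted_algebra m e \<sigma>\<^esub> p)
    = c * functional (\<lambda>b. \<sigma> a b * f (m a b)) p"
  "functional f (p \<otimes>\<^bsub>twisted_algebra m e \<sigma>\<^esub> Poly_Mapping.single a c)
    = c * functional (\<lambda>b. \<sigma> b a * f (m b a)) p"
  by (induction p rule: poly_mapping_additive_induct)
    (auto simp: twisted_mult_add_right twisted_mult_add_left functional_add distrib_left)

lemma functional_linear_extension:
  "functional f (linear_extension h p) = functional (\<lambda>a. functional f (h a)) p"
  unfolding linear_extension_def functional_sum functional_scale functional_def[of _ p] ..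

definition form_radical :: "('n \<Rightarrow> 'n \<Rightarrow> 'k::field) \<Rightarrow> ('n list \<Rightarrow>\<^sub>0 'k) set"
  where "form_radical q = {p. \<forall>x. functional (word_form q x) p = 0}"

lemma subspace_form_radical: "pm.subspace (form_radical q)"
  by (auto simp: pm.subspace_def form_radical_def functional_add functional_scale)

text \<open>Moving the letters of w to the first argument turns them into derivations acting on x,
  so the value is a combination of values of the form at shorter words and p. This makes the radical
  an ideal.\<close>

lemma form_radical_append:
  assumes "p \<in> form_radical q"
  shows "functional (\<lambda>u. word_form q x (w @ u)) p = 0" "functional (\<lambda>u. word_form q x (u @ w)) p = 0"
proof -
  show "functional (\<lambda>u. word_form q x (w @ u)) p = 0"
    using assms by (induction w arbitrary: x)
      (auto simp: form_radical_def word_form_Cons_right functional_deriv)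
  show "functional (\<lambda>u. word_form q x (u @ w)) p = 0"
  proof (induction w arbitrary: x rule: rev_induct)
    case (snoc i w)
    have "functional (\<lambda>u. word_form q x (u @ w @ [i])) p
        = functional (\<lambda>u. lderiv q i x (\<lambda>x. word_form q x (u @ w))) p"
      by (rule functional_cong) (simp add: word_form_snoc_right flip: append_assoc)
    then show ?case by (simp add: functional_deriv snoc)
  qed (use assms in \<open>auto simp: form_radical_def\<close>)
qed

lemma ideal_form_radical:
  fixes q :: "'n \<Rightarrow> 'n \<Rightarrow> 'k::field"
  shows "ideal (form_radical q) tensor_algebra"
proof (rule idealI)
  let ?T = "tensor_algebra :: ('k, 'n list \<Rightarrow>\<^sub>0 'k) module"
  note s = subspace_form_radical[of q]
  show "ring ?T" by (rule tensor_algebra_ring)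
  then interpret ring ?T .
  show "subgroup (form_radical q) (add_monoid ?T)"
  proof (rule add.subgroupI)
    fix p assume p: "p \<in> form_radical q"
    have "\<ominus>\<^bsub>?T\<^esub> p = - p"
      by (rule minus_equality) (auto simp: tensor_algebra_def)
    then show "\<ominus>\<^bsub>?T\<^esub> p \<in> form_radical q" using p s pm.subspace_neg by metis
  qed (use pm.subspace_0[OF s] pm.subspace_add[OF s] in \<open>auto simp: tensor_algebra_def\<close>)
  fix p x assume p: "p \<in> form_radical q"
  show "x \<otimes>\<^bsub>?T\<^esub> p \<in> form_radical q"
  proof (induction x rule: poly_mapping_additive_induct)
    case (1 w c)
    show ?case
      using form_radical_append(1)[OF p]
      by (simp add: form_radical_def tensor_algebra_def functional_twisted_single)
  qed (use pm.subspace_0[OF s] pm.subspace_add[OF s] in \<open>auto simp: tensor_algebra_def twisted_mult_add_left\<close>)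
  show "p \<otimes>\<^bsub>?T\<^esub> x \<in> form_radical q"
  proof (induction x rule: poly_mapping_additive_induct)
    case (1 w c)
    show ?case
      using form_radical_append(2)[OF p]
      by (simp add: form_radical_def tensor_algebra_def functional_twisted_single)
  qed (use pm.subspace_0[OF s] pm.subspace_add[OF s] in \<open>auto simp: tensor_algebra_def twisted_mult_add_right\<close>)
qed

lemma graded_form_radical: "graded_subspace (form_radical q)"
  unfolding graded_subspace_def
proof (intro conjI ballI allI)
  fix p n assume p: "p \<in> form_radical q"
  have "functional (word_form q x) (homogeneous_component n p) = 0" for x
  proof -
    have len: "word_form q x u = 0" if "length u \<noteq> length x" for u
      using word_form_mset[of q x u] mset_eq_length[of x u] that by auto
    have "functional (word_form q x) (homogeneous_component n p)
        = functional (\<lambda>u. if length u = n then word_form q x u else 0) p"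
      by (subst functional_superset[of "Poly_Mapping.keys p"])
        (auto simp: in_keys_iff functional_def if_distrib cong: if_cong intro!: sum.cong)
    also have "\<dots> = functional (\<lambda>u. (if length x = n then 1 else 0) * word_form q x u) p"
      by (rule functional_cong) (use len in auto)
    also have "\<dots> = 0"
      using p unfolding functional_mult_left by (simp add: form_radical_def)
    finally show ?thesis .
  qed
  then show "homogeneous_component n p \<in> form_radical q" by (simp add: form_radical_def)
qed (rule subspace_form_radical)

section \<open>The radical as a coideal\<close>

lemma lookup_pure_tensor [simp]:
  "Poly_Mapping.lookup (pure_tensor p q) (a, b) = Poly_Mapping.lookup p a * Poly_Mapping.lookup q b"
proof -
  have "Poly_Mapping.lookup (pure_tensor p q) (a, b)
      = (\<Sum>u\<in>Poly_Mapping.keys p. \<Sum>v\<in>Poly_Mapping.keys q.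
          if u = a then if v = b then Poly_Mapping.lookup p u * Poly_Mapping.lookup q v else 0 else 0)"
    unfolding pure_tensor_def lookup_sum by (intro sum.cong) (auto simp: lookup_single when_def)
  also have "\<dots> = (\<Sum>u\<in>Poly_Mapping.keys p. if u = a then \<Sum>v\<in>Poly_Mapping.keys q.
          if v = b then Poly_Mapping.lookup p u * Poly_Mapping.lookup q v else 0 else 0)"
    by (intro sum.cong) auto
  also have "\<dots> = Poly_Mapping.lookup p a * Poly_Mapping.lookup q b"
    by (auto simp: in_keys_iff)
  finally show ?thesis .
qed

text \<open>
  The radical of \<open>\<phi> \<otimes> \<phi>\<close> is \<open>R \<otimes> T + T \<otimes> R\<close>; \<open>\<rho>\<close> below is the projection along \<open>R\<close>
  onto a complement.
\<close>

lemma tensor_square_radical: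
  fixes \<phi> :: "'x \<Rightarrow> 'a \<Rightarrow> 'k::field"
  defines "R \<equiv> {p. \<forall>x. functional (\<phi> x) p = 0}"
  assumes t: "\<And>x y. functional (\<lambda>(u, v). \<phi> x u * \<phi> y v) t = 0"
  shows "t \<in> pm.span {pure_tensor p q | p q. p \<in> R \<or> q \<in> R}"
proof -
  interpret pp: vector_space_pair "pm_scale :: 'k \<Rightarrow> ('a \<Rightarrow>\<^sub>0 'k) \<Rightarrow> _" "pm_scale :: 'k \<Rightarrow> ('a \<Rightarrow>\<^sub>0 'k) \<Rightarrow> _" ..
  have sR: "pm.subspace R"
    by (auto simp: R_def pm.subspace_def functional_add functional_scale)
  have lid: "Vector_Spaces.linear (pm_scale :: 'k \<Rightarrow> ('a \<Rightarrow>\<^sub>0 'k) \<Rightarrow> _) pm_scale id"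
    by (rule pm.linear_id)
  obtain \<pi> where \<pi>: "Vector_Spaces.linear pm_scale pm_scale \<pi>" "range \<pi> \<subseteq> R" "\<And>p. p \<in> R \<Longrightarrow> \<pi> p = p"
    using pp.linear_exists_left_inverse_on[OF lid sR] by auto
  interpret \<pi>: Vector_Spaces.linear pm_scale pm_scale \<pi> by fact
  define \<rho> where "\<rho> p = p - \<pi> p" for p
  have \<rho>_sum: "\<rho> (\<Sum>i\<in>A. pm_scale (c i) (p i)) = (\<Sum>i\<in>A. pm_scale (c i) (\<rho> (p i)))"
    for A :: "('a \<times> 'a) set" and c p
    by (simp add: \<rho>_def \<pi>.sum \<pi>.scale sum_subtractf pm.scale_right_diff_distrib)
  have \<rho>_inj: "\<rho> p = 0" if "\<rho> p \<in> R" for p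
  proof -
    have "\<rho> p + \<pi> p \<in> R" using that \<pi>(2) pm.subspace_add[OF sR] by blast
    then have "p \<in> R" by (simp add: \<rho>_def)
    then show ?thesis by (simp add: \<rho>_def \<pi>(3))
  qed
  have \<rho>_\<phi>: "functional (\<phi> x) (\<rho> p) = functional (\<phi> x) p" for x p
    using \<pi>(2) by (auto simp: \<rho>_def functional_minus R_def)
  let ?s = "\<lambda>u. Poly_Mapping.single u (1::'k)" and ?l = Poly_Mapping.lookup
  let ?K = "Poly_Mapping.keys t"
  have s_\<phi>: "functional (\<phi> x) (\<rho> (?s u)) = \<phi> x u" for x u by (simp add: \<rho>_\<phi>)
  \<comment> \<open>Contracting the second tensor factor with \<phi> y leaves a vector on which all
    \<phi> x vanish, hence an element of R, which \<rho> kills. The next step does the same in the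
    second factor.\<close>
  have 1: "(\<Sum>z\<in>?K. ?l t z * \<phi> y (snd z) * ?l (\<rho> (?s (fst z))) a) = 0" for y a
  proof -
    let ?p = "\<Sum>z\<in>?K. pm_scale (?l t z * \<phi> y (snd z)) (?s (fst z))"
    have "functional (\<phi> x) ?p = functional (\<lambda>(u, v). \<phi> x u * \<phi> y v) t" for x
      unfolding functional_sum functional_scale functional_def[of _ t]
      by (rule sum.cong) (auto simp: ac_simps)
    then have "\<rho> ?p \<in> R" by (simp add: R_def \<rho>_\<phi> t)
    then have "\<rho> ?p = 0" by (rule \<rho>_inj)
    then have "?l (\<rho> ?p) a = 0" by simp
    then show ?thesis unfolding \<rho>_sum lookup_sum by simp
  qed
  have 2: "(\<Sum>z\<in>?K. ?l t z * ?l (\<rho> (?s (fst z))) a * ?l (\<rho> (?s (snd z))) b) = 0" for a b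
  proof -
    let ?p = "\<Sum>z\<in>?K. pm_scale (?l t z * ?l (\<rho> (?s (fst z))) a) (?s (snd z))"
    have "functional (\<phi> y) ?p = 0" for y
      using 1[of y a] unfolding functional_sum functional_scale by (simp add: ac_simps)
    then have "\<rho> ?p \<in> R" by (simp add: R_def \<rho>_\<phi>)
    then have "\<rho> ?p = 0" by (rule \<rho>_inj)
    then have "?l (\<rho> ?p) b = 0" by simp
    then show ?thesis unfolding \<rho>_sum lookup_sum by simp
  qed
  \<comment> \<open>The identity of the tensor square is \<pi> \<otimes> 1 + \<rho> \<otimes> \<pi>
    + \<rho> \<otimes> \<rho>. The last term kills t by 2, and each of the others has a factor in
    R.\<close>
  have "t = (\<Sum>z\<in>?K. pm_scale (?l t z) (pure_tensor (\<pi> (?s (fst z))) (?s (snd z))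
      + pure_tensor (\<rho> (?s (fst z))) (\<pi> (?s (snd z)))))" (is "t = ?r")
  proof (rule poly_mapping_eqI)
    fix z :: "'a \<times> 'a"
    obtain a b where z: "z = (a, b)" by (cases z)
    have "?l t z = (\<Sum>y\<in>?K. ?l t y * ?l (?s (fst y)) a * ?l (?s (snd y)) b)"
    proof -
      have "?l t z = (\<Sum>y\<in>?K. if y = z then ?l t z else 0)"
        by (auto simp: in_keys_iff)
      also have "\<dots> = (\<Sum>y\<in>?K. ?l t y * ?l (?s (fst y)) a * ?l (?s (snd y)) b)"
        by (rule sum.cong) (auto simp: z lookup_single when_def)
      finally show ?thesis .
    qed
    also have "\<dots> = (\<Sum>y\<in>?K. ?l t y * (?l (\<pi> (?s (fst y))) a * ?l (?s (snd y)) b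
        + ?l (\<rho> (?s (fst y))) a * ?l (\<pi> (?s (snd y))) b)
        + ?l t y * ?l (\<rho> (?s (fst y))) a * ?l (\<rho> (?s (snd y))) b)"
      by (rule sum.cong) (auto simp: \<rho>_def lookup_minus algebra_simps)
    also have "\<dots> = ?l ?r z"
      unfolding sum.distrib 2 lookup_sum by (simp add: z lookup_add)
    finally show "?l t z = ?l ?r z" .
  qed
  also have "\<dots> \<in> pm.span {pure_tensor p q | p q. p \<in> R \<or> q \<in> R}"
    using \<pi>(2) by (intro pm.span_sum pm.span_scale pm.span_add pm.span_base) blast+
  finally show ?thesis .
qed

text \<open>The form is a pairing of bialgebras: comultiplication on one side is concatenation on
  the other, in opposite order. A new letter i goes either to the factor paired with x, without a
  scalar, or past that factor to the one paired with y, with the scalar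
  \<open>letter_word q i x\<close>; \<open>rderiv_append\<close> splits the derivation of y @ x in
  the same way.\<close>

lemma functional_word_comult:
  fixes d :: "'i \<Rightarrow> 'g::ab_group_add" and c :: "'i \<Rightarrow> 'g \<Rightarrow> 'k::field"
  assumes "\<And>i. is_character (c i)"
  defines "q \<equiv> \<lambda>i j. c j (d i)"
  shows "functional (\<lambda>(u, v). word_form q x u * word_form q y v) (word_comult d c w)
    = word_form q (y @ x) w"
proof (induction w arbitrary: x y)
  case Nil
  have "word_form q x [] = (if x = [] then 1 else 0)" for x by (cases x) auto
  then show ?case by (auto simp: braided_square_def)
next
  case (Cons i w)
  let ?t = "word_comult d c w" and ?\<Phi> = "\<lambda>x y (u, v). word_form q x u * word_form q y v"
  have c0: "word_character c u 0 = 1" for u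
    using word_character_char[of c u] assms(1) by (simp add: is_character_def)
  have ci: "word_character c u (d i) = letter_word q i u" for u
    by (simp add: word_character_def letter_word_def q_def)
  have "functional (?\<Phi> x y) (Poly_Mapping.single ([i], []) 1 \<otimes>\<^bsub>braided_square d c\<^esub> ?t)
      = functional (\<lambda>z. rderiv q i x (\<lambda>x. ?\<Phi> x y z)) ?t"
    unfolding braided_square_def functional_twisted_single mult_1_left
    by (rule functional_cong)
      (auto simp: word_degree_def c0 word_form_Cons_right mult.commute simp flip: deriv_mult_left)
  also have "\<dots> = rderiv q i x (\<lambda>x. word_form q (y @ x) w)"
    by (simp add: functional_deriv Cons)
  finally have 1: "functional (?\<Phi> x y) (Poly_Mapping.single ([i], []) 1 \<otimes>\<^bsub>braided_square d c\<^esub> ?t)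
    = rderiv q i x (\<lambda>x. word_form q (y @ x) w)" .
  have "functional (?\<Phi> x y) (Poly_Mapping.single ([], [i]) 1 \<otimes>\<^bsub>braided_square d c\<^esub> ?t)
      = functional (\<lambda>z. letter_word q i x * rderiv q i y (\<lambda>y. ?\<Phi> x y z)) ?t"
    unfolding braided_square_def functional_twisted_single mult_1_left
  proof (rule functional_cong)
    fix z :: "'i list \<times> 'i list"
    obtain u v where z: "z = (u, v)" by (cases z)
    have "letter_word q i u * word_form q x u = letter_word q i x * word_form q x u"
      by (rule word_form_mult_cong) (rule letter_word_mset_cong, simp)
    then show "(case ([], [i]) of (u, v) \<Rightarrow> \<lambda>(u', v'). word_character c u' (word_degree d v)) z
        * ?\<Phi> x y ((case ([], [i]) of (u, v) \<Rightarrow> \<lambda>(u', v'). (u @ u', v @ v')) z)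
        = letter_word q i x * rderiv q i y (\<lambda>y. ?\<Phi> x y z)"
      by (simp add: z word_degree_def ci word_form_Cons_right deriv_mult_left flip: mult.assoc)
  qed
  also have "\<dots> = letter_word q i x * rderiv q i y (\<lambda>y. word_form q (y @ x) w)"
    by (simp add: functional_deriv functional_mult_left Cons)
  finally have 2: "functional (?\<Phi> x y) (Poly_Mapping.single ([], [i]) 1 \<otimes>\<^bsub>braided_square d c\<^esub> ?t)
    = letter_word q i x * rderiv q i y (\<lambda>y. word_form q (y @ x) w)" .
  have "functional (?\<Phi> x y) (word_comult d c (i # w))
      = functional (?\<Phi> x y) (Poly_Mapping.single ([i], []) 1 \<otimes>\<^bsub>braided_square d c\<^esub> ?t)
      + functional (?\<Phi> x y) (Poly_Mapping.single ([], [i]) 1 \<otimes>\<^bsub>braided_square d c\<^esub> ?t)"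
    unfolding word_comult.simps braided_square_def twisted_mult_add_left functional_add ..
  then show ?case
    by (simp add: 1 2 word_form_Cons_right rderiv_append)
qed

text \<open>This turns linear dependences in the Gram matrix into relations of U. The pairing
  property makes the radical a coideal, and the form on single letters is the identity matrix, so
  the radical meets V in 0.\<close>

lemma form_radical_subset_nichols_ideal:
  fixes d :: "'i \<Rightarrow> 'g::ab_group_add" and c :: "'i \<Rightarrow> 'g \<Rightarrow> 'k::field"
  assumes "\<And>i. is_character (c i)"
  shows "form_radical (\<lambda>i j. c j (d i)) \<subseteq> nichols_ideal d c"
proof (rule nichols_ideal_greatest(2))
  let ?q = "\<lambda>i j. c j (d i)"
  have "coideal d c (form_radical ?q)"
    unfolding coideal_def
  proof (intro conjI ballI)
    fix p assume p: "p \<in> form_radical ?q"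
    then have "functional (word_form ?q []) p = 0" by (simp only: form_radical_def mem_Collect_eq)
    moreover have "functional (word_form ?q []) p = functional (\<lambda>u. if u = [] then 1 else 0) p"
      by (rule functional_cong) simp
    ultimately show "counit p = 0"
      by (auto simp: counit_def functional_def in_keys_iff if_distrib cong: if_cong split: if_splits)
    show "comult d c p \<in> pm.span {pure_tensor x y | x y. x \<in> form_radical ?q \<or> y \<in> form_radical ?q}"
      unfolding form_radical_def
    proof (rule tensor_square_radical)
      show "functional (\<lambda>(u, v). word_form ?q x u * word_form ?q y v) (comult d c p) = 0" for x y
        using p functional_word_comult[of c d x y, OF assms]
        by (simp add: comult_def functional_linear_extension form_radical_def)
    qed
  qed (rule subspace_form_radical)
  moreover have "form_radical ?q \<inter> homogeneous 1 = {0}"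
  proof -
    have "p = 0" if p: "p \<in> form_radical ?q" "p \<in> homogeneous 1" for p
    proof (rule poly_mapping_eqI)
      fix w
      show "Poly_Mapping.lookup p w = Poly_Mapping.lookup 0 w"
      proof (cases "length w = 1")
        case True
        then obtain i where w: "w = [i]" by (cases w) auto
        have "word_form ?q [i] u = (if u = [i] then 1 else 0)" if "length u = 1" for u
          using that by (cases u) auto
        then have "functional (word_form ?q [i]) p = functional (\<lambda>u. if u = [i] then 1 else 0) p"
          using p(2) by (intro functional_cong) (auto simp: homogeneous_def)
        moreover have "functional (word_form ?q [i]) p = 0"
          using p(1) by (simp only: form_radical_def mem_Collect_eq)
        ultimately have "functional (\<lambda>u. if u = [i] then 1 else 0) p = 0" by metis
        then show ?thesis
          by (auto simp: w functional_def in_keys_iff if_distrib cong: if_cong split: if_splits)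
      next
        case False
        then have "w \<notin> Poly_Mapping.keys p" using p(2) by (auto simp: homogeneous_def)
        then show ?thesis by (simp add: in_keys_iff)
      qed
    qed
    then show ?thesis using pm.subspace_0[OF subspace_form_radical] by (auto simp: homogeneous_def)
  qed
  ultimately show "nichols_admissible d c (form_radical ?q)"
    by (simp add: nichols_admissible_def ideal_form_radical graded_form_radical)
qed

lemma form_radical_inverse:
  assumes "\<And>i j. q i j \<noteq> (0 :: 'k::field)"
  shows "form_radical q \<subseteq> form_radical (\<lambda>i j. inverse (q j i))"
proof
  fix p assume p: "p \<in> form_radical q"
  have "functional (word_form (\<lambda>i j. inverse (q j i)) x) p = 0" for x
  proof -
    obtain c where "\<And>y. word_form (\<lambda>i j. inverse (q j i)) x y = c * word_form q (rev x) y"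
      using word_form_inverse[of q x] assms by blast
    then have "functional (word_form (\<lambda>i j. inverse (q j i)) x) p = c * functional (word_form q (rev x)) p"
      by (simp add: functional_mult_left[symmetric] cong: functional_cong)
    then show ?thesis using p by (simp add: form_radical_def)
  qed
  then show "p \<in> form_radical (\<lambda>i j. inverse (q j i))" by (simp add: form_radical_def)
qed

section \<open>The Casimir operator\<close>

definition words :: "'n set \<Rightarrow> nat \<Rightarrow> 'n list set"
  where "words J n = {w. set w \<subseteq> J \<and> length w = n}"

lemma finite_words: "finite J \<Longrightarrow> finite (words J n)"
  unfolding words_def by (rule finite_lists_length_eq)

lemma words_mset_cong: "mset u = mset v \<Longrightarrow> u \<in> words J n \<longleftrightarrow> v \<in> words J n"
  by (auto simp: words_def dest: mset_eq_setD mset_eq_length)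

lemma words_Suc_add_mset:
  assumes "add_mset i (mset y) = mset u" "u \<in> words J (Suc n)"
  shows "y \<in> words J n"
proof -
  have "mset (i # y) = mset u" using assms(1) by simp
  then have "i # y \<in> words J (Suc n)" using assms(2) words_mset_cong by blast
  then show ?thesis by (simp add: words_def)
qed

text \<open>Every linear map f over a field has a linear g with f g f = f, namely a right inverse on
  its range. Here f is the matrix S cut down to I, and A is the matrix of g.\<close>

lemma generalized_inverse_exists:
  fixes S :: "'a \<Rightarrow> 'a \<Rightarrow> 'k::field"
  assumes "finite I"
  shows "\<exists>A. \<forall>x\<in>I. \<forall>y\<in>I. (\<Sum>(u, w)\<in>I \<times> I. S x u * A u w * S w y) = S x y"
proof -
  interpret pp: vector_space_pair "pm_scale :: 'k \<Rightarrow> ('a \<Rightarrow>\<^sub>0 'k) \<Rightarrow> _" "pm_scale :: 'k \<Rightarrow> ('a \<Rightarrow>\<^sub>0 'k) \<Rightarrow> _" ..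
  define f :: "('a \<Rightarrow>\<^sub>0 'k) \<Rightarrow> ('a \<Rightarrow>\<^sub>0 'k)"
    where "f p = (\<Sum>x\<in>I. Poly_Mapping.single x (\<Sum>u\<in>I. S x u * Poly_Mapping.lookup p u))" for p
  have f: "Poly_Mapping.lookup (f p) x = (if x \<in> I then \<Sum>u\<in>I. S x u * Poly_Mapping.lookup p u else 0)" for p x
    unfolding f_def lookup_sum using assms by (simp add: lookup_single when_def)
  have "Vector_Spaces.linear pm_scale pm_scale f"
    by (auto simp: Vector_Spaces.linear_iff pm.vector_space_axioms f lookup_add distrib_left
        sum.distrib sum_distrib_left mult.left_commute intro!: poly_mapping_eqI)
  from pp.linear_exists_right_inverse_on[OF this pm.subspace_UNIV]
  obtain g where g: "Vector_Spaces.linear pm_scale pm_scale g" "\<And>p. f (g (f p)) = f p" by auto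
  interpret g: Vector_Spaces.linear pm_scale pm_scale g by fact
  define A where "A u w = Poly_Mapping.lookup (g (Poly_Mapping.single w 1)) u" for u w
  have "(\<Sum>(u, w)\<in>I \<times> I. S x u * A u w * S w y) = S x y" if "x \<in> I" "y \<in> I" for x y
  proof -
    have fy: "f (Poly_Mapping.single y 1) = (\<Sum>w\<in>I. pm_scale (S w y) (Poly_Mapping.single w 1))"
      by (rule poly_mapping_eqI)
        (use assms that in \<open>simp add: f lookup_sum lookup_single when_def if_distrib cong: if_cong\<close>)
    have "S x y = Poly_Mapping.lookup (f (g (f (Poly_Mapping.single y 1)))) x"
      unfolding g(2) using assms that by (simp add: f lookup_single when_def if_distrib cong: if_cong)
    also have "\<dots> = (\<Sum>u\<in>I. S x u * (\<Sum>w\<in>I. S w y * A u w))"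
      using that unfolding f[of "g _"] fy by (simp add: g.sum g.scale lookup_sum A_def)
    also have "\<dots> = (\<Sum>(u, w)\<in>I \<times> I. S x u * A u w * S w y)"
      by (simp add: sum_distrib_left sum.cartesian_product ac_simps)
    finally show ?thesis ..
  qed
  then show ?thesis by blast
qed

lemma word_form_generalized_inverse:
  fixes q :: "'n::finite \<Rightarrow> 'n \<Rightarrow> 'k::field"
  obtains A where "\<And>u w. A u w \<noteq> 0 \<Longrightarrow> mset u = mset w"
    "\<And>n x y. x \<in> words J n \<Longrightarrow> y \<in> words J n \<Longrightarrow>
      (\<Sum>(u, w)\<in>words J n \<times> words J n. word_form q x u * A u w * word_form q w y) = word_form q x y"
proof -
  have "\<exists>A. \<forall>x\<in>words J n. \<forall>y\<in>words J n.
      (\<Sum>(u, w)\<in>words J n \<times> words J n. word_form q x u * A u w * word_form q w y) = word_form q x y" for n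
    by (rule generalized_inverse_exists) (simp add: finite_words)
  then have "\<forall>n. \<exists>A. \<forall>x\<in>words J n. \<forall>y\<in>words J n.
      (\<Sum>(u, w)\<in>words J n \<times> words J n. word_form q x u * A u w * word_form q w y) = word_form q x y" ..
  from choice[OF this] obtain A where A: "\<And>n x y. x \<in> words J n \<Longrightarrow> y \<in> words J n \<Longrightarrow>
      (\<Sum>(u, w)\<in>words J n \<times> words J n. word_form q x u * A n u w * word_form q w y) = word_form q x y"
    by auto
  define A' where "A' u w = (if mset u = mset w then A (length u) u w else 0)" for u w
  show ?thesis
  proof
    fix n x y assume xy: "x \<in> words J n" "y \<in> words J n"
    have "(\<Sum>(u, w)\<in>words J n \<times> words J n. word_form q x u * A' u w * word_form q w y)
      = (\<Sum>(u, w)\<in>words J n \<times> words J n.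
          (if mset x = mset y then 1 else 0) * (word_form q x u * A n u w * word_form q w y))"
    proof (rule sum.cong, goal_cases)
      case (2 z)
      obtain u w where z: "z = (u, w)" by (cases z)
      have "length u = n" using 2 by (auto simp: z words_def)
      show ?case
      proof (cases "word_form q x u = 0 \<or> word_form q w y = 0")
        case False
        then have "mset u = mset w \<longleftrightarrow> mset x = mset y"
          using word_form_mset[of q x u] word_form_mset[of q w y] by simp
        then show ?thesis using \<open>length u = n\<close> by (simp add: z A'_def)
      qed (auto simp: z)
    qed simp
    also have "\<dots> = (if mset x = mset y then 1 else 0) * word_form q x y"
      unfolding A[OF xy, symmetric] sum_distrib_left by (rule sum.cong) auto
    also have "\<dots> = word_form q x y" using word_form_mset[of q x y] by auto
    finally show "(\<Sum>(u, w)\<in>words J n \<times> words J n. word_form q x u * A' u w * word_form q w y)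
      = word_form q x y" .
  qed (auto simp: A'_def split: if_splits)
qed

section \<open>Operators satisfying the linking and Nichols relations\<close>

abbreviation endo :: "('k::field \<Rightarrow> 'm::ab_group_add \<Rightarrow> 'm) \<Rightarrow> ('m \<Rightarrow> 'm) \<Rightarrow> bool"
  where "endo s \<equiv> Vector_Spaces.linear s s"

context vector_space
begin

lemma endo_iff: "endo scale f \<longleftrightarrow> (\<forall>x y. f (x + y) = f x + f y) \<and> (\<forall>c x. f (scale c x) = scale c (f x))"
  by (auto simp: Vector_Spaces.linear_iff vector_space_axioms)

lemma endo_simps:
  assumes "endo scale f"
  shows "f (x + y) = f x + f y" "f (scale c x) = scale c (f x)" "f 0 = 0" "f (x - y) = f x - f y"
    "f (\<Sum>i\<in>I. g i) = (\<Sum>i\<in>I. f (g i))"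
proof -
  interpret f: Vector_Spaces.linear scale scale f by fact
  show "f (x + y) = f x + f y" "f (scale c x) = scale c (f x)" "f 0 = 0" "f (x - y) = f x - f y"
    "f (\<Sum>i\<in>I. g i) = (\<Sum>i\<in>I. f (g i))"
    by (rule f.add f.scale f.zero f.diff f.sum)+
qed

lemma endo_foldr: "(\<And>i. endo scale (T i)) \<Longrightarrow> endo scale (foldr T w)"
  by (induction w) (auto simp: endo_iff)

lemma endo_deriv:
  assumes "endo scale f"
  shows "f (right_deriv q scale i u g) = right_deriv q scale i u (\<lambda>y. f (g y))"
    "f (left_deriv q scale i u g) = left_deriv q scale i u (\<lambda>y. f (g y))"
proof -
  interpret vector_space_pair scale scale ..
  show "f (right_deriv q scale i u g) = right_deriv q scale i u (\<lambda>y. f (g y))"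
    "f (left_deriv q scale i u g) = left_deriv q scale i u (\<lambda>y. f (g y))"
    using deriv_linear[OF assms] by metis+
qed

lemma deriv_scale:
  "right_deriv q scale i u (\<lambda>y. scale c (f y)) = scale c (right_deriv q scale i u f)"
  "left_deriv q scale i u (\<lambda>y. scale c (f y)) = scale c (left_deriv q scale i u f)"
proof -
  have "endo scale (scale c)" by (simp add: endo_iff scale_right_distrib mult.commute)
  from endo_deriv[OF this] show
    "right_deriv q scale i u (\<lambda>y. scale c (f y)) = scale c (right_deriv q scale i u f)"
    "left_deriv q scale i u (\<lambda>y. scale c (f y)) = scale c (left_deriv q scale i u f)" by metis+
qed

end

text \<open>The operators stand for v_i divided by l_i, for w_i and for K_i L_i. The last two axioms
  say that elements of the radical act by zero, written in coefficients so that no quotient of the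
  tensor algebra appears.\<close>

locale linked_rep = vector_space scale
  for scale :: "'k::field \<Rightarrow> 'm::ab_group_add \<Rightarrow> 'm" +
  fixes q :: "'n::finite \<Rightarrow> 'n \<Rightarrow> 'k" and E F k :: "'n \<Rightarrow> 'm \<Rightarrow> 'm"
  assumes q_nonzero: "q i j \<noteq> 0"
    and endo_E: "endo scale (E i)" and endo_F: "endo scale (F i)" and endo_k: "endo scale (k i)"
    and k_E: "k i (E j x) = scale (q i j * q j i) (E j (k i x))"
    and k_F: "k i (F j x) = scale (inverse (q i j * q j i)) (F j (k i x))"
    and E_F: "E i (F j x) = scale (inverse (q i j)) (F j (E i x)) + (if i = j then k i x - x else 0)"
    and radical_E: "finite A \<Longrightarrow> (\<And>x. (\<Sum>w\<in>A. c w * word_form q x w) = 0) \<Longrightarrow>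
      (\<Sum>w\<in>A. scale (c w) (foldr E w z)) = 0"
    and radical_F: "finite A \<Longrightarrow> (\<And>x. (\<Sum>w\<in>A. c w * word_form q x w) = 0) \<Longrightarrow>
      (\<Sum>w\<in>A. scale (c w) (foldr F w z)) = 0"
begin

lemmas E_simps = endo_simps[OF endo_E] and F_simps = endo_simps[OF endo_F]
  and E_word_simps = endo_simps[OF endo_foldr, of E, OF endo_E]
  and F_word_simps = endo_simps[OF endo_foldr, of F, OF endo_F]

lemma q_words_nonzero: "letter_word q i u \<noteq> 0" "word_letter q u i \<noteq> 0"
  by (rule letter_word_nonzero word_letter_nonzero, rule q_nonzero)+

lemma k_E_word: "k i (foldr E u z) = scale (letter_word q i u * word_letter q u i) (foldr E u (k i z))"
  by (induction u) (simp_all add: k_E E_simps mult_ac)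

lemma k_F_word:
  "k i (foldr F u z) = scale (inverse (letter_word q i u * word_letter q u i)) (foldr F u (k i z))"
  by (induction u) (simp_all add: k_F F_simps mult_ac)

text \<open>If E_i meets the letter i in u = u1 i u2, the result is (k_i - 1) between the words of
  u1 and u2, with the scalar collected along u1. That scalar is rewritten as a skew derivation times
  a scalar depending only on the letters of the remaining word u1 u2, the shape in which the
  canonical element can absorb it.\<close>

lemma E_F_word:
  "E i (foldr F u z) = scale (inverse (letter_word q i u)) (foldr F u (E i z))
    + left_deriv q scale i u (\<lambda>y. scale (inverse (letter_word q i y * word_letter q y i)) (foldr F y (k i z)))
    - right_deriv q scale i u (\<lambda>y. scale (inverse (letter_word q i y)) (foldr F y z))"
proof (induction u)
  case (Cons j u)
  let ?f = "\<lambda>y. scale (inverse (letter_word q i y * word_letter q y i)) (foldr F y (k i z))"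
  let ?g = "\<lambda>y. scale (inverse (letter_word q i y)) (foldr F y z)"
  have f: "scale (q j i) (left_deriv q scale i u (\<lambda>y. ?f (j # y)))
      = scale (inverse (q i j)) (F j (left_deriv q scale i u ?f))"
    unfolding endo_deriv[OF endo_F] deriv_scale[symmetric]
    by (rule left_deriv_cong) (use q_nonzero[of j i] in \<open>simp add: F_simps field_simps\<close>)
  have g: "right_deriv q scale i u (\<lambda>y. ?g (j # y))
      = scale (inverse (q i j)) (F j (right_deriv q scale i u ?g))"
    unfolding endo_deriv[OF endo_F] deriv_scale[symmetric]
    by (simp add: F_simps ac_simps)
  have "E i (foldr F (j # u) z) = scale (inverse (q i j)) (F j (E i (foldr F u z)))
      + (if i = j then k i (foldr F u z) - foldr F u z else 0)"
    by (simp add: E_F)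
  also have "\<dots> = scale (inverse (letter_word q i (j # u))) (foldr F (j # u) (E i z))
    + left_deriv q scale i (j # u) ?f - right_deriv q scale i (j # u) ?g"
    unfolding left_deriv.simps right_deriv.simps f g Cons
    using q_words_nonzero
    by (simp add: F_simps scale_right_distrib scale_right_diff_distrib k_F_word ac_simps)
  finally show ?case .
qed simp

lemma E_word_F:
  "foldr E u (F i z) = scale (inverse (word_letter q u i)) (F i (foldr E u z))
    + right_deriv q scale i u (\<lambda>y. foldr E y (k i z))
    - left_deriv q scale i u (\<lambda>y. scale (inverse (word_letter q y i)) (foldr E y z))"
proof (induction u)
  case (Cons j u)
  let ?f = "\<lambda>y. foldr E y (k i z)"
  let ?g = "\<lambda>y. scale (inverse (word_letter q y i)) (foldr E y z)"
  have f: "right_deriv q scale i u (\<lambda>y. ?f (j # y)) = E j (right_deriv q scale i u ?f)"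
    unfolding endo_deriv[OF endo_E] by simp
  have g: "scale (q j i) (left_deriv q scale i u (\<lambda>y. ?g (j # y))) = E j (left_deriv q scale i u ?g)"
    unfolding endo_deriv[OF endo_E] deriv_scale[symmetric]
    using q_nonzero[of j i] by (simp add: E_simps flip: mult.assoc)
  have "foldr E (j # u) (F i z) = scale (inverse (word_letter q u i)) (E j (F i (foldr E u z)))
      + E j (right_deriv q scale i u ?f) - E j (left_deriv q scale i u ?g)"
    by (simp add: Cons E_simps)
  also have "\<dots> = scale (inverse (word_letter q (j # u) i)) (F i (foldr E (j # u) z))
    + right_deriv q scale i (j # u) ?f - left_deriv q scale i (j # u) ?g"
    unfolding left_deriv.simps right_deriv.simps f g E_F
    using q_words_nonzero
    by (auto simp: scale_right_distrib scale_right_diff_distrib k_E_word ac_simps)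
  finally show ?case .
qed simp

text \<open>The Gram matrix on the words ij and ji has diagonal \<open>q i j\<close>,
  \<open>q j i\<close> and off-diagonal entries 1, so it is singular under the hypothesis. Its
  kernel vector, with entries 1 and \<open>- q i j\<close>, is the quantum Serre relation for
  unlinked letters.\<close>

lemma commute_letters:
  assumes "i \<noteq> j" "q i j * q j i = 1"
  shows "E i (E j z) = scale (q i j) (E j (E i z))" "F i (F j z) = scale (q i j) (F j (F i z))"
proof -
  let ?A = "{[i, j], [j, i]}" and ?c = "\<lambda>w. if w = [i, j] then 1 else - q i j"
  have *: "(\<Sum>w\<in>?A. ?c w * word_form q x w) = 0" for x
  proof (cases "x = [i, j] \<or> x = [j, i]")
    case True
    then show ?thesis using assms by auto
  next
    case False
    have "word_form q x [i, j] = 0 \<and> word_form q x [j, i] = 0"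
    proof (rule ccontr)
      assume "\<not> ?thesis"
      then have "mset x = {#i, j#}" using word_form_mset[of q x] by fastforce
      then have "length x = 2" by (metis size_mset size_add_mset size_empty numeral_2_eq_2)
      then obtain a b where x: "x = [a, b]" by (auto simp: length_Suc_conv numeral_2_eq_2)
      then show False using \<open>mset x = {#i, j#}\<close> False by (auto simp: add_eq_conv_ex)
    qed
    then show ?thesis using assms(1) by simp
  qed
  have "(\<Sum>w\<in>?A. scale (?c w) (foldr E w z)) = 0" by (rule radical_E) (auto intro: *)
  then show "E i (E j z) = scale (q i j) (E j (E i z))" using assms(1) by (simp add: add_eq_0_iff2)
  have "(\<Sum>w\<in>?A. scale (?c w) (foldr F w z)) = 0" by (rule radical_F) (auto intro: *)
  then show "F i (F j z) = scale (q i j) (F j (F i z))" using assms(1) by (simp add: add_eq_0_iff2)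
qed

end

section \<open>The Casimir operator of a set of letters\<close>

locale casimir = linked_rep scale q E F k
  for scale :: "'k::field \<Rightarrow> 'm::ab_group_add \<Rightarrow> 'm"
    and q :: "'n::finite \<Rightarrow> 'n \<Rightarrow> 'k" and E F k :: "'n \<Rightarrow> 'm \<Rightarrow> 'm" +
  fixes J :: "'n set" and A :: "'n list \<Rightarrow> 'n list \<Rightarrow> 'k" and B :: nat
  assumes J_orthogonal: "i \<in> J \<Longrightarrow> j \<notin> J \<Longrightarrow> q i j * q j i = 1"
    and A_mset: "A u w \<noteq> 0 \<Longrightarrow> mset u = mset w"
    and A_inverse: "x \<in> words J n \<Longrightarrow> y \<in> words J n \<Longrightarrow>
      (\<Sum>(u, w)\<in>words J n \<times> words J n. word_form q x u * A u w * word_form q w y) = word_form q x y"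
    and E_nilpotent: "length w \<ge> B \<Longrightarrow> foldr E w z = 0"
begin

abbreviation word_pairs :: "nat \<Rightarrow> ('n list \<times> 'n list) set"
  where "word_pairs n \<equiv> words J n \<times> words J n"

lemma finite_word_pairs: "finite (words J n)" "finite (word_pairs n)"
  by (simp_all add: finite_words)

definition casimir_part :: "nat \<Rightarrow> 'm \<Rightarrow> 'm"
  where "casimir_part n z = (\<Sum>(u, w)\<in>word_pairs n. scale (A u w) (foldr F u (foldr E w z)))"

text \<open>The part of degree B is zero because E-words of that length are. Including it lets the
  part of degree 0 be split off whatever B is.\<close>

definition casimir_op :: "'m \<Rightarrow> 'm"
  where "casimir_op z = (\<Sum>n<Suc B. casimir_part n z)"

text \<open>The difference \<open>d\<close> of the two sides, as a combination of words, lies in the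
  radical and is killed by T. Words outside \<open>words J n\<close> pair to zero with all words
  involved, so testing inside is enough.\<close>

lemma word_expansion:
  assumes T: "\<And>S c. finite S \<Longrightarrow> (\<And>x. (\<Sum>w\<in>S. c w * word_form q x w) = 0) \<Longrightarrow>
      (\<Sum>w\<in>S. scale (c w) (T w)) = (0 :: 'm)"
    and c: "\<And>y. y \<in> words J n \<Longrightarrow> (\<Sum>z\<in>word_pairs n. c z * word_form q (t z) y) = word_form q x y"
    and t: "\<And>z. z \<in> word_pairs n \<Longrightarrow> t z \<in> words J n" and x: "x \<in> words J n"
  shows "(\<Sum>z\<in>word_pairs n. scale (c z) (T (t z))) = T x"
proof -
  define d where "d w = (\<Sum>z\<in>word_pairs n. if t z = w then c z else 0) - (if w = x then 1 else 0)" for w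
  have reindex: "(\<Sum>w\<in>words J n. \<Sum>z\<in>word_pairs n. if t z = w then f z else 0) = (\<Sum>z\<in>word_pairs n. f z)"
    for f :: "_ \<Rightarrow> 'a::comm_monoid_add"
    by (subst sum.swap) (use t finite_word_pairs in \<open>auto intro!: sum.cong\<close>)
  have "(\<Sum>w\<in>words J n. d w * word_form q y w) = 0" for y
  proof (cases "y \<in> words J n")
    case True
    have "(\<Sum>w\<in>words J n. d w * word_form q y w)
        = (\<Sum>w\<in>words J n. (\<Sum>z\<in>word_pairs n. if t z = w then c z * word_form q y (t z) else 0)
          - (if w = x then word_form q y x else 0))"
      by (rule sum.cong) (auto simp: d_def left_diff_distrib sum_distrib_right intro!: sum.cong)
    also have "\<dots> = (\<Sum>z\<in>word_pairs n. c z * word_form q y (t z)) - word_form q y x"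
      unfolding sum_subtractf reindex using finite_word_pairs x by simp
    also have "\<dots> = 0" using c[OF True] by (simp add: word_form_commute[of q y])
    finally show ?thesis .
  next
    case False
    then have "word_form q y w = 0" if "w \<in> words J n" for w
      using that word_form_mset words_mset_cong by metis
    then show ?thesis by simp
  qed
  then have "(\<Sum>w\<in>words J n. scale (d w) (T w)) = 0" by (rule T[OF finite_word_pairs(1)])
  moreover have "(\<Sum>w\<in>words J n. scale (d w) (T w))
      = (\<Sum>w\<in>words J n. (\<Sum>z\<in>word_pairs n. if t z = w then scale (c z) (T (t z)) else 0)
          - (if w = x then T x else 0))"
    by (rule sum.cong)
      (auto simp: d_def scale_left_diff_distrib scale_sum_left intro!: arg_cong2[where f = minus] sum.cong)
  moreover have "\<dots> = (\<Sum>z\<in>word_pairs n. scale (c z) (T (t z))) - T x"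
    unfolding sum_subtractf reindex using finite_word_pairs x by simp
  ultimately show ?thesis by simp
qed

text \<open>The reproducing property of the canonical element. Between words it holds only modulo
  the radical, which acts by zero here.\<close>

lemma E_word_expansion:
  assumes "x \<in> words J n"
  shows "(\<Sum>(u, w)\<in>word_pairs n. scale (word_form q x u * A u w) (foldr E w z)) = foldr E x z"
proof -
  have "(\<Sum>y\<in>word_pairs n. scale (word_form q x (fst y) * A (fst y) (snd y)) (foldr E (snd y) z)) = foldr E x z"
  proof (rule word_expansion[where T = "\<lambda>w. foldr E w z"])
    fix y assume "y \<in> words J n"
    then show "(\<Sum>z\<in>word_pairs n. word_form q x (fst z) * A (fst z) (snd z) * word_form q (snd z) y) = word_form q x y"
      using A_inverse[OF assms, of y] by (simp only: case_prod_unfold)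
  qed (use assms radical_E in auto)
  then show ?thesis by (simp add: case_prod_unfold)
qed

lemma F_word_expansion:
  assumes "x \<in> words J n"
  shows "(\<Sum>(u, w)\<in>word_pairs n. scale (A u w * word_form q w x) (foldr F u z)) = foldr F x z"
proof -
  have "(\<Sum>y\<in>word_pairs n. scale (A (fst y) (snd y) * word_form q (snd y) x) (foldr F (fst y) z)) = foldr F x z"
  proof (rule word_expansion[where T = "\<lambda>w. foldr F w z"])
    fix y assume "y \<in> words J n"
    then have "word_form q y x = (\<Sum>z\<in>word_pairs n. word_form q y (fst z) * A (fst z) (snd z) * word_form q (snd z) x)"
      using A_inverse[OF _ assms, of y] by (simp only: case_prod_unfold)
    also have "\<dots> = (\<Sum>z\<in>word_pairs n. A (fst z) (snd z) * word_form q (snd z) x * word_form q (fst z) y)"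
      by (rule sum.cong[OF refl], subst word_form_commute[of q y]) (simp only: ac_simps)
    finally show "(\<Sum>z\<in>word_pairs n. A (fst z) (snd z) * word_form q (snd z) x * word_form q (fst z) y) = word_form q x y"
      by (simp only: word_form_commute[of q x y])
  qed (use assms radical_F in auto)
  then show ?thesis by (simp add: case_prod_unfold)
qed

text \<open>The adjunction behind the commutation rules: a derivation D on the F-words in degree n +
  1 becomes an extra letter on the E-words in degree n. Expand the shortened F-words by the
  reproducing property; then D acts only on values of the form, where the recursion of the form
  turns it into \<open>p\<close>, and the sum over degree n + 1 contracts again. \<open>d\<close> is
  the scalar version of \<open>D\<close>, \<open>p\<close> attaches i at one end, and
  \<open>h\<close> is a scalar that depends only on the letters and so passes from the F-word to the
  E-word.\<close>

lemma casimir_deriv_F: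
  assumes D: "\<And>u f g. (\<And>y. add_mset i (mset y) = mset u \<Longrightarrow> f y = g y) \<Longrightarrow> D u f = D u g"
    and D_sum: "\<And>u c T. D u (\<lambda>y. \<Sum>z\<in>word_pairs n. scale (c z y) (T z)) = (\<Sum>z\<in>word_pairs n. scale (d u (c z)) (T z))"
    and d: "\<And>u w c. w \<in> words J n \<Longrightarrow> d u (\<lambda>y. c * word_form q w y) = c * word_form q (p w) u"
    and p: "\<And>w. w \<in> words J n \<Longrightarrow> p w \<in> words J (Suc n)"
    and h: "\<And>y y'. mset y = mset y' \<Longrightarrow> h y = h y'"
  shows "(\<Sum>(u, w)\<in>word_pairs (Suc n). scale (A u w) (D u (\<lambda>y. scale (h y) (foldr F y (foldr E w z)))))
    = (\<Sum>(u, w)\<in>word_pairs n. scale (A u w * h w) (foldr F u (foldr E (p w) z)))"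
proof -
  have 1: "D u (\<lambda>y. scale (h y) (foldr F y x))
      = (\<Sum>(u', w')\<in>word_pairs n. scale (A u' w' * h w' * word_form q (p w') u) (foldr F u' x))"
    if u: "u \<in> words J (Suc n)" for u x
  proof -
    have "D u (\<lambda>y. scale (h y) (foldr F y x))
      = D u (\<lambda>y. \<Sum>z\<in>word_pairs n. scale (A (fst z) (snd z) * h (snd z) * word_form q (snd z) y) (foldr F (fst z) x))"
    proof (rule D)
      fix y assume "add_mset i (mset y) = mset u"
      then have y: "y \<in> words J n" using u by (rule words_Suc_add_mset)
      have hy: "h y * (A u w * word_form q w y) = A u w * h w * word_form q w y" for u w
      proof -
        have *: "h y * word_form q w y = h w * word_form q w y"
          by (rule word_form_mult_cong) (rule h, simp)
        show ?thesis unfolding mult.left_commute[of "h y"] * by (rule mult.assoc[symmetric])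
      qed
      show "scale (h y) (foldr F y x)
        = (\<Sum>z\<in>word_pairs n. scale (A (fst z) (snd z) * h (snd z) * word_form q (snd z) y) (foldr F (fst z) x))"
        by (subst F_word_expansion[OF y, symmetric])
            (simp only: scale_sum_right case_prod_unfold scale_scale hy)
    qed
    also have "\<dots> = (\<Sum>z\<in>word_pairs n. scale (A (fst z) (snd z) * h (snd z) * word_form q (p (snd z)) u) (foldr F (fst z) x))"
      unfolding D_sum by (rule sum.cong) (auto simp: d)
    finally show ?thesis by (simp add: case_prod_unfold)
  qed
  have "(\<Sum>(u, w)\<in>word_pairs (Suc n). scale (A u w) (D u (\<lambda>y. scale (h y) (foldr F y (foldr E w z)))))
    = (\<Sum>(u, w)\<in>word_pairs (Suc n). \<Sum>(u', w')\<in>word_pairs n.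
        scale (A u' w' * h w') (scale (word_form q (p w') u * A u w) (foldr F u' (foldr E w z))))"
  proof (rule sum.cong[OF refl], clarify)
    fix u w assume u: "u \<in> words J (Suc n)"
    show "scale (A u w) (D u (\<lambda>y. scale (h y) (foldr F y (foldr E w z))))
      = (\<Sum>(u', w')\<in>word_pairs n.
        scale (A u' w' * h w') (scale (word_form q (p w') u * A u w) (foldr F u' (foldr E w z))))"
      unfolding 1[OF u] scale_sum_right
      by (rule sum.cong[OF refl]) (simp add: case_prod_unfold mult_ac)
  qed
  also have "\<dots> = (\<Sum>(u', w')\<in>word_pairs n. scale (A u' w' * h w') (foldr F u'
      (\<Sum>(u, w)\<in>word_pairs (Suc n). scale (word_form q (p w') u * A u w) (foldr E w z))))"
    unfolding case_prod_unfold by (subst sum.swap) (simp add: F_word_simps scale_sum_right)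
  also have "\<dots> = (\<Sum>(u', w')\<in>word_pairs n. scale (A u' w' * h w') (foldr F u' (foldr E (p w') z)))"
    by (rule sum.cong) (auto simp: E_word_expansion p)
  finally show ?thesis .
qed

text \<open>The same adjunction with the two factors of the canonical element exchanged.\<close>

lemma casimir_deriv_E:
  assumes D: "\<And>u f g. (\<And>y. add_mset i (mset y) = mset u \<Longrightarrow> f y = g y) \<Longrightarrow> D u f = D u g"
    and D_sum: "\<And>u c T. D u (\<lambda>y. \<Sum>z\<in>word_pairs n. scale (c z y) (T z)) = (\<Sum>z\<in>word_pairs n. scale (d u (c z)) (T z))"
    and d: "\<And>u w c. w \<in> words J n \<Longrightarrow> d u (\<lambda>y. c * word_form q w y) = c * word_form q (p w) u"
    and p: "\<And>w. w \<in> words J n \<Longrightarrow> p w \<in> words J (Suc n)"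
    and h: "\<And>y y'. mset y = mset y' \<Longrightarrow> h y = h y'"
  shows "(\<Sum>(u, w)\<in>word_pairs (Suc n). scale (A u w) (foldr F u (D w (\<lambda>y. scale (h y) (foldr E y z)))))
    = (\<Sum>(u, w)\<in>word_pairs n. scale (A u w * h u) (foldr F (p u) (foldr E w z)))"
proof -
  have 1: "D w (\<lambda>y. scale (h y) (foldr E y x))
      = (\<Sum>(u', w')\<in>word_pairs n. scale (A u' w' * h u' * word_form q (p u') w) (foldr E w' x))"
    if w: "w \<in> words J (Suc n)" for w x
  proof -
    have "D w (\<lambda>y. scale (h y) (foldr E y x))
      = D w (\<lambda>y. \<Sum>z\<in>word_pairs n. scale (A (fst z) (snd z) * h (fst z) * word_form q (fst z) y) (foldr E (snd z) x))"
    proof (rule D)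
      fix y assume "add_mset i (mset y) = mset w"
      then have y: "y \<in> words J n" using w by (rule words_Suc_add_mset)
      have hy: "h y * (word_form q y u * A u w) = A u w * h u * word_form q u y" for u w
      proof -
        have *: "h y * word_form q u y = h u * word_form q u y"
          by (rule word_form_mult_cong) (rule h, simp)
        show ?thesis
          unfolding word_form_commute[of q y u] mult.assoc[symmetric] * by (simp only: ac_simps)
      qed
      show "scale (h y) (foldr E y x)
        = (\<Sum>z\<in>word_pairs n. scale (A (fst z) (snd z) * h (fst z) * word_form q (fst z) y) (foldr E (snd z) x))"
        by (subst E_word_expansion[OF y, symmetric])
            (simp only: scale_sum_right case_prod_unfold scale_scale hy)
    qed
    also have "\<dots> = (\<Sum>z\<in>word_pairs n. scale (A (fst z) (snd z) * h (fst z) * word_form q (p (fst z)) w) (foldr E (snd z) x))"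
      unfolding D_sum by (rule sum.cong) (auto simp: d)
    finally show ?thesis by (simp add: case_prod_unfold)
  qed
  have "(\<Sum>(u, w)\<in>word_pairs (Suc n). scale (A u w) (foldr F u (D w (\<lambda>y. scale (h y) (foldr E y z)))))
    = (\<Sum>(u, w)\<in>word_pairs (Suc n). \<Sum>(u', w')\<in>word_pairs n.
        scale (A u' w' * h u') (scale (A u w * word_form q w (p u')) (foldr F u (foldr E w' z))))"
  proof (rule sum.cong[OF refl], clarify)
    fix u w assume w: "w \<in> words J (Suc n)"
    show "scale (A u w) (foldr F u (D w (\<lambda>y. scale (h y) (foldr E y z))))
      = (\<Sum>(u', w')\<in>word_pairs n.
        scale (A u' w' * h u') (scale (A u w * word_form q w (p u')) (foldr F u (foldr E w' z))))"
      unfolding 1[OF w] F_word_simps scale_sum_right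
      by (rule sum.cong[OF refl]) (simp add: case_prod_unfold F_word_simps word_form_commute[of q w] mult_ac)
  qed
  also have "\<dots> = (\<Sum>(u', w')\<in>word_pairs n. scale (A u' w' * h u')
      (\<Sum>(u, w)\<in>word_pairs (Suc n). scale (A u w * word_form q w (p u')) (foldr F u (foldr E w' z))))"
    unfolding case_prod_unfold by (subst sum.swap) (simp add: scale_sum_right)
  also have "\<dots> = (\<Sum>(u', w')\<in>word_pairs n. scale (A u' w' * h u') (foldr F (p u') (foldr E w' z)))"
    by (rule sum.cong) (auto simp: F_word_expansion p)
  finally show ?thesis .
qed

lemma word_deriv_sum:
  "right_deriv q scale i u (\<lambda>y. \<Sum>z\<in>S. scale (c z y) (T z)) = (\<Sum>z\<in>S. scale (rderiv q i u (c z)) (T z))"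
  "left_deriv q scale i u (\<lambda>y. \<Sum>z\<in>S. scale (c z y) (T z)) = (\<Sum>z\<in>S. scale (lderiv q i u (c z)) (T z))"
  by (simp_all add: deriv_sum deriv_scale_vector)

lemma casimir_right_deriv_F:
  assumes "i \<in> J" "\<And>y y'. mset y = mset y' \<Longrightarrow> h y = h y'"
  shows "(\<Sum>(u, w)\<in>word_pairs (Suc n). scale (A u w) (right_deriv q scale i u (\<lambda>y. scale (h y) (foldr F y (foldr E w z)))))
    = (\<Sum>(u, w)\<in>word_pairs n. scale (A u w * h w) (foldr F u (foldr E (i # w) z)))"
proof (rule casimir_deriv_F[where i = i and d = "rderiv q i" and h = h])
  show "right_deriv q scale i u f = right_deriv q scale i u g"
    if "\<And>y. add_mset i (mset y) = mset u \<Longrightarrow> f y = g y" for u f g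
    using that by (rule right_deriv_cong)
  show "h y = h y'" if "mset y = mset y'" for y y'
    using that by (rule assms(2))
qed (use assms(1) in \<open>auto simp: word_deriv_sum deriv_mult_left word_form_snoc words_def\<close>)

lemma casimir_left_deriv_F:
  assumes "i \<in> J" "\<And>y y'. mset y = mset y' \<Longrightarrow> h y = h y'"
  shows "(\<Sum>(u, w)\<in>word_pairs (Suc n). scale (A u w) (left_deriv q scale i u (\<lambda>y. scale (h y) (foldr F y (foldr E w z)))))
    = (\<Sum>(u, w)\<in>word_pairs n. scale (A u w * h w) (foldr F u (foldr E (w @ [i]) z)))"
proof (rule casimir_deriv_F[where i = i and d = "lderiv q i" and h = h])
  show "left_deriv q scale i u f = left_deriv q scale i u g"
    if "\<And>y. add_mset i (mset y) = mset u \<Longrightarrow> f y = g y" for u f g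
    using that by (rule left_deriv_cong)
  show "h y = h y'" if "mset y = mset y'" for y y'
    using that by (rule assms(2))
qed (use assms(1) in \<open>auto simp: word_deriv_sum deriv_mult_left word_form_snoc words_def\<close>)

lemma casimir_right_deriv_E:
  assumes "i \<in> J" "\<And>y y'. mset y = mset y' \<Longrightarrow> h y = h y'"
  shows "(\<Sum>(u, w)\<in>word_pairs (Suc n). scale (A u w) (foldr F u (right_deriv q scale i w (\<lambda>y. scale (h y) (foldr E y z)))))
    = (\<Sum>(u, w)\<in>word_pairs n. scale (A u w * h u) (foldr F (i # u) (foldr E w z)))"
proof (rule casimir_deriv_E[where i = i and d = "rderiv q i" and h = h])
  show "right_deriv q scale i u f = right_deriv q scale i u g"
    if "\<And>y. add_mset i (mset y) = mset u \<Longrightarrow> f y = g y" for u f g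
    using that by (rule right_deriv_cong)
  show "h y = h y'" if "mset y = mset y'" for y y'
    using that by (rule assms(2))
qed (use assms(1) in \<open>auto simp: word_deriv_sum deriv_mult_left word_form_snoc words_def\<close>)

lemma casimir_left_deriv_E:
  assumes "i \<in> J" "\<And>y y'. mset y = mset y' \<Longrightarrow> h y = h y'"
  shows "(\<Sum>(u, w)\<in>word_pairs (Suc n). scale (A u w) (foldr F u (left_deriv q scale i w (\<lambda>y. scale (h y) (foldr E y z)))))
    = (\<Sum>(u, w)\<in>word_pairs n. scale (A u w * h u) (foldr F (u @ [i]) (foldr E w z)))"
proof (rule casimir_deriv_E[where i = i and d = "lderiv q i" and h = h])
  show "left_deriv q scale i u f = left_deriv q scale i u g"
    if "\<And>y. add_mset i (mset y) = mset u \<Longrightarrow> f y = g y" for u f g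
    using that by (rule left_deriv_cong)
  show "h y = h y'" if "mset y = mset y'" for y y'
    using that by (rule assms(2))
qed (use assms(1) in \<open>auto simp: word_deriv_sum deriv_mult_left word_form_snoc words_def\<close>)

text \<open>Moving E_i through the F-words yields f, where E_i reaches the E-words, and the
  derivation terms g without k_i and h with it. By adjunction g in degree n + 1 is f in degree n, so
  these telescope, while h in degree n + 1 is the part of degree n with E_i absorbed on the
  right.\<close>

lemma casimir_E:
  assumes i: "i \<in> J" and m: "k i m = scale \<kappa> m"
  shows "E i (casimir_op m) = scale (\<kappa> * (q i i * q i i)) (casimir_op (E i m))"
proof -
  define f where "f n = (\<Sum>(u, w)\<in>word_pairs n. scale (A u w * inverse (letter_word q i u)) (foldr F u (E i (foldr E w m))))" for n
  define g where "g n = (\<Sum>(u, w)\<in>word_pairs n. scale (A u w) (right_deriv q scale i u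
    (\<lambda>y. scale (inverse (letter_word q i y)) (foldr F y (foldr E w m)))))" for n
  define h where "h n = (\<Sum>(u, w)\<in>word_pairs n. scale (A u w) (left_deriv q scale i u
    (\<lambda>y. scale (\<kappa> * (q i i * q i i)) (foldr F y (foldr E w m)))))" for n
  have part: "E i (casimir_part n m) = f n + h n - g n" for n
  proof -
    have "E i (casimir_part n m) = (\<Sum>(u, w)\<in>word_pairs n. scale (A u w * inverse (letter_word q i u)) (foldr F u (E i (foldr E w m)))
      + scale (A u w) (left_deriv q scale i u (\<lambda>y. scale (\<kappa> * (q i i * q i i)) (foldr F y (foldr E w m))))
      - scale (A u w) (right_deriv q scale i u (\<lambda>y. scale (inverse (letter_word q i y)) (foldr F y (foldr E w m)))))"
      unfolding casimir_part_def E_simps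
    proof (rule sum.cong, goal_cases)
      case (2 z)
      obtain u w where z: "z = (u, w)" by (cases z)
      show ?case
      proof (cases "A u w = 0")
        case False
        have "left_deriv q scale i u (\<lambda>y. scale (inverse (letter_word q i y * word_letter q y i)) (foldr F y (k i (foldr E w m))))
          = left_deriv q scale i u (\<lambda>y. scale (\<kappa> * (q i i * q i i)) (foldr F y (foldr E w m)))"
        proof (rule left_deriv_cong)
          \<comment> \<open>Since w is a rearrangement of i # y, the contribution of y to the value
            of k_i cancels. What is left is \<kappa> and two factors \<open>q i i\<close> from the
            extra letter i.\<close>
          fix y assume "add_mset i (mset y) = mset u"
          then have "mset w = mset (i # y)" using A_mset[OF False] by simp
          then have *: "letter_word q i w = q i i * letter_word q i y" "word_letter q w i = q i i * word_letter q y i"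
            using letter_word_mset_cong[of w "i # y"] word_letter_mset_cong[of w "i # y"] by auto
          show "scale (inverse (letter_word q i y * word_letter q y i)) (foldr F y (k i (foldr E w m)))
            = scale (\<kappa> * (q i i * q i i)) (foldr F y (foldr E w m))"
            using q_words_nonzero by (simp add: k_E_word m E_word_simps F_word_simps * field_simps)
        qed
        then show ?thesis
          by (simp add: z E_simps E_F_word scale_right_distrib scale_right_diff_distrib)
      qed (simp add: z E_simps)
    qed simp
    then show ?thesis
      by (simp add: f_def g_def h_def case_prod_unfold sum.distrib sum_subtractf)
  qed
  have g0: "g 0 = 0" and h0: "h 0 = 0"
    by (auto simp: g_def h_def words_def intro!: sum.neutral)
  have g: "g (Suc n) = f n" for n
  proof -
    have "g (Suc n) = (\<Sum>(u, w)\<in>word_pairs n. scale (A u w * inverse (letter_word q i w)) (foldr F u (foldr E (i # w) m)))"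
      unfolding g_def by (rule casimir_right_deriv_F[OF i]) (metis letter_word_mset_cong)
    also have "\<dots> = f n"
      unfolding f_def
    proof (rule sum.cong[OF refl], clarify)
      fix u w
      have "A u w * inverse (letter_word q i w) = A u w * inverse (letter_word q i u)"
        using A_mset[of u w] letter_word_mset_cong[of u w q i] by (cases "A u w = 0") auto
      then show "scale (A u w * inverse (letter_word q i w)) (foldr F u (foldr E (i # w) m))
        = scale (A u w * inverse (letter_word q i u)) (foldr F u (E i (foldr E w m)))" by simp
    qed
    finally show ?thesis .
  qed
  have h: "h (Suc n) = scale (\<kappa> * (q i i * q i i)) (casimir_part n (E i m))" for n
  proof -
    have "h (Suc n) = (\<Sum>(u, w)\<in>word_pairs n. scale (A u w * (\<kappa> * (q i i * q i i))) (foldr F u (foldr E (w @ [i]) m)))"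
      unfolding h_def by (rule casimir_left_deriv_F[OF i]) simp
    then show ?thesis by (simp add: casimir_part_def case_prod_unfold scale_sum_right mult.commute)
  qed
  have fB: "f B = 0"
  proof -
    have "E i (foldr E w m) = 0" if "w \<in> words J B" for w
      using E_nilpotent[of "i # w"] that by (simp add: words_def)
    then show ?thesis by (auto simp: f_def F_word_simps intro!: sum.neutral)
  qed
  have pB: "casimir_part B (E i m) = 0"
    by (auto simp: casimir_part_def words_def E_nilpotent F_word_simps intro!: sum.neutral)
  have "E i (casimir_op m) = (\<Sum>n<Suc B. f n) + (\<Sum>n<Suc B. h n) - (\<Sum>n<Suc B. g n)"
    unfolding casimir_op_def E_simps part by (simp add: sum.distrib sum_subtractf)
  also have "\<dots> = (\<Sum>n<B. scale (\<kappa> * (q i i * q i i)) (casimir_part n (E i m)))"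
    unfolding sum.lessThan_Suc_shift[of g] sum.lessThan_Suc_shift[of h] sum.lessThan_Suc[of f]
    by (simp add: g h g0 h0 fB)
  also have "\<dots> = scale (\<kappa> * (q i i * q i i)) (casimir_op (E i m))"
    by (simp add: casimir_op_def pB scale_sum_right)
  finally show ?thesis .
qed

text \<open>The mirror image: F_i is moved through the E-words from the right. Now k_i acts on m
  directly, so its value is \<kappa> without a contribution of i.\<close>

lemma casimir_F:
  assumes i: "i \<in> J" and m: "k i m = scale \<kappa> m"
  shows "casimir_op (F i m) = scale \<kappa> (F i (casimir_op m))"
proof -
  define f where "f n = (\<Sum>(u, w)\<in>word_pairs n. scale (A u w * inverse (word_letter q u i)) (foldr F u (F i (foldr E w m))))" for n
  define g where "g n = (\<Sum>(u, w)\<in>word_pairs n. scale (A u w) (foldr F u (left_deriv q scale i w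
    (\<lambda>y. scale (inverse (word_letter q y i)) (foldr E y m)))))" for n
  define h where "h n = (\<Sum>(u, w)\<in>word_pairs n. scale (A u w) (foldr F u (right_deriv q scale i w
    (\<lambda>y. scale \<kappa> (foldr E y m)))))" for n
  have part: "casimir_part n (F i m) = f n + h n - g n" for n
  proof -
    have "casimir_part n (F i m) = (\<Sum>(u, w)\<in>word_pairs n. scale (A u w * inverse (word_letter q u i)) (foldr F u (F i (foldr E w m)))
      + scale (A u w) (foldr F u (right_deriv q scale i w (\<lambda>y. scale \<kappa> (foldr E y m))))
      - scale (A u w) (foldr F u (left_deriv q scale i w (\<lambda>y. scale (inverse (word_letter q y i)) (foldr E y m)))))"
      unfolding casimir_part_def
    proof (rule sum.cong, goal_cases)
      case (2 z)
      obtain u w where z: "z = (u, w)" by (cases z)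
      show ?case
      proof (cases "A u w = 0")
        case False
        then have "word_letter q w i = word_letter q u i" using A_mset word_letter_mset_cong by metis
        then show ?thesis
          by (simp add: z E_word_F m E_word_simps F_word_simps scale_right_distrib scale_right_diff_distrib)
      qed (simp add: z)
    qed simp
    then show ?thesis
      by (simp add: f_def g_def h_def case_prod_unfold sum.distrib sum_subtractf)
  qed
  have g0: "g 0 = 0" and h0: "h 0 = 0"
    by (auto simp: g_def h_def words_def F_word_simps intro!: sum.neutral)
  have g: "g (Suc n) = f n" for n
  proof -
    have "g (Suc n) = (\<Sum>(u, w)\<in>word_pairs n. scale (A u w * inverse (word_letter q u i)) (foldr F (u @ [i]) (foldr E w m)))"
      unfolding g_def by (rule casimir_left_deriv_E[OF i]) (metis word_letter_mset_cong)
    then show ?thesis by (simp add: f_def)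
  qed
  have h: "h (Suc n) = scale \<kappa> (F i (casimir_part n m))" for n
  proof -
    have "h (Suc n) = (\<Sum>(u, w)\<in>word_pairs n. scale (A u w * \<kappa>) (foldr F (i # u) (foldr E w m)))"
      unfolding h_def by (rule casimir_right_deriv_E[OF i]) simp
    then show ?thesis
      by (simp add: casimir_part_def case_prod_unfold scale_sum_right F_simps mult.commute)
  qed
  have pB: "foldr E w m = 0" if "w \<in> words J B" for w
    using E_nilpotent that by (simp add: words_def)
  have fB: "f B = 0" and pB: "casimir_part B m = 0"
    by (auto simp: f_def casimir_part_def pB F_word_simps F_simps intro!: sum.neutral)
  have "casimir_op (F i m) = (\<Sum>n<Suc B. f n) + (\<Sum>n<Suc B. h n) - (\<Sum>n<Suc B. g n)"
    unfolding casimir_op_def part by (simp add: sum.distrib sum_subtractf)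
  also have "\<dots> = (\<Sum>n<B. scale \<kappa> (F i (casimir_part n m)))"
    unfolding sum.lessThan_Suc_shift[of g] sum.lessThan_Suc_shift[of h] sum.lessThan_Suc[of f]
    by (simp add: g h g0 h0 fB)
  also have "\<dots> = scale \<kappa> (F i (casimir_op m))"
    by (simp add: casimir_op_def pB scale_sum_right F_simps)
  finally show ?thesis .
qed

text \<open>Letters inside and outside J are orthogonal and commute up to scalars, also E with E and
  F with F. For E_i, and likewise for F_i, the scalars picked up at E-words and at F-words are
  inverse to each other, so they cancel along the canonical element.\<close>

lemma outer_letter_words:
  assumes i: "i \<notin> J" and w: "set w \<subseteq> J"
  shows "E i (foldr E w z) = scale (letter_word q i w) (foldr E w (E i z))"
    "F i (foldr F w z) = scale (letter_word q i w) (foldr F w (F i z))"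
    "E i (foldr F w z) = scale (inverse (letter_word q i w)) (foldr F w (E i z))"
    "F i (foldr E w z) = scale (inverse (letter_word q i w)) (foldr E w (F i z))"
proof -
  have *: "i \<noteq> j" "j \<noteq> i" "q i j * q j i = 1" "inverse (q i j) = q j i" if "j \<in> J" for j
    using that i J_orthogonal[of j i] q_nonzero[of i j] by (auto simp: field_simps)
  have FE: "F i (E j z) = scale (inverse (q i j)) (E j (F i z))" if "j \<in> J" for j z
    using E_F[of j i z] *[OF that] q_nonzero[of j i] by (simp add: field_simps)
  show "E i (foldr E w z) = scale (letter_word q i w) (foldr E w (E i z))"
    using w by (induction w) (auto simp: commute_letters(1)[of i] * E_simps)
  show "F i (foldr F w z) = scale (letter_word q i w) (foldr F w (F i z))"
    using w by (induction w) (auto simp: commute_letters(2)[of i] * F_simps)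
  show "E i (foldr F w z) = scale (inverse (letter_word q i w)) (foldr F w (E i z))"
    using w by (induction w) (auto simp: E_F *(1) F_simps ac_simps)
  show "F i (foldr E w z) = scale (inverse (letter_word q i w)) (foldr E w (F i z))"
    using w by (induction w) (auto simp: FE E_simps ac_simps)
qed

lemma endo_casimir: "endo scale casimir_op"
  unfolding endo_iff casimir_op_def casimir_part_def case_prod_unfold E_word_simps F_word_simps
  by (simp add: scale_right_distrib sum.distrib scale_sum_right ac_simps)

text \<open>Covers both the group elements and the generators outside \<open>J\<close>.\<close>

lemma casimir_commute:
  assumes T: "endo scale T"
    and "\<And>n u w z. u \<in> words J n \<Longrightarrow> w \<in> words J n \<Longrightarrow> mset u = mset w \<Longrightarrow>
      T (foldr F u (foldr E w z)) = foldr F u (foldr E w (T z))"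
  shows "T (casimir_op m) = casimir_op (T m)"
  unfolding casimir_op_def casimir_part_def endo_simps[OF T]
proof (intro sum.cong refl, goal_cases)
  case (1 n z)
  then show ?case using assms(2)[of "fst z" n "snd z" m] A_mset[of "fst z" "snd z"]
    by (cases "A (fst z) (snd z) = 0") (auto simp: case_prod_unfold endo_simps[OF T])
qed

lemma casimir_outer:
  assumes i: "i \<notin> J"
  shows "E i (casimir_op m) = casimir_op (E i m)" "F i (casimir_op m) = casimir_op (F i m)"
proof -
  show "E i (casimir_op m) = casimir_op (E i m)"
    by (rule casimir_commute[OF endo_E])
      (use q_words_nonzero in \<open>auto simp: words_def outer_letter_words[OF i] F_word_simps dest: letter_word_mset_cong[of _ _ q i]\<close>)
  show "F i (casimir_op m) = casimir_op (F i m)"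
    by (rule casimir_commute[OF endo_F])
      (use q_words_nonzero in \<open>auto simp: words_def outer_letter_words[OF i] F_word_simps dest: letter_word_mset_cong[of _ _ q i]\<close>)
qed

lemma casimir_part_0 [simp]: "casimir_part 0 m = m"
proof -
  have w: "words J 0 = {[]}" by (auto simp: words_def)
  have "A [] [] = 1" using A_inverse[of "[]" 0 "[]"] by (simp add: w)
  then show ?thesis by (simp add: casimir_part_def w)
qed

text \<open>The last letter of w acts first, so every summand of positive degree begins with some
  E_i, i in J, applied to m. For N = {0} this says that singular vectors are fixed.\<close>

lemma casimir_singular_mod:
  assumes N: "subspace N" "\<And>i x. x \<in> N \<Longrightarrow> F i x \<in> N" "\<And>i x. x \<in> N \<Longrightarrow> E i x \<in> N"
    and m: "\<And>i. i \<in> J \<Longrightarrow> E i m \<in> N"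
  shows "casimir_op m - m \<in> N"
proof -
  have F: "foldr F u x \<in> N" if "x \<in> N" for u x using that N(2) by (induction u) auto
  have E: "foldr E w x \<in> N" if "x \<in> N" for w x using that N(3) by (induction w) auto
  have "casimir_part (Suc n) m \<in> N" for n
    unfolding casimir_part_def
  proof (rule subspace_sum[OF N(1)], clarify)
    fix u w assume "u \<in> words J (Suc n)" and w: "w \<in> words J (Suc n)"
    obtain v i where v: "w = v @ [i]" using w by (cases w rule: rev_cases) (auto simp: words_def)
    have "foldr E w m \<in> N" using w m E by (auto simp: words_def v)
    then show "scale (A u w) (foldr F u (foldr E w m)) \<in> N"
      using F N(1) subspace_scale by blast
  qed
  then have "(\<Sum>n<B. casimir_part (Suc n) m) \<in> N" by (intro subspace_sum[OF N(1)])
  then show ?thesis unfolding casimir_op_def sum.lessThan_Suc_shift by simp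
qed

end

section \<open>Eigenvalues\<close>

text \<open>Both exponents are positive, which separates a from its inverse unless a is a root of
  unity. Classes are closed under products, so a nonempty product within the class of an element
  that is not a root of unity is never 1.\<close>

definition commensurable :: "'k::field \<Rightarrow> 'k \<Rightarrow> bool"
  where "commensurable a b \<longleftrightarrow> (\<exists>m n. 0 < m \<and> 0 < n \<and> a ^ m = b ^ n)"

lemma commensurable_refl: "commensurable a a"
  unfolding commensurable_def by (rule exI[of _ 1], rule exI[of _ 1]) simp

lemma commensurable_sym: "commensurable a b \<Longrightarrow> commensurable b a"
  unfolding commensurable_def by metis

lemma commensurable_trans:
  assumes "commensurable a b" "commensurable b c"
  shows "commensurable a c"
proof -
  obtain m n m' n' where "0 < m" "0 < n" "a ^ m = b ^ n" "0 < m'" "0 < n'" "b ^ m' = c ^ n'"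
    using assms by (auto simp: commensurable_def)
  moreover from this have "a ^ (m * m') = c ^ (n' * n)"
    by (metis power_mult mult.commute)
  ultimately show ?thesis unfolding commensurable_def by (metis nat_0_less_mult_iff)
qed

lemma commensurable_power: "commensurable a b \<Longrightarrow> 0 < n \<Longrightarrow> commensurable (a ^ n) b"
proof -
  assume "commensurable a b" "0 < n"
  then obtain m m' where "0 < m" "0 < m'" "a ^ m = b ^ m'" by (auto simp: commensurable_def)
  moreover from this have "(a ^ n) ^ m = b ^ (m' * n)" by (metis power_mult mult.commute)
  ultimately show ?thesis using \<open>0 < n\<close> unfolding commensurable_def by (metis nat_0_less_mult_iff)
qed

lemma commensurable_mult:
  assumes "commensurable a c" "commensurable b c"
  shows "commensurable (a * b) c"
proof -
  obtain m n m' n' where *: "0 < m" "0 < n" "a ^ m = c ^ n" "0 < m'" "0 < n'" "b ^ m' = c ^ n'"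
    using assms by (auto simp: commensurable_def)
  have "(a * b) ^ (m * m') = (a ^ m) ^ m' * (b ^ m') ^ m"
    by (simp add: power_mult_distrib flip: power_mult) (simp add: mult.commute)
  also have "\<dots> = c ^ (n * m' + n' * m)"
    by (simp add: * power_add power_mult)
  finally show ?thesis using * unfolding commensurable_def
    by (intro exI[of _ "m * m'"] exI[of _ "n * m' + n' * m"]) simp
qed

lemma commensurable_prod_list:
  assumes "xs \<noteq> []" "\<And>x. x \<in> set xs \<Longrightarrow> commensurable (f x) c"
  shows "commensurable (\<Prod>x\<leftarrow>xs. f x) c"
  using assms by (induction xs rule: list_nonempty_induct) (auto intro: commensurable_mult)

text \<open>
  The eigenvalue of the Casimir operator of \<open>J\<close> on \<open>F\<^sub>w v\<close>, for a singular vector \<open>v\<close> on which the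
  group element \<open>K\<^sub>i L\<^sub>i\<close> acts by \<open>\<kappa> i\<close>.
\<close>

primrec casimir_eigenvalue :: "('n \<Rightarrow> 'n \<Rightarrow> 'k::field) \<Rightarrow> ('n \<Rightarrow> 'k) \<Rightarrow> 'n set \<Rightarrow> 'n list \<Rightarrow> 'k"
  where
    "casimir_eigenvalue q \<kappa> J [] = 1"
  | "casimir_eigenvalue q \<kappa> J (j # w) =
      (if j \<in> J then \<kappa> j * inverse (letter_word q j w * word_letter q w j) else 1) * casimir_eigenvalue q \<kappa> J w"

text \<open>The eigenvalue involves each pair of positions of w once, the square twice, and so it
  becomes a product over the letters s in which s meets all of w. There s also meets itself, and
  \<open>(q s s)\<^sup>2\<close> compensates for that. Letters outside J contribute nothing by
  orthogonality.\<close>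

lemma casimir_eigenvalue_square:
  assumes q: "\<And>i j. q i j \<noteq> 0" and \<kappa>: "\<And>i. \<kappa> i \<noteq> 0"
    and J: "\<And>i j. i \<in> J \<Longrightarrow> j \<notin> J \<Longrightarrow> q i j * q j i = 1"
  shows "(casimir_eigenvalue q \<kappa> J w)\<^sup>2
    = (\<Prod>s\<leftarrow>filter (\<lambda>s. s \<in> J) w. \<kappa> s * (\<kappa> s * inverse (letter_word q s w * word_letter q w s)) * (q s s)\<^sup>2)"
proof (induction w)
  case (Cons j w)
  let ?\<mu> = "\<lambda>w s. \<kappa> s * inverse (letter_word q s w * word_letter q w s)"
  \<comment> \<open>\<open>w\<close> determines the lower weight and \<open>v\<close> the letters
    over which the product runs. They are separated because prepending j changes both.\<close>
  let ?P = "\<lambda>w v. \<Prod>s\<leftarrow>filter (\<lambda>s. s \<in> J) v. \<kappa> s * ?\<mu> w s * (q s s)\<^sup>2"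
  have step: "?P (j # w) v = ?P w v * inverse (\<Prod>s\<leftarrow>filter (\<lambda>s. s \<in> J) v. q s j * q j s)" for v
    by (induction v) (auto simp: ac_simps)
  have nz: "letter_word q i u \<noteq> 0" "word_letter q u i \<noteq> 0" for i u
    by (rule letter_word_nonzero word_letter_nonzero, rule q)+
  show ?case
  proof (cases "j \<in> J")
    case True
    have prod: "(\<Prod>s\<leftarrow>filter (\<lambda>s. s \<in> J) v. q s j * q j s) = letter_word q j v * word_letter q v j" for v
      using J[OF True] by (induction v) (auto simp: ac_simps)
    have "?P (j # w) (j # w) = \<kappa> j * ?\<mu> (j # w) j * (q j j)\<^sup>2 * ?P (j # w) w"
      using True by simp
    also have "\<dots> = \<kappa> j * ?\<mu> w j * (?P w w * inverse (letter_word q j w * word_letter q w j))"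
      unfolding step prod using q[of j j] nz by (simp add: field_simps power2_eq_square)
    also have "\<dots> = (?\<mu> w j)\<^sup>2 * ?P w w"
      by (simp add: power2_eq_square ac_simps)
    finally show ?thesis using True Cons by (simp add: power_mult_distrib)
  next
    case False
    have "(\<Prod>s\<leftarrow>filter (\<lambda>s. s \<in> J) v. q s j * q j s) = 1" for v
      using J[OF _ False] by (induction v) auto
    then show ?thesis using False Cons step[of w] by simp
  qed
qed simp

text \<open>By dominance of both weights each factor of the square is \<open>q s s\<close> to an
  exponent of at least 2. As w has a letter in J, the square is a nonempty product in the class of
  \<open>q i i\<close>, whose members are not 1.\<close>

lemma casimir_eigenvalue_neq_1:
  fixes q :: "'n \<Rightarrow> 'n \<Rightarrow> 'k::field"
  assumes q: "\<And>i j. q i j \<noteq> 0" and \<kappa>: "\<And>i. \<kappa> i \<noteq> 0"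
    and generic: "\<And>i n. 0 < n \<Longrightarrow> q i i ^ n \<noteq> 1"
    and orthogonal: "\<And>i j. \<not> commensurable (q i i) (q j j) \<Longrightarrow> q i j * q j i = 1"
    and J: "J = {j. commensurable (q j j) (q i i)}"
    and dominant: "\<And>s. s \<in> J \<Longrightarrow> \<exists>n. \<kappa> s = q s s ^ n"
      "\<And>s. s \<in> J \<Longrightarrow> \<exists>n. \<kappa> s * inverse (letter_word q s w * word_letter q w s) = q s s ^ n"
    and w: "s0 \<in> set w" "s0 \<in> J"
  shows "casimir_eigenvalue q \<kappa> J w \<noteq> 1"
proof
  assume 1: "casimir_eigenvalue q \<kappa> J w = 1"
  let ?f = "\<lambda>s. \<kappa> s * (\<kappa> s * inverse (letter_word q s w * word_letter q w s)) * (q s s)\<^sup>2"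
  have f: "commensurable (?f s) (q i i)" if s: "s \<in> J" for s
  proof -
    obtain m n where "?f s = q s s ^ m * q s s ^ n * (q s s)\<^sup>2" using dominant[OF s] by metis
    then have "?f s = q s s ^ (m + n + 2)" by (simp only: power_add)
    then show ?thesis using s commensurable_power[of "q s s" "q i i" "m + n + 2"] by (simp add: J)
  qed
  have orth: "q s t * q t s = 1" if "s \<in> J" "t \<notin> J" for s t
    using that orthogonal[of s t] commensurable_trans commensurable_sym unfolding J by blast
  have "commensurable (\<Prod>s\<leftarrow>filter (\<lambda>s. s \<in> J) w. ?f s) (q i i)"
  proof (rule commensurable_prod_list)
    show "filter (\<lambda>s. s \<in> J) w \<noteq> []" using w by (auto simp: filter_empty_conv)
    show "commensurable (?f s) (q i i)" if "s \<in> set (filter (\<lambda>s. s \<in> J) w)" for s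
      by (rule f) (use that in simp)
  qed
  also have "(\<Prod>s\<leftarrow>filter (\<lambda>s. s \<in> J) w. ?f s) = (casimir_eigenvalue q \<kappa> J w)\<^sup>2"
    by (rule casimir_eigenvalue_square[symmetric, OF q \<kappa>]) (rule orth)
  finally have "commensurable ((casimir_eigenvalue q \<kappa> J w)\<^sup>2) (q i i)" .
  then show False using generic by (auto simp: commensurable_def 1)
qed

section \<open>Independence of eigenspaces\<close>

definition eigenvectors :: "('k \<Rightarrow> 'm \<Rightarrow> 'm) \<Rightarrow> ('m \<Rightarrow> 'm) \<Rightarrow> 'k set \<Rightarrow> 'm set"
  where "eigenvectors s X T = {y. \<exists>t\<in>T. X y = s t y}"

context vector_space
begin

lemma eigenvectors_mono: "T \<subseteq> T' \<Longrightarrow> eigenvectors scale X T \<subseteq> eigenvectors scale X T'"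
  by (auto simp: eigenvectors_def)

lemma endo_span:
  assumes "endo scale f" "\<And>s. s \<in> S \<Longrightarrow> f s \<in> N" "subspace N" "x \<in> span S"
  shows "f x \<in> N"
  using assms(4)
proof (induction rule: span_induct_alt)
  case base
  then show ?case using assms(1,3) by (simp add: endo_simps subspace_0)
next
  case (step c x y)
  then show ?case using assms by (simp add: endo_simps subspace_add subspace_scale)
qed

text \<open>X - t kills the eigenvectors for t and rescales the others, so eigenvalues can be
  removed one at a time.\<close>

lemma span_eigenvectors_step:
  assumes X: "endo scale X" and u: "u \<in> span (eigenvectors scale X (insert t T))"
  shows "X u - scale t u \<in> span (eigenvectors scale X T)"
proof (rule endo_span[OF _ _ _ u])
  show "endo scale (\<lambda>u. X u - scale t u)"
    using X by (simp add: endo_iff scale_right_distrib scale_right_diff_distrib mult.commute)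
  show "X s - scale t s \<in> span (eigenvectors scale X T)" if s: "s \<in> eigenvectors scale X (insert t T)" for s
  proof (cases "X s = scale t s")
    case False
    then obtain t' where t': "t' \<in> T" "X s = scale t' s" using s unfolding eigenvectors_def by blast
    then have "s \<in> eigenvectors scale X T" by (auto simp: eigenvectors_def)
    then show ?thesis unfolding t' scale_left_diff_distrib[symmetric] by (intro span_scale span_base)
  qed (simp add: span_zero)
qed simp

lemma span_eigenvectors_finite:
  assumes "u \<in> span (eigenvectors scale X (- {c}))"
  shows "\<exists>T. finite T \<and> c \<notin> T \<and> u \<in> span (eigenvectors scale X T)"
proof -
  obtain S r where S: "finite S" "S \<subseteq> eigenvectors scale X (- {c})" "u = (\<Sum>s\<in>S. scale (r s) s)"
    using assms unfolding span_explicit by auto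
  then have "\<forall>s\<in>S. \<exists>t. t \<noteq> c \<and> X s = scale t s" by (auto simp: eigenvectors_def)
  then obtain t where t: "\<forall>s\<in>S. t s \<noteq> c \<and> X s = scale (t s) s" by (rule bchoice[THEN exE])
  then have "S \<subseteq> eigenvectors scale X (t ` S)" by (auto simp: eigenvectors_def)
  then have "u \<in> span (eigenvectors scale X (t ` S))"
    unfolding S(3) by (intro span_sum span_scale span_base) auto
  then show ?thesis using t S(1) by (intro exI[of _ "t ` S"]) auto
qed

text \<open>On a fixed vector X - t is multiplication by the nonzero scalar 1 - t, so removing all
  eigenvalues only rescales u, yet leaves 0.\<close>

lemma fixed_vector_eigenvectors:
  assumes X: "endo scale X" and u: "u \<in> span (eigenvectors scale X (- {1}))" "X u = u"
  shows "u = 0"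
proof -
  obtain T where "finite T" "1 \<notin> T" "u \<in> span (eigenvectors scale X T)"
    using span_eigenvectors_finite[OF u(1)] by blast
  then show ?thesis
    using u(2)
  proof (induction T arbitrary: u rule: finite_induct)
    case empty
    then show ?case by (simp add: eigenvectors_def)
  next
    case (insert t T)
    have "X u - scale t u \<in> span (eigenvectors scale X T)"
      using span_eigenvectors_step[OF X insert.prems(2)] .
    then have "scale (1 - t) u \<in> span (eigenvectors scale X T)"
      using insert.prems(3) by (simp add: scale_left_diff_distrib)
    then have "scale (1 - t) u = 0"
      using insert.prems insert.IH[of "scale (1 - t) u"] by (simp add: endo_simps[OF X])
    then show ?case using insert.prems(1) by simp
  qed
qed

end

section \<open>Weights\<close>

definition word_weight :: "('n \<Rightarrow> 'g \<Rightarrow> 'k::field) \<Rightarrow> 'n list \<Rightarrow> 'g \<Rightarrow> 'k"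
  where "word_weight \<chi> w g = prod_list (map (\<lambda>i. \<chi> i g) w)"

lemma word_weight_simps [simp]:
  "word_weight \<chi> [] g = 1" "word_weight \<chi> (i # w) g = \<chi> i g * word_weight \<chi> w g"
  by (simp_all add: word_weight_def)

lemma word_weight_mset_cong: "mset u = mset w \<Longrightarrow> word_weight \<chi> u = word_weight \<chi> w"
  unfolding word_weight_def by (rule ext) (rule prod_list_map_mset_cong)

lemma prod_list_eq_prod_count:
  fixes f :: "'n::finite \<Rightarrow> 'k::field"
  shows "prod_list (map f w) = (\<Prod>i\<in>UNIV. f i ^ count (mset w) i)"
proof (induction w)
  case (Cons j w)
  have "(\<Prod>i\<in>UNIV. f i ^ count (mset (j # w)) i)
      = (\<Prod>i\<in>UNIV. (if i = j then f i else 1) * f i ^ count (mset w) i)"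
    by (rule prod.cong) auto
  also have "\<dots> = f j * (\<Prod>i\<in>UNIV. f i ^ count (mset w) i)"
    by (simp add: prod.distrib)
  finally show ?case by (simp add: Cons)
qed simp

lemma regular_word_weight:
  fixes \<chi> :: "'n::finite \<Rightarrow> 'g \<Rightarrow> 'k::field"
  assumes "regular_datum \<chi>" and nz: "\<And>i g. \<chi> i g \<noteq> 0" and eq: "word_weight \<chi> u = word_weight \<chi> w"
  shows "mset u = mset w"
proof -
  define m where "m i = int (count (mset u) i) - int (count (mset w) i)" for i
  have "(\<Prod>i\<in>UNIV. \<chi> i g powi m i) = 1" for g
  proof -
    have "(\<Prod>i\<in>UNIV. \<chi> i g powi m i)
        = (\<Prod>i\<in>UNIV. \<chi> i g ^ count (mset u) i) / (\<Prod>i\<in>UNIV. \<chi> i g ^ count (mset w) i)"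
      unfolding prod_dividef[symmetric] m_def
      by (rule prod.cong) (simp_all add: power_int_diff nz)
    also have "\<dots> = 1"
      using fun_cong[OF eq, of g] nz unfolding word_weight_def prod_list_eq_prod_count by simp
    finally show ?thesis .
  qed
  then have "m i = 0" for i using assms(1) unfolding regular_datum_def by blast
  then show ?thesis by (intro multiset_eqI) (simp add: m_def)
qed

section \<open>Weight spaces of a group representation\<close>

locale group_rep = vector_space scale
  for scale :: "'k::field \<Rightarrow> 'm::ab_group_add \<Rightarrow> 'm" +
  fixes kact :: "'g::ab_group_add \<Rightarrow> 'm \<Rightarrow> 'm"
  assumes endo_kact: "endo scale (kact g)"
    and kact_zero: "kact 0 x = x" and kact_plus: "kact (g + h) x = kact g (kact h x)"
    and finite_span: "\<exists>B. finite B \<and> span B = UNIV"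
    and weight_span: "span {x. \<exists>\<psi>. \<forall>g. kact g x = scale (\<psi> g) x} = UNIV"
begin

lemmas kact_simps = endo_simps[OF endo_kact]

definition has_weight :: "('g \<Rightarrow> 'k) \<Rightarrow> 'm \<Rightarrow> bool"
  where "has_weight \<psi> x \<longleftrightarrow> (\<forall>g. kact g x = scale (\<psi> g) x)"

definition weight_vector :: "'m \<Rightarrow> bool"
  where "weight_vector x \<longleftrightarrow> (\<exists>\<psi>. has_weight \<psi> x)"

definition stable :: "'m set \<Rightarrow> bool"
  where "stable N \<longleftrightarrow> subspace N \<and> (\<forall>g. \<forall>x\<in>N. kact g x \<in> N)"

lemma stable_subspace: "stable N \<Longrightarrow> subspace N"
  by (simp add: stable_def)

lemma has_weight_zero [simp]: "has_weight \<psi> 0"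
  by (simp add: has_weight_def kact_simps)

lemma has_weight_add: "has_weight \<psi> x \<Longrightarrow> has_weight \<psi> y \<Longrightarrow> has_weight \<psi> (x + y)"
  by (simp add: has_weight_def kact_simps scale_right_distrib)

lemma has_weight_diff: "has_weight \<psi> x \<Longrightarrow> has_weight \<psi> y \<Longrightarrow> has_weight \<psi> (x - y)"
  by (simp add: has_weight_def kact_simps scale_right_diff_distrib)

lemma has_weight_minus: "has_weight \<psi> x \<Longrightarrow> has_weight \<psi> (- x)"
  using has_weight_diff[OF has_weight_zero] by simp

lemma has_weight_scale: "has_weight \<psi> x \<Longrightarrow> has_weight \<psi> (scale c x)"
  by (simp add: has_weight_def kact_simps mult.commute)

lemma weight_vector_scale: "weight_vector x \<Longrightarrow> weight_vector (scale c x)"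
  unfolding weight_vector_def using has_weight_scale by blast

lemma has_weight_sum: "(\<And>i. i \<in> A \<Longrightarrow> has_weight \<psi> (f i)) \<Longrightarrow> has_weight \<psi> (\<Sum>i\<in>A. f i)"
  by (induction A rule: infinite_finite_induct) (auto intro: has_weight_add)

lemma has_weight_unique: "has_weight \<psi> x \<Longrightarrow> has_weight \<phi> x \<Longrightarrow> x \<noteq> 0 \<Longrightarrow> \<psi> = \<phi>"
  by (auto simp: has_weight_def fun_eq_iff)

lemma has_weight_nonzero:
  assumes "has_weight \<psi> x" "x \<noteq> 0"
  shows "\<psi> g \<noteq> 0"
proof
  assume "\<psi> g = 0"
  then have "kact (- g + g) x = 0" using assms unfolding kact_plus by (simp add: has_weight_def kact_simps)
  then show False using assms(2) by (simp add: kact_zero)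
qed

lemma stable_weight_span:
  assumes "\<And>s. s \<in> S \<Longrightarrow> weight_vector s"
  shows "stable (span S)"
  unfolding stable_def
proof (intro conjI allI ballI)
  fix g x assume x: "x \<in> span S"
  show "kact g x \<in> span S"
  proof (rule endo_span[OF endo_kact _ subspace_span x])
    fix s assume s: "s \<in> S"
    then obtain \<psi> where "has_weight \<psi> s" using assms by (auto simp: weight_vector_def)
    then show "kact g s \<in> span S" using s by (simp add: has_weight_def span_scale span_base)
  qed
qed simp

text \<open>The usual argument for the independence of distinct characters, relative to \<open>N\<close>.\<close>

lemma weight_components:
  assumes "finite P" "stable N" "\<And>\<psi>. \<psi> \<in> P \<Longrightarrow> has_weight \<psi> (x \<psi>)" "(\<Sum>\<psi>\<in>P. x \<psi>) \<in> N" "\<psi> \<in> P"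
  shows "x \<psi> \<in> N"
  using assms
proof (induction P arbitrary: x \<psi> rule: finite_induct)
  case (insert \<phi> P x \<psi>)
  note N = stable_subspace[OF insert.prems(1)]
  let ?y = "\<Sum>\<psi>\<in>insert \<phi> P. x \<psi>"
  have *: "x \<psi> \<in> N" if \<psi>: "\<psi> \<in> P" for \<psi>
  proof -
    have "\<psi> \<noteq> \<phi>" using insert.hyps \<psi> by auto
    then obtain g where g: "\<psi> g \<noteq> \<phi> g" by (auto simp: fun_eq_iff)
    have "kact g ?y - scale (\<phi> g) ?y \<in> N"
      using insert.prems(1,3) N by (auto simp: stable_def intro: subspace_diff subspace_scale)
    also have "kact g ?y - scale (\<phi> g) ?y = (\<Sum>\<psi>\<in>insert \<phi> P. scale (\<psi> g - \<phi> g) (x \<psi>))"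
      unfolding kact_simps scale_sum_right sum_subtractf[symmetric]
      by (rule sum.cong) (use insert.prems(2) in \<open>auto simp: has_weight_def scale_left_diff_distrib\<close>)
    also have "\<dots> = (\<Sum>\<psi>\<in>P. scale (\<psi> g - \<phi> g) (x \<psi>))"
      using insert.hyps by simp
    finally have "scale (\<psi> g - \<phi> g) (x \<psi>) \<in> N"
      by (rule insert.IH[OF insert.prems(1), rotated, OF _ \<psi>])
        (use insert.prems(2) in \<open>auto intro: has_weight_scale\<close>)
    then have "scale (inverse (\<psi> g - \<phi> g)) (scale (\<psi> g - \<phi> g) (x \<psi>)) \<in> N"
      using N subspace_scale by blast
    then show ?thesis using g by simp
  qed
  have "?y - (\<Sum>\<psi>\<in>P. x \<psi>) \<in> N"
    by (rule subspace_diff[OF N insert.prems(3) subspace_sum[OF N *]])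
  then have "x \<phi> \<in> N" using insert.hyps by simp
  then show ?case using *[of \<psi>] insert.prems(4) by (cases "\<psi> = \<phi>") auto
qed simp

lemma weight_grouping:
  assumes "finite S" "\<And>s. s \<in> S \<Longrightarrow> weight_vector (f s)"
  obtains P y where "finite P" "\<And>\<psi>. \<psi> \<in> P \<Longrightarrow> has_weight \<psi> (y \<psi>)" "(\<Sum>s\<in>S. f s) = (\<Sum>\<psi>\<in>P. y \<psi>)"
    "\<And>\<psi>. \<psi> \<in> P \<Longrightarrow> y \<psi> \<in> span {f s | s. s \<in> S \<and> has_weight \<psi> (f s)}"
proof -
  have "\<forall>s\<in>S. \<exists>\<psi>. has_weight \<psi> (f s)" using assms(2) by (auto simp: weight_vector_def)
  then obtain \<phi> where \<phi>: "\<forall>s\<in>S. has_weight (\<phi> s) (f s)" by (rule bchoice[THEN exE])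
  let ?y = "\<lambda>\<psi>. \<Sum>s | s \<in> S \<and> \<phi> s = \<psi>. f s"
  show ?thesis
  proof (rule that)
    show "finite (\<phi> ` S)" using assms(1) by simp
    show "(\<Sum>s\<in>S. f s) = (\<Sum>\<psi>\<in>\<phi> ` S. ?y \<psi>)" using assms(1) by (rule sum.image_gen)
    show "has_weight \<psi> (?y \<psi>)" for \<psi> using \<phi> by (auto intro: has_weight_sum)
    show "?y \<psi> \<in> span {f s | s. s \<in> S \<and> has_weight \<psi> (f s)}" for \<psi>
      using \<phi> by (intro span_sum span_base) auto
  qed
qed

text \<open>Independence of weights is used relative to the span \<open>?N\<close> of the members of
  S of weight \<psi>. The components of x minus x itself sum to 0, so the component for \<psi>
  differs from x by an element of \<open>?N\<close>, and it lies in \<open>?N\<close> too.\<close>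

lemma span_weight:
  assumes S: "\<And>s. s \<in> S \<Longrightarrow> weight_vector s" and x: "x \<in> span S" "has_weight \<psi> x"
  shows "x \<in> span {s \<in> S. has_weight \<psi> s}"
proof -
  let ?N = "span {s \<in> S. has_weight \<psi> s}"
  have N: "stable ?N" by (rule stable_weight_span) (auto simp: S)
  obtain t r where t: "finite t" "t \<subseteq> S" "x = (\<Sum>s\<in>t. scale (r s) s)"
    using x(1) unfolding span_explicit by auto
  obtain P y where P: "finite P" "\<And>\<phi>. \<phi> \<in> P \<Longrightarrow> has_weight \<phi> (y \<phi>)"
    "(\<Sum>s\<in>t. scale (r s) s) = (\<Sum>\<phi>\<in>P. y \<phi>)"
    "\<And>\<phi>. \<phi> \<in> P \<Longrightarrow> y \<phi> \<in> span {scale (r s) s | s. s \<in> t \<and> has_weight \<phi> (scale (r s) s)}"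
    by (rule weight_grouping[of t "\<lambda>s. scale (r s) s"])
      (use t S in \<open>auto intro!: weight_vector_scale\<close>)
  \<comment> \<open>\<psi> need not occur in P; its component is then 0.\<close>
  define y' where "y' \<phi> = (if \<phi> \<in> P then y \<phi> else 0)" for \<phi>
  have "(\<Sum>\<phi>\<in>insert \<psi> P. y' \<phi> - (if \<phi> = \<psi> then x else 0)) = (\<Sum>\<phi>\<in>insert \<psi> P. y' \<phi>) - x"
    using P(1) by (simp add: sum_subtractf)
  also have "(\<Sum>\<phi>\<in>insert \<psi> P. y' \<phi>) = (\<Sum>\<phi>\<in>P. y \<phi>)"
    by (rule sum.mono_neutral_cong_right) (auto simp: y'_def P(1))
  finally have "(\<Sum>\<phi>\<in>insert \<psi> P. y' \<phi> - (if \<phi> = \<psi> then x else 0)) \<in> ?N"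
    using t(3) P(3) by (simp add: span_zero)
  then have "y' \<psi> - (if \<psi> = \<psi> then x else 0) \<in> ?N"
    by (intro weight_components[where P = "insert \<psi> P"
          and x = "\<lambda>\<phi>. y' \<phi> - (if \<phi> = \<psi> then x else 0)", OF _ N])
      (use P(1,2) x(2) in \<open>auto simp: y'_def intro!: has_weight_diff has_weight_minus\<close>)
  moreover have "y' \<psi> \<in> ?N"
  proof (cases "\<psi> \<in> P")
    case True
    have "scale (r s) s \<in> ?N" if "s \<in> t" "has_weight \<psi> (scale (r s) s)" for s
    proof (cases "r s = 0")
      case False
      then have "s \<in> {s \<in> S. has_weight \<psi> s}"
        using that t(2) has_weight_scale[OF that(2), of "inverse (r s)"] by auto
      then show ?thesis by (intro span_scale span_base)
    qed (simp add: span_zero)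
    then have "{scale (r s) s | s. s \<in> t \<and> has_weight \<psi> (scale (r s) s)} \<subseteq> ?N" by blast
    then have "span {scale (r s) s | s. s \<in> t \<and> has_weight \<psi> (scale (r s) s)} \<subseteq> ?N"
      by (rule span_minimal) simp
    then show ?thesis using P(4)[OF True] True by (auto simp: y'_def)
  qed (simp add: y'_def span_zero)
  ultimately have "y' \<psi> - (y' \<psi> - (if \<psi> = \<psi> then x else 0)) \<in> ?N" by (rule span_diff[rotated])
  then show ?thesis by simp
qed

lemma weight_decomposition:
  obtains P y where "finite P" "\<And>\<psi>. \<psi> \<in> P \<Longrightarrow> has_weight \<psi> (y \<psi>)" "x = (\<Sum>\<psi>\<in>P. y \<psi>)"
proof -
  have "x \<in> span {x. weight_vector x}"
    using weight_span unfolding weight_vector_def has_weight_def by auto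
  then obtain t r where t: "finite t" "t \<subseteq> {x. weight_vector x}" "x = (\<Sum>s\<in>t. scale (r s) s)"
    unfolding span_explicit by auto
  obtain P y where "finite P" "\<And>\<phi>. \<phi> \<in> P \<Longrightarrow> has_weight \<phi> (y \<phi>)"
    "(\<Sum>s\<in>t. scale (r s) s) = (\<Sum>\<phi>\<in>P. y \<phi>)"
    by (rule weight_grouping[of t "\<lambda>s. scale (r s) s"])
      (use t in \<open>auto intro!: weight_vector_scale\<close>)
  then show ?thesis by (rule that[OF _ _ trans[OF t(3)]])
qed

lemma weight_vector_in_stable:
  assumes N: "stable N" and x: "x \<in> N" "x \<noteq> 0"
  obtains y \<psi> where "y \<in> N" "y \<noteq> 0" "has_weight \<psi> y"
proof -
  obtain P y where P: "finite P" "\<And>\<psi>. \<psi> \<in> P \<Longrightarrow> has_weight \<psi> (y \<psi>)" "x = (\<Sum>\<psi>\<in>P. y \<psi>)"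
    by (rule weight_decomposition[of x]) (rule that)
  have "y \<psi> \<in> N" if "\<psi> \<in> P" for \<psi>
    by (rule weight_components[OF P(1) N]) (use P x that in auto)
  moreover obtain \<psi> where "\<psi> \<in> P" "y \<psi> \<noteq> 0" using P(3) x(2) by (metis sum.neutral)
  ultimately show ?thesis using P(2) that by blast
qed

lemma weight_vector_outside:
  assumes N: "subspace N" and x: "x \<notin> N"
  obtains y \<psi> where "y \<notin> N" "has_weight \<psi> y"
proof -
  obtain P y where P: "finite P" "\<And>\<psi>. \<psi> \<in> P \<Longrightarrow> has_weight \<psi> (y \<psi>)" "x = (\<Sum>\<psi>\<in>P. y \<psi>)"
    by (rule weight_decomposition[of x]) (rule that)
  then obtain \<psi> where "\<psi> \<in> P" "y \<psi> \<notin> N" using x subspace_sum[OF N, of P y] by blast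
  then show ?thesis using P(2) that by blast
qed

text \<open>There is a finite spanning set of weight vectors, and by \<open>span_weight\<close> a
  weight carried by none of its nonzero members does not occur.\<close>

lemma finite_weights: "finite {\<psi>. \<exists>x. x \<noteq> 0 \<and> has_weight \<psi> x}"
proof -
  obtain B where B: "finite B" "span B = UNIV" using finite_span by blast
  have "\<exists>T. finite T \<and> (\<forall>s\<in>T. weight_vector s) \<and> b \<in> span T" for b
  proof -
    obtain P y where P: "finite P" "\<And>\<psi>. \<psi> \<in> P \<Longrightarrow> has_weight \<psi> (y \<psi>)" "b = (\<Sum>\<psi>\<in>P. y \<psi>)"
      by (rule weight_decomposition[of b]) (rule that)
    then show ?thesis
      by (intro exI[of _ "y ` P"] conjI ballI)
        (simp, unfold weight_vector_def, blast, simp only:, intro span_sum span_base imageI)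
  qed
  then have "\<forall>b. \<exists>T. finite T \<and> (\<forall>s\<in>T. weight_vector s) \<and> b \<in> span T" ..
  then obtain T where T: "\<forall>b. finite (T b) \<and> (\<forall>s\<in>T b. weight_vector s) \<and> b \<in> span (T b)"
    by (rule choice[THEN exE])
  let ?T = "\<Union>b\<in>B. T b"
  have "b \<in> span ?T" if "b \<in> B" for b
  proof -
    have "span (T b) \<subseteq> span ?T" using that by (intro span_mono) blast
    then show ?thesis using T by blast
  qed
  then have "B \<subseteq> span ?T" by blast
  then have span: "span ?T = UNIV" using B(2) span_minimal[of B "span ?T"] by auto
  have "\<exists>s\<in>?T. s \<noteq> 0 \<and> has_weight \<psi> s" if "x \<noteq> 0" "has_weight \<psi> x" for \<psi> x
  proof (rule ccontr)
    assume "\<not> ?thesis"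
    then have "span {s \<in> ?T. has_weight \<psi> s} \<subseteq> {0}" by (intro span_minimal) auto
    moreover have "x \<in> span {s \<in> ?T. has_weight \<psi> s}"
      by (rule span_weight) (use T span that in auto)
    ultimately show False using that(1) by blast
  qed
  then have "{\<psi>. \<exists>x. x \<noteq> 0 \<and> has_weight \<psi> x} \<subseteq> (\<lambda>s. THE \<psi>. has_weight \<psi> s) ` (?T - {0})"
  proof (intro subsetI)
    fix \<psi> assume "\<psi> \<in> {\<psi>. \<exists>x. x \<noteq> 0 \<and> has_weight \<psi> x}"
    then obtain s where s: "s \<in> ?T" "s \<noteq> 0" "has_weight \<psi> s"
      using \<open>\<And>x \<psi>. x \<noteq> 0 \<Longrightarrow> has_weight \<psi> x \<Longrightarrow> \<exists>s\<in>?T. s \<noteq> 0 \<and> has_weight \<psi> s\<close> by blast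
    have "(THE \<phi>. has_weight \<phi> s) = \<psi>"
      by (rule the_equality[of "\<lambda>\<phi>. has_weight \<phi> s", OF s(3)]) (rule has_weight_unique[OF _ s(3,2)])
    then show "\<psi> \<in> (\<lambda>s. THE \<psi>. has_weight \<psi> s) ` (?T - {0})"
      using s(1,2) by (intro image_eqI[of _ _ s]) auto
  qed
  then show ?thesis by (rule finite_subset) (use B(1) T in auto)
qed

text \<open>If the word w does not kill x, neither does any suffix of w, and suffixes of different
  lengths give different weights. A word of length n thus needs n + 1 weights. With \<eta> left open
  the argument covers both E and F.\<close>

lemma weight_shift_nilpotent:
  fixes T :: "'n \<Rightarrow> 'm \<Rightarrow> 'm" and \<eta> :: "'n list \<Rightarrow> 'g \<Rightarrow> 'k"
  assumes T: "\<And>i. endo scale (T i)"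
    and shift: "\<And>w \<psi> x. has_weight \<psi> x \<Longrightarrow> has_weight (\<lambda>g. \<psi> g * \<eta> w g) (foldr T w x)"
    and inj: "\<And>u w. \<eta> u = \<eta> w \<Longrightarrow> length u = length w"
  shows "\<exists>B. \<forall>w z. length w \<ge> B \<longrightarrow> foldr T w z = 0"
proof (intro exI[of _ "card {\<psi>. \<exists>x. x \<noteq> 0 \<and> has_weight \<psi> x}"] allI impI)
  let ?W = "{\<psi>. \<exists>x. x \<noteq> 0 \<and> has_weight \<psi> x}"
  fix w :: "'n list" and z assume len: "length w \<ge> card ?W"
  have "foldr T w x = 0" if "has_weight \<psi> x" for x \<psi>
  proof (rule ccontr)
    assume nz: "foldr T w x \<noteq> 0"
    have 1: "foldr T (drop k w) x \<noteq> 0" for k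
    proof
      assume *: "foldr T (drop k w) x = 0"
      have "foldr T w x = foldr T (take k w) (foldr T (drop k w) x)"
        by (metis append_take_drop_id foldr_append comp_apply)
      then show False using nz by (simp add: * endo_simps[OF endo_foldr[of T, OF T]])
    qed
    have "x \<noteq> 0" using 1[of "length w"] by auto
    let ?f = "\<lambda>k g. \<psi> g * \<eta> (drop k w) g"
    have "inj_on ?f {..length w}"
    proof
      fix k k' assume "k \<in> {..length w}" "k' \<in> {..length w}" "?f k = ?f k'"
      moreover have "\<psi> g \<noteq> 0" for g using has_weight_nonzero[OF that \<open>x \<noteq> 0\<close>] .
      ultimately have "\<eta> (drop k w) = \<eta> (drop k' w)" by (auto simp: fun_eq_iff)
      from inj[OF this] show "k = k'" using \<open>k \<in> _\<close> \<open>k' \<in> _\<close> by auto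
    qed
    moreover have "?f ` {..length w} \<subseteq> ?W" using 1 shift[OF that] by auto
    ultimately have "card {..length w} \<le> card ?W" using finite_weights by (rule card_inj_on_le)
    then show False using len by simp
  qed
  moreover obtain P y where P: "finite P" "\<And>\<psi>. \<psi> \<in> P \<Longrightarrow> has_weight \<psi> (y \<psi>)" "z = (\<Sum>\<psi>\<in>P. y \<psi>)"
    by (rule weight_decomposition[of z]) (rule that)
  ultimately show "foldr T w z = 0"
    unfolding P(3) endo_simps(5)[OF endo_foldr[of T, OF T]] by (intro sum.neutral) blast
qed

end

section \<open>Singular vectors and dominant weights\<close>

locale weighted_rep = linked_rep scale q E F "\<lambda>i. kact (h i)" + group_rep scale kact
  for scale :: "'k::field \<Rightarrow> 'm::ab_group_add \<Rightarrow> 'm"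
    and q :: "'n::finite \<Rightarrow> 'n \<Rightarrow> 'k" and E F :: "'n \<Rightarrow> 'm \<Rightarrow> 'm"
    and kact :: "'g::ab_group_add \<Rightarrow> 'm \<Rightarrow> 'm" and h :: "'n \<Rightarrow> 'g" +
  fixes \<chi> :: "'n \<Rightarrow> 'g \<Rightarrow> 'k"
  assumes \<chi>_nonzero: "\<chi> i g \<noteq> 0"
    and \<chi>_h: "\<chi> j (h i) = q i j * q j i"
    and kact_E: "kact g (E i x) = scale (\<chi> i g) (E i (kact g x))"
    and kact_F: "kact g (F i x) = scale (inverse (\<chi> i g)) (F i (kact g x))"
    and regular: "regular_datum \<chi>"
    and generic: "0 < n \<Longrightarrow> q i i ^ n \<noteq> 1"
    and orthogonal: "\<not> commensurable (q i i) (q j j) \<Longrightarrow> q i j * q j i = 1"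
begin

lemma has_weight_E:
  assumes "has_weight \<psi> x"
  shows "has_weight (\<lambda>g. \<psi> g * word_weight \<chi> w g) (foldr E w x)"
  using assms by (induction w) (auto simp: has_weight_def kact_E E_simps ac_simps)

lemma has_weight_F:
  assumes "has_weight \<psi> x"
  shows "has_weight (\<lambda>g. \<psi> g * inverse (word_weight \<chi> w g)) (foldr F w x)"
  using assms by (induction w) (auto simp: has_weight_def kact_F F_simps ac_simps)

lemma word_weight_nonzero: "word_weight \<chi> w g \<noteq> 0"
  by (induction w) (auto simp: \<chi>_nonzero)

lemma word_weight_h: "word_weight \<chi> w (h i) = letter_word q i w * word_letter q w i"
  by (induction w) (auto simp: \<chi>_h ac_simps)

lemma word_weight_inj: "word_weight \<chi> u = word_weight \<chi> w \<Longrightarrow> mset u = mset w"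
  by (rule regular_word_weight[OF regular \<chi>_nonzero])

lemma E_nilpotent: "\<exists>B. \<forall>w z. length w \<ge> B \<longrightarrow> foldr E w z = 0"
proof (rule weight_shift_nilpotent[where \<eta> = "word_weight \<chi>", OF endo_E has_weight_E])
  fix u w assume "word_weight \<chi> u = word_weight \<chi> w"
  then show "length u = length w" using word_weight_inj mset_eq_length by blast
qed

lemma F_nilpotent: "\<exists>B. \<forall>w z. length w \<ge> B \<longrightarrow> foldr F w z = 0"
proof (rule weight_shift_nilpotent[where \<eta> = "\<lambda>w g. inverse (word_weight \<chi> w g)"])
  fix u w assume "(\<lambda>g. inverse (word_weight \<chi> u g)) = (\<lambda>g. inverse (word_weight \<chi> w g))"
  then have "word_weight \<chi> u = word_weight \<chi> w" by (auto simp: fun_eq_iff)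
  then show "length u = length w" using word_weight_inj mset_eq_length by blast
qed (simp_all add: endo_F has_weight_F)

definition submodule :: "'m set \<Rightarrow> bool"
  where "submodule N \<longleftrightarrow> stable N \<and> (\<forall>i. \<forall>x\<in>N. E i x \<in> N) \<and> (\<forall>i. \<forall>x\<in>N. F i x \<in> N)"

definition simple :: "'m set \<Rightarrow> bool"
  where "simple S \<longleftrightarrow> submodule S \<and> S \<noteq> {0} \<and> (\<forall>N. submodule N \<and> N \<subseteq> S \<longrightarrow> N = {0} \<or> N = S)"

definition singular :: "'m \<Rightarrow> bool"
  where "singular v \<longleftrightarrow> weight_vector v \<and> (\<forall>i. E i v = 0)"

lemma submodule_simps:
  assumes "submodule N"
  shows "stable N" "subspace N" "x \<in> N \<Longrightarrow> E i x \<in> N" "x \<in> N \<Longrightarrow> F i x \<in> N" "x \<in> N \<Longrightarrow> kact g x \<in> N"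
  using assms by (auto simp: submodule_def stable_def)

lemma submodule_zero: "submodule {0}"
  by (simp add: submodule_def stable_def E_simps F_simps kact_simps)

lemma submodule_words:
  assumes "submodule N" "x \<in> N"
  shows "foldr E w x \<in> N" "foldr F w x \<in> N"
  using assms by (induction w) (auto simp: submodule_simps)

text \<open>A vector outside \<open>N\<close> moved up as far as possible becomes singular modulo \<open>N\<close>.\<close>

lemma raise:
  assumes N: "submodule N" and x: "x \<notin> N"
  obtains w where "foldr E w x \<notin> N" "\<And>i. E i (foldr E w x) \<in> N"
proof -
  obtain B where B: "\<And>w z. length w \<ge> B \<Longrightarrow> foldr E w z = 0" using E_nilpotent by blast
  have "0 \<in> N" using N by (simp add: submodule_simps subspace_0)
  let ?P = "\<lambda>n. \<exists>w. length w = n \<and> foldr E w x \<notin> N"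
  have P0: "?P 0" using x by auto
  have bound: "\<forall>n. ?P n \<longrightarrow> n \<le> B"
  proof (intro allI impI)
    fix n assume "?P n"
    then obtain w where w: "length w = n" "foldr E w x \<notin> N" by blast
    show "n \<le> B"
    proof (rule ccontr)
      assume "\<not> n \<le> B"
      then have "foldr E w x = 0" using B w(1) by simp
      then show False using w(2) \<open>0 \<in> N\<close> by simp
    qed
  qed
  obtain w where w: "length w = Greatest ?P" "foldr E w x \<notin> N"
    using GreatestI_nat[of ?P 0 B] P0 bound by blast
  have "E i (foldr E w x) \<in> N" for i
  proof (rule ccontr)
    assume "E i (foldr E w x) \<notin> N"
    then have "?P (Suc (length w))" by (intro exI[of _ "i # w"]) simp
    from Greatest_le_nat[of ?P, OF this] bound w(1) show False by auto
  qed
  then show ?thesis using that w(2) by blast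
qed

lemma sum_powers_nonzero: "(\<Sum>r<Suc m. inverse (q i i) ^ r) \<noteq> 0"
proof
  assume "(\<Sum>r<Suc m. inverse (q i i) ^ r) = 0"
  then have "inverse (q i i) ^ Suc m = 1"
    using power_diff_1_eq[of "inverse (q i i)" "Suc m"] by simp
  then have "q i i ^ Suc m = 1" unfolding power_inverse by (rule inverse_eq_1_iff[THEN iffD1])
  then show False using generic[of "Suc m" i] by simp
qed

text \<open>The rank one commutation formula, with a quantum integer for
  \<open>inverse (q i i)\<close> as first factor. As v is singular only modulo N, so is the formula;
  its error term stays in N because F_i does.\<close>

lemma E_F_power:
  assumes N: "submodule N" and v: "has_weight \<psi> v" "E i v \<in> N"
  shows "E i ((F i ^^ Suc m) v) - scale ((\<Sum>r<Suc m. inverse (q i i) ^ r) * (\<psi> (h i) * inverse (q i i) ^ m - 1)) ((F i ^^ m) v) \<in> N"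
proof (induction m)
  case 0
  have "E i (F i v) - scale (\<psi> (h i) - 1) v = scale (inverse (q i i)) (F i (E i v))"
    using v(1) by (simp add: E_F has_weight_def scale_left_diff_distrib)
  then show ?case using N v(2) by (simp add: submodule_simps subspace_scale)
next
  case (Suc m)
  let ?p = "inverse (q i i)"
  let ?a = "\<lambda>m. (\<Sum>r<Suc m. ?p ^ r) * (\<psi> (h i) * ?p ^ m - 1)" and ?y = "(F i ^^ Suc m) v"
  have y: "kact (h i) ?y = scale (\<psi> (h i) * ?p ^ (2 * Suc m)) ?y"
  proof -
    have "(F i ^^ Suc m) v = foldr F (replicate (Suc m) i) v"
      by (simp only: foldr_replicate)
    moreover have "word_weight \<chi> (replicate (Suc m) i) (h i) = q i i ^ (2 * Suc m)"
      by (induction m) (simp_all add: \<chi>_h power2_eq_square)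
    ultimately show ?thesis
      using has_weight_F[OF v(1), of "replicate (Suc m) i"] unfolding has_weight_def
      by (simp only: power_inverse)
  qed
  \<comment> \<open>Passing one more F_i multiplies the old coefficient by \<open>?p\<close> and
    adds the value of k_i - 1 on \<open>?y\<close>.\<close>
  have "?p * ?a m + \<psi> (h i) * ?p ^ (2 * Suc m) - 1 = ?a (Suc m)"
  proof -
    have 1: "?p * (\<Sum>r<Suc m. ?p ^ r) = (\<Sum>r<Suc (Suc m). ?p ^ r) - 1"
      unfolding sum.lessThan_Suc_shift[of _ "Suc m"] by (simp only: sum_distrib_left power_Suc power_0 add_diff_cancel_left')
    have 2: "(\<Sum>r<Suc m. ?p ^ r) = (\<Sum>r<Suc (Suc m). ?p ^ r) - ?p ^ Suc m" by simp
    have "?p * ?a m = (\<Sum>r<Suc m. ?p ^ r) * (\<psi> (h i) * ?p ^ Suc m) - ?p * (\<Sum>r<Suc m. ?p ^ r)"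
      by (simp add: algebra_simps)
    also have "\<dots> = ((\<Sum>r<Suc (Suc m). ?p ^ r) - ?p ^ Suc m) * (\<psi> (h i) * ?p ^ Suc m)
        - ((\<Sum>r<Suc (Suc m). ?p ^ r) - 1)"
      unfolding 1 unfolding 2 ..
    finally have "?p * ?a m = ((\<Sum>r<Suc (Suc m). ?p ^ r) - ?p ^ Suc m) * (\<psi> (h i) * ?p ^ Suc m)
        - ((\<Sum>r<Suc (Suc m). ?p ^ r) - 1)" .
    moreover have "?p ^ (2 * Suc m) = ?p ^ Suc m * ?p ^ Suc m"
      by (simp only: mult_2 power_add)
    moreover have "(s - x) * (c * x) - (s - 1) + c * (x * x) - 1 = s * (c * x - 1)" for s x c :: 'k
      by (simp add: algebra_simps)
    ultimately show ?thesis by (simp only:)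
  qed
  then have "E i (F i ?y) - scale (?a (Suc m)) ?y
      = scale ?p (F i (E i ?y)) + scale (\<psi> (h i) * ?p ^ (2 * Suc m)) ?y - ?y - scale (?p * ?a m + \<psi> (h i) * ?p ^ (2 * Suc m) - 1) ?y"
    using y by (simp add: E_F)
  also have "\<dots> = scale ?p (F i (E i ?y)) - scale ?p (scale (?a m) ?y)"
    by (simp only: scale_left_distrib scale_left_diff_distrib scale_one scale_scale) simp
  also have "\<dots> = scale ?p (F i (E i ?y - scale (?a m) ((F i ^^ m) v)))"
    by (simp add: F_simps scale_right_diff_distrib)
  also have "\<dots> \<in> N"
    using Suc N by (simp add: submodule_simps subspace_scale)
  finally show ?case by simp
qed

text \<open>For the last power of F_i that keeps v outside N, the rank one coefficient has to
  vanish. Its quantum integer does not, as \<open>q i i\<close> is not a root of unity, so the other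
  factor does.\<close>

lemma dominant:
  assumes N: "submodule N" and v: "has_weight \<psi> v" "v \<notin> N" "E i v \<in> N"
  shows "\<exists>n. \<psi> (h i) = q i i ^ n"
proof -
  note sN = submodule_simps(2)[OF N]
  obtain B where "foldr F w z = 0" if "length w \<ge> B" for w z using F_nilpotent by blast
  from this[of "replicate B i" v] have "(F i ^^ B) v \<in> N"
    using subspace_0[OF sN] by (simp add: foldr_replicate)
  moreover have "(F i ^^ 0) v \<notin> N" using v(2) by simp
  ultimately obtain m where m: "(F i ^^ m) v \<notin> N" "(F i ^^ Suc m) v \<in> N"
    using ex_least_nat_less[of "\<lambda>m. (F i ^^ m) v \<in> N" B] by blast
  let ?a = "(\<Sum>r<Suc m. inverse (q i i) ^ r) * (\<psi> (h i) * inverse (q i i) ^ m - 1)"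
  have "E i ((F i ^^ Suc m) v) - (E i ((F i ^^ Suc m) v) - scale ?a ((F i ^^ m) v)) \<in> N"
    by (rule subspace_diff[OF sN submodule_simps(3)[OF N m(2)] E_F_power[OF N v(1,3)]])
  then have "scale ?a ((F i ^^ m) v) \<in> N"
    by (simp only: diff_diff_eq2 diff_diff_eq add_diff_cancel_left')
  then have "scale (inverse ?a) (scale ?a ((F i ^^ m) v)) \<in> N"
    by (rule subspace_scale[OF sN])
  moreover have "scale (inverse ?a) (scale ?a ((F i ^^ m) v)) = (F i ^^ m) v" if "?a \<noteq> 0"
    unfolding scale_scale left_inverse[OF that] scale_one ..
  ultimately have "?a = 0" using m(1) by metis
  then have "\<psi> (h i) * inverse (q i i) ^ m = 1" using sum_powers_nonzero[of i m] by simp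
  then have "\<psi> (h i) = q i i ^ m" using q_nonzero[of i i] by (simp add: power_inverse field_simps)
  then show ?thesis ..
qed

end

section \<open>Complete reducibility\<close>

context weighted_rep
begin

section \<open>Casimir operators of the classes of indices\<close>

definition q_class :: "'n \<Rightarrow> 'n set"
  where "q_class i = {j. commensurable (q j j) (q i i)}"

lemma q_class_orthogonal: "s \<in> q_class i \<Longrightarrow> t \<notin> q_class i \<Longrightarrow> q s t * q t s = 1"
  using orthogonal[of s t] commensurable_trans commensurable_sym unfolding q_class_def by blast

lemma self_q_class: "i \<in> q_class i"
  by (simp add: q_class_def commensurable_refl)

text \<open>Hides the choice of the generalised inverse and of the degree bound. The last clause is
  relative to a submodule because it is applied to {0} and to the socle.\<close>

definition casimir_for :: "'n set \<Rightarrow> ('m \<Rightarrow> 'm) \<Rightarrow> bool"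
  where "casimir_for J X \<longleftrightarrow> endo scale X \<and>
    (\<forall>j\<in>J. \<forall>\<psi> x. has_weight \<psi> x \<longrightarrow> E j (X x) = scale (\<psi> (h j) * (q j j * q j j)) (X (E j x))) \<and>
    (\<forall>j\<in>J. \<forall>\<psi> x. has_weight \<psi> x \<longrightarrow> X (F j x) = scale (\<psi> (h j)) (F j (X x))) \<and>
    (\<forall>j x. j \<notin> J \<longrightarrow> E j (X x) = X (E j x) \<and> F j (X x) = X (F j x)) \<and>
    (\<forall>\<psi> x. has_weight \<psi> x \<longrightarrow> has_weight \<psi> (X x)) \<and>
    (\<forall>N x. submodule N \<longrightarrow> (\<forall>j\<in>J. E j x \<in> N) \<longrightarrow> X x - x \<in> N)"

lemma casimir_forD:
  assumes "casimir_for J X"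
  shows "endo scale X"
    "j \<in> J \<Longrightarrow> has_weight \<psi> x \<Longrightarrow> E j (X x) = scale (\<psi> (h j) * (q j j * q j j)) (X (E j x))"
    "j \<in> J \<Longrightarrow> has_weight \<psi> x \<Longrightarrow> X (F j x) = scale (\<psi> (h j)) (F j (X x))"
    "j \<notin> J \<Longrightarrow> E j (X x) = X (E j x)" "j \<notin> J \<Longrightarrow> F j (X x) = X (F j x)"
    "has_weight \<psi> x \<Longrightarrow> has_weight \<psi> (X x)"
    "submodule N \<Longrightarrow> (\<And>j. j \<in> J \<Longrightarrow> E j x \<in> N) \<Longrightarrow> X x - x \<in> N"
  using assms unfolding casimir_for_def by (elim conjE, simp)+

lemma casimir_singular_fixed: "casimir_for J X \<Longrightarrow> singular v \<Longrightarrow> X v = v"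
  using casimir_forD(7)[OF _ submodule_zero, of J X v] by (simp add: singular_def)

lemma casimir_exists: "\<exists>X. casimir_for (q_class i) X"
proof -
  let ?J = "q_class i"
  obtain B where B: "\<And>w z. length w \<ge> B \<Longrightarrow> foldr E w z = 0" using E_nilpotent by blast
  obtain A where A: "\<And>u w. A u w \<noteq> 0 \<Longrightarrow> mset u = mset w"
    "\<And>n x y. x \<in> words ?J n \<Longrightarrow> y \<in> words ?J n \<Longrightarrow>
      (\<Sum>(u, w)\<in>words ?J n \<times> words ?J n. word_form q x u * A u w * word_form q w y) = word_form q x y"
    by (rule word_form_generalized_inverse[of ?J q]) (rule that)
  interpret C: casimir scale q E F "\<lambda>i. kact (h i)" ?J A B
    by unfold_locales (rule q_class_orthogonal A B; assumption)+
  have weight: "has_weight \<psi> (C.casimir_op x)" if x: "has_weight \<psi> x" for \<psi> x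
    unfolding has_weight_def
  proof
    fix g
    have "kact g (C.casimir_op x) = C.casimir_op (kact g x)"
    proof (rule C.casimir_commute[OF endo_kact])
      fix u w :: "'n list" and z
      assume uw: "mset u = mset w"
      have E: "kact g (foldr E w z) = scale (word_weight \<chi> w g) (foldr E w (kact g z))" for z
        by (induction w) (simp_all add: kact_E E_simps mult.commute)
      have F: "kact g (foldr F u z) = scale (inverse (word_weight \<chi> u g)) (foldr F u (kact g z))" for z
        by (induction u) (simp_all add: kact_F F_simps mult.commute)
      show "kact g (foldr F u (foldr E w z)) = foldr F u (foldr E w (kact g z))"
        using word_weight_nonzero[of w g] by (simp add: E F F_word_simps word_weight_mset_cong[OF uw])
    qed
    then show "kact g (C.casimir_op x) = scale (\<psi> g) (C.casimir_op x)"
      using x by (simp add: has_weight_def endo_simps[OF C.endo_casimir])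
  qed
  have "casimir_for ?J C.casimir_op"
    unfolding casimir_for_def
  proof (intro conjI allI ballI impI)
    fix j \<psi> x assume "j \<in> ?J" "has_weight \<psi> x"
    then show "E j (C.casimir_op x) = scale (\<psi> (h j) * (q j j * q j j)) (C.casimir_op (E j x))"
      "C.casimir_op (F j x) = scale (\<psi> (h j)) (F j (C.casimir_op x))"
      by (simp_all add: C.casimir_E C.casimir_F has_weight_def)
  next
    fix N x assume N: "submodule N" "\<forall>j\<in>?J. E j x \<in> N"
    show "C.casimir_op x - x \<in> N"
      by (rule C.casimir_singular_mod) (use N in \<open>auto simp: submodule_simps\<close>)
  qed (simp_all add: C.endo_casimir C.casimir_outer weight)
  then show ?thesis by blast
qed

lemma casimir_word:
  assumes X: "casimir_for J X" and v: "has_weight \<psi> v" "X v = v"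
  shows "X (foldr F w v) = scale (casimir_eigenvalue q (\<lambda>j. \<psi> (h j)) J w) (foldr F w v)"
proof (induction w)
  case (Cons j w)
  show ?case
  proof (cases "j \<in> J")
    case True
    show ?thesis
      using casimir_forD(3)[OF X True has_weight_F[OF v(1), of w]] Cons True
      by (simp add: F_simps word_weight_h)
  next
    case False
    show ?thesis
      using casimir_forD(5)[OF X False, of "foldr F w v"] Cons False by (simp add: F_simps)
  qed
qed (simp add: v)

lemma singular_weight: "singular v \<Longrightarrow> has_weight \<psi> v \<Longrightarrow> v \<noteq> 0 \<Longrightarrow> \<exists>n. \<psi> (h i) = q i i ^ n"
  by (rule dominant[OF submodule_zero]) (auto simp: singular_def)

lemma eigenvalue_neq_1:
  assumes v: "singular v" "has_weight \<psi> v" "v \<noteq> 0"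
    and \<mu>: "\<And>s. \<exists>n. \<psi> (h s) * inverse (word_weight \<chi> w (h s)) = q s s ^ n"
    and w: "s0 \<in> set w" "s0 \<in> q_class i"
  shows "casimir_eigenvalue q (\<lambda>j. \<psi> (h j)) (q_class i) w \<noteq> 1"
proof (rule casimir_eigenvalue_neq_1[where i = i])
  show "\<psi> (h j) \<noteq> 0" for j using has_weight_nonzero[OF v(2,3)] .
  show "\<exists>n. \<psi> (h s) = q s s ^ n" for s by (rule singular_weight[OF v])
  show "\<exists>n. \<psi> (h s) * inverse (letter_word q s w * word_letter q w s) = q s s ^ n" for s
    using \<mu>[of s] by (simp only: word_weight_h)
qed (use w in \<open>auto simp: q_nonzero generic orthogonal q_class_def\<close>)

definition generated :: "'m \<Rightarrow> 'm set"
  where "generated v = span (range (\<lambda>w. foldr F w v))"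

text \<open>Stability under E_i comes from \<open>E_F_word\<close>: with E_i v = 0 only derivation
  terms remain, and these are combinations of F-words applied to v.\<close>

lemma submodule_span_words:
  assumes S: "\<And>v. v \<in> S \<Longrightarrow> singular v"
  shows "submodule (span {foldr F w v | w v. v \<in> S})"
proof -
  let ?N = "span {foldr F w v | w v. v \<in> S}"
  have base: "foldr F w v \<in> ?N" if "v \<in> S" for w v using that by (intro span_base) blast
  have "stable ?N"
  proof (rule stable_weight_span)
    fix x assume "x \<in> {foldr F w v | w v. v \<in> S}"
    then show "weight_vector x"
      using S unfolding singular_def weight_vector_def by (blast dest: has_weight_F)
  qed
  moreover have "E i x \<in> ?N" if x: "x \<in> ?N" for i x
  proof (rule endo_span[OF endo_E _ subspace_span x])
    fix y assume "y \<in> {foldr F w v | w v. v \<in> S}"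
    then obtain w v where y: "y = foldr F w v" and v: "v \<in> S" by blast
    obtain \<psi> where \<psi>: "has_weight \<psi> v" and Ev: "E i v = 0"
      using S[OF v] by (auto simp: singular_def weight_vector_def)
    have "E i y = left_deriv q scale i w (\<lambda>y. scale (inverse (letter_word q i y * word_letter q y i)) (foldr F y (scale (\<psi> (h i)) v)))
      - right_deriv q scale i w (\<lambda>y. scale (inverse (letter_word q i y)) (foldr F y v))"
      using \<psi> unfolding y E_F_word Ev has_weight_def by (simp add: F_word_simps)
    also have "\<dots> \<in> ?N"
      using base[OF v] by (intro span_diff deriv_in_subspace subspace_span) (simp_all add: F_word_simps span_scale)
    finally show "E i y \<in> ?N" .
  qed
  moreover have "F i x \<in> ?N" if x: "x \<in> ?N" for i x
  proof (rule endo_span[OF endo_F _ subspace_span x])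
    fix y assume "y \<in> {foldr F w v | w v. v \<in> S}"
    then obtain w v where "y = foldr F w v" "v \<in> S" by blast
    then show "F i y \<in> ?N" using base[of v "i # w"] by simp
  qed
  ultimately show ?thesis by (simp add: submodule_def)
qed

lemma generated_alt: "generated v = span {foldr F w x | w x. x \<in> {v}}"
  unfolding generated_def by (rule arg_cong[of _ _ span]) auto

lemma submodule_generated: "singular v \<Longrightarrow> submodule (generated v)"
  unfolding generated_alt by (rule submodule_span_words) simp

lemma generated_self: "v \<in> generated v"
  unfolding generated_def by (rule span_base) (rule range_eqI[of _ _ "[]"], simp)

text \<open>The vector u is a combination of the F_w v of its own weight, and by regularity the
  words w with F_w v nonzero are rearrangements of each other. If they contain a letter j, the
  Casimir operator of the class of j has only eigenvalues other than 1 on these vectors; but it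
  fixes u, so u = 0. Otherwise only the empty word remains.\<close>

lemma singular_in_generated:
  assumes v: "singular v" "has_weight \<psi> v" "v \<noteq> 0"
    and u: "singular u" "u \<in> generated v"
  shows "u \<in> span {v}"
proof (cases "u = 0")
  case False
  obtain \<mu> where \<mu>: "has_weight \<mu> u" using u(1) by (auto simp: singular_def weight_vector_def)
  let ?S = "{s \<in> range (\<lambda>w. foldr F w v). has_weight \<mu> s}"
  have span: "u \<in> span ?S"
  proof (rule span_weight[OF _ u(2)[unfolded generated_def] \<mu>])
    show "weight_vector s" if "s \<in> range (\<lambda>w. foldr F w v)" for s
      using that has_weight_F[OF v(2)] unfolding weight_vector_def by blast
  qed
  have weight: "\<mu> g = \<psi> g * inverse (word_weight \<chi> w g)" if "has_weight \<mu> (foldr F w v)" "foldr F w v \<noteq> 0" for w g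
    using has_weight_unique[OF that(1) has_weight_F[OF v(2)] that(2)] by simp
  have same: "mset w = mset w'"
    if "has_weight \<mu> (foldr F w v)" "foldr F w v \<noteq> 0" "has_weight \<mu> (foldr F w' v)" "foldr F w' v \<noteq> 0" for w w'
  proof (rule word_weight_inj, rule ext)
    fix g
    have "\<psi> g * inverse (word_weight \<chi> w g) = \<psi> g * inverse (word_weight \<chi> w' g)"
      by (rule trans[OF weight[OF that(1,2), symmetric] weight[OF that(3,4)]])
    then show "word_weight \<chi> w g = word_weight \<chi> w' g"
      using has_weight_nonzero[OF v(2,3), of g] by auto
  qed
  show ?thesis
  proof (cases "\<exists>j w. has_weight \<mu> (foldr F (j # w) v) \<and> foldr F (j # w) v \<noteq> 0")
    case True
    then obtain j w0 where w0: "has_weight \<mu> (foldr F (j # w0) v)" "foldr F (j # w0) v \<noteq> 0" by blast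
    obtain X where X: "casimir_for (q_class j) X" using casimir_exists by blast
    note fixed = casimir_singular_fixed[OF X v(1)] casimir_singular_fixed[OF X u(1)]
    have "?S \<subseteq> eigenvectors scale X (- {1})"
    proof
      fix s assume "s \<in> ?S"
      then obtain w where s: "s = foldr F w v" "has_weight \<mu> s" by blast
      show "s \<in> eigenvectors scale X (- {1})"
      proof (cases "s = 0")
        case True
        then show ?thesis by (auto simp: eigenvectors_def endo_simps[OF casimir_forD(1)[OF X]] intro: exI[of _ 0])
      next
        case False
        have "mset w = mset (j # w0)" using same[of w "j # w0"] s w0 False by blast
        then have "j \<in> set w" by (metis list.set_intros(1) mset_eq_setD)
        have "casimir_eigenvalue q (\<lambda>l. \<psi> (h l)) (q_class j) w \<noteq> 1"
        proof (rule eigenvalue_neq_1[OF v _ \<open>j \<in> set w\<close> self_q_class])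
          show "\<exists>n. \<psi> (h l) * inverse (word_weight \<chi> w (h l)) = q l l ^ n" for l
            using singular_weight[OF u(1) \<mu> \<open>u \<noteq> 0\<close>, of l] weight[of w "h l"] s False by metis
        qed
        then show ?thesis
          using casimir_word[OF X v(2) fixed(1), of w] s(1) by (auto simp: eigenvectors_def)
      qed
    qed
    then have "u \<in> span (eigenvectors scale X (- {1}))" using span span_mono by blast
    then have "u = 0" using fixed_vector_eigenvectors[OF casimir_forD(1)[OF X]] fixed(2) by blast
    then show ?thesis using False by simp
  next
    case none: False
    have "?S \<subseteq> span {v}"
    proof
      fix s assume "s \<in> ?S"
      then obtain w where s: "s = foldr F w v" "has_weight \<mu> s" by blast
      show "s \<in> span {v}"
        using none s by (cases w; cases "s = 0") (auto simp: span_zero intro: span_base)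
    qed
    then show ?thesis using span span_minimal[of ?S "span {v}"] by auto
  qed
qed (simp add: span_zero)

text \<open>A nonzero submodule contains a weight vector, hence by raising a nonzero singular
  vector, which is a multiple of v.\<close>

lemma simple_generated:
  assumes v: "singular v" "v \<noteq> 0"
  shows "simple (generated v)"
  unfolding simple_def
proof (intro conjI allI impI)
  show "submodule (generated v)" by (rule submodule_generated[OF v(1)])
  show "generated v \<noteq> {0}" using generated_self[of v] v(2) by auto
  obtain \<psi> where \<psi>: "has_weight \<psi> v" using v(1) by (auto simp: singular_def weight_vector_def)
  fix N assume N: "submodule N \<and> N \<subseteq> generated v"
  show "N = {0} \<or> N = generated v"
  proof (cases "N = {0}")
    case False
    note sN = submodule_simps(2)[OF conjunct1[OF N]]
    have "0 \<in> N" by (rule subspace_0[OF sN])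
    then obtain x where x: "x \<in> N" "x \<noteq> 0" using False by blast
    obtain y \<phi> where y: "y \<in> N" "y \<noteq> 0" "has_weight \<phi> y"
      by (rule weight_vector_in_stable[OF submodule_simps(1)[OF conjunct1[OF N]] x]) (rule that)
    obtain w where w: "foldr E w y \<notin> {0}" "\<And>i. E i (foldr E w y) \<in> {0}"
      by (rule raise[OF submodule_zero, of y]) (use y(2) in auto)
    let ?u = "foldr E w y"
    have u: "?u \<in> N" by (rule submodule_words[OF conjunct1[OF N] y(1)])
    have "singular ?u"
      using w(2) has_weight_E[OF y(3)] unfolding singular_def weight_vector_def by blast
    then have "?u \<in> span {v}"
      using singular_in_generated[OF v(1) \<psi> v(2)] u N by blast
    then obtain c where c: "?u = scale c v" by (auto simp: span_singleton)
    then have "c \<noteq> 0" using w(1) by auto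
    have "scale (inverse c) ?u \<in> N" by (rule subspace_scale[OF sN u])
    then have "v \<in> N" using c \<open>c \<noteq> 0\<close> by simp
    then have "range (\<lambda>w. foldr F w v) \<subseteq> N" using submodule_words(2)[OF conjunct1[OF N]] by blast
    then have "generated v \<subseteq> N" unfolding generated_def by (rule span_minimal[OF _ sN])
    then show ?thesis using N by blast
  qed simp
qed

text \<open>Described by words instead of simple submodules in order to have a spanning set of
  weight vectors on which Casimir operators act by known scalars.\<close>

definition socle :: "'m set"
  where "socle = span {foldr F w v | w v. v \<in> {v. singular v}}"

lemma submodule_socle: "submodule socle"
  unfolding socle_def by (rule submodule_span_words) simp

lemma singular_in_socle: "singular v \<Longrightarrow> v \<in> socle"
  unfolding socle_def by (rule span_base, rule CollectI, rule exI[of _ "[]"]) auto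

text \<open>Replacing v by X v - t v for each t in T removes the t-part from all E_j v with j in J
  at once, since E_j X v is a multiple of X E_j v. Modulo N the operator X fixes v, so v is only
  multiplied by 1 - t, and it stays outside N because 1 is not in T. \<open>Z\<close> holds the
  letters treated before; they still kill the new vector.\<close>

lemma kill_step:
  assumes X: "casimir_for J X"
    and T: "finite T" "1 \<notin> T"
    and N: "submodule N"
    and v: "has_weight \<psi> v" "v \<notin> N" "\<And>j. E j v \<in> N" "\<And>j. j \<in> Z \<Longrightarrow> E j v = 0"
      "\<And>j. j \<in> J \<Longrightarrow> E j v \<in> span (eigenvectors scale (\<lambda>x. scale (\<psi> (h j) * (q j j * q j j)) (X x)) T)"
  shows "\<exists>v. has_weight \<psi> v \<and> v \<notin> N \<and> (\<forall>j. E j v \<in> N) \<and> (\<forall>j\<in>Z \<union> J. E j v = 0)"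
  using T v
proof (induction T arbitrary: v rule: finite_induct)
  case empty
  have "E j v = 0" if "j \<in> J" for j using empty(6)[OF that] by (simp add: eigenvectors_def)
  then show ?case using empty by blast
next
  case (insert t T)
  note sN = submodule_simps(2)[OF N]
  let ?v = "X v - scale t v" and ?\<gamma> = "\<lambda>j. \<psi> (h j) * (q j j * q j j)"
  have Xv: "X v - v \<in> N" using casimir_forD(7)[OF X N] insert.prems(4) by blast
  have in_N: "X x \<in> N" if x: "x \<in> N" for x
  proof -
    have "X x - x \<in> N" using casimir_forD(7)[OF X N] submodule_simps(3)[OF N x] by blast
    then show ?thesis using subspace_add[OF sN _ x] by fastforce
  qed
  have E: "E j ?v = scale (if j \<in> J then ?\<gamma> j else 1) (X (E j v)) - scale t (E j v)" for j
    using casimir_forD(2)[OF X _ insert.prems(2), of j] casimir_forD(4)[OF X, of j v] by (simp add: E_simps)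
  show ?case
  proof (rule insert.IH)
    show "1 \<notin> T" using insert.prems(1) by simp
    show "has_weight \<psi> ?v" by (intro has_weight_diff has_weight_scale casimir_forD(6)[OF X] insert.prems(2))
    show "?v \<notin> N"
    proof
      assume "?v \<in> N"
      then have "X v - v - ?v \<in> N" by (rule subspace_diff[OF sN Xv])
      also have "X v - v - ?v = scale (t - 1) v" by (simp add: scale_left_diff_distrib)
      finally have "scale (inverse (t - 1)) (scale (t - 1) v) \<in> N" by (rule subspace_scale[OF sN])
      then show False using insert.prems(1,3) by simp
    qed
    show "E j ?v \<in> N" for j
      unfolding E using insert.prems(4)[of j] by (intro subspace_diff[OF sN] subspace_scale[OF sN] in_N)
    show "E j ?v = 0" if "j \<in> Z" for j
      unfolding E using insert.prems(5)[OF that] by (simp add: endo_simps[OF casimir_forD(1)[OF X]])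
    show "E j ?v \<in> span (eigenvectors scale (\<lambda>x. scale (?\<gamma> j) (X x)) T)" if "j \<in> J" for j
    proof -
      have "endo scale (\<lambda>x. scale (?\<gamma> j) (X x))"
        by (simp add: endo_iff endo_simps[OF casimir_forD(1)[OF X]] scale_right_distrib mult.commute)
      from span_eigenvectors_step[OF this insert.prems(6)[OF that]] show ?thesis
        using that by (simp only: E if_True)
    qed
  qed
qed

text \<open>E_j v is a combination of vectors F_w s with s singular. On each of these the operator
  in question acts by the eigenvalue for the longer word j # w, whose lower weight is that of v and
  hence dominant. So this scalar is not 1, and \<open>kill_step\<close> applies.\<close>

lemma kill_class:
  assumes v: "has_weight \<psi> v" "v \<notin> socle" "\<And>j. E j v \<in> socle" "\<And>j. j \<in> Z \<Longrightarrow> E j v = 0"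
  shows "\<exists>v. has_weight \<psi> v \<and> v \<notin> socle \<and> (\<forall>j. E j v \<in> socle) \<and> (\<forall>j\<in>Z \<union> q_class i. E j v = 0)"
proof -
  let ?\<gamma> = "\<lambda>j. \<psi> (h j) * (q j j * q j j)"
  obtain X where X: "casimir_for (q_class i) X" using casimir_exists by blast
  have dom: "\<exists>n. \<psi> (h j) = q j j ^ n" for j by (rule dominant[OF submodule_socle v(1,2,3)])
  have "E j v \<in> span (eigenvectors scale (\<lambda>x. scale (?\<gamma> j) (X x)) (- {1}))" if j: "j \<in> q_class i" for j
  proof -
    let ?\<mu> = "\<lambda>g. \<psi> g * word_weight \<chi> [j] g"
    let ?B = "{foldr F w v | w v. v \<in> {v. singular v}}"
    have "E j v \<in> span {s \<in> ?B. has_weight ?\<mu> s}"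
    proof (rule span_weight)
      show "E j v \<in> span ?B" using v(3) by (simp add: socle_def)
      show "has_weight ?\<mu> (E j v)" using has_weight_E[OF v(1), of "[j]"] by simp
      show "weight_vector s" if "s \<in> ?B" for s
        using that unfolding singular_def weight_vector_def by (blast dest: has_weight_F)
    qed
    moreover have "{s \<in> ?B. has_weight ?\<mu> s} \<subseteq> eigenvectors scale (\<lambda>x. scale (?\<gamma> j) (X x)) (- {1})"
    proof
      fix y assume "y \<in> {s \<in> ?B. has_weight ?\<mu> s}"
      then obtain w s where y: "y = foldr F w s" "has_weight ?\<mu> y" and s: "singular s" by blast
      show "y \<in> eigenvectors scale (\<lambda>x. scale (?\<gamma> j) (X x)) (- {1})"
      proof (cases "y = 0")
        case True
        then show ?thesis by (auto simp: eigenvectors_def endo_simps[OF casimir_forD(1)[OF X]] intro: exI[of _ 0])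
      next
        case False
        then have "s \<noteq> 0" using y(1) by (auto simp: F_word_simps)
        obtain \<phi> where \<phi>: "has_weight \<phi> s" using s by (auto simp: singular_def weight_vector_def)
        have eq: "\<psi> g * \<chi> j g = \<phi> g * inverse (word_weight \<chi> w g)" for g
          using has_weight_unique[OF y(2) _ False] has_weight_F[OF \<phi>, of w] y(1) by (auto simp: fun_eq_iff)
        let ?e = "casimir_eigenvalue q (\<lambda>l. \<phi> (h l)) (q_class i)"
        have Xy: "X y = scale (?e w) y"
          unfolding y(1) by (rule casimir_word[OF X \<phi> casimir_singular_fixed[OF X s]])
        have "?e (j # w) \<noteq> 1"
        proof (rule eigenvalue_neq_1[OF s \<phi> \<open>s \<noteq> 0\<close> _ _ j])
          fix l
          have "\<phi> (h l) * inverse (word_weight \<chi> (j # w) (h l))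
              = \<phi> (h l) * inverse (word_weight \<chi> w (h l)) * inverse (\<chi> j (h l))"
            by simp
          also have "\<dots> = \<psi> (h l)"
            unfolding eq[symmetric] using \<chi>_nonzero[of j "h l"] by simp
          finally have "\<phi> (h l) * inverse (word_weight \<chi> (j # w) (h l)) = \<psi> (h l)" .
          then show "\<exists>n. \<phi> (h l) * inverse (word_weight \<chi> (j # w) (h l)) = q l l ^ n"
            using dom[of l] by simp
        qed simp
        \<comment> \<open>By \<open>eq\<close>, K_j L_j acts on y by the value at v times
          \<open>(q j j)\<^sup>2\<close>, which is the factor that j adds to the eigenvalue of
          w.\<close>
        moreover have "?\<gamma> j * ?e w = ?e (j # w)"
          using eq[of "h j"] j by (simp add: \<chi>_h word_weight_h)
        ultimately have "?\<gamma> j * ?e w \<noteq> 1" by (simp only: not_False_eq_True)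
        moreover have "scale (?\<gamma> j) (X y) = scale (?\<gamma> j * ?e w) y" unfolding Xy by simp
        ultimately show ?thesis unfolding eigenvectors_def by blast
      qed
    qed
    ultimately show ?thesis using span_mono by blast
  qed
  then have "\<forall>j\<in>q_class i. \<exists>T. finite T \<and> 1 \<notin> T \<and> E j v \<in> span (eigenvectors scale (\<lambda>x. scale (?\<gamma> j) (X x)) T)"
    using span_eigenvectors_finite by blast
  then obtain T where T: "\<forall>j\<in>q_class i. finite (T j) \<and> 1 \<notin> T j \<and>
      E j v \<in> span (eigenvectors scale (\<lambda>x. scale (?\<gamma> j) (X x)) (T j))"
    by (rule bchoice[THEN exE])
  show ?thesis
  proof (rule kill_step[OF X, where T = "\<Union>j\<in>q_class i. T j"])
    show "E j v \<in> span (eigenvectors scale (\<lambda>x. scale (?\<gamma> j) (X x)) (\<Union>j\<in>q_class i. T j))"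
      if "j \<in> q_class i" for j
    proof -
      have "eigenvectors scale (\<lambda>x. scale (?\<gamma> j) (X x)) (T j)
        \<subseteq> eigenvectors scale (\<lambda>x. scale (?\<gamma> j) (X x)) (\<Union>j\<in>q_class i. T j)"
        using that by (intro eigenvectors_mono) blast
      then show ?thesis using T that span_mono by blast
    qed
  qed (use T v submodule_socle in auto)
qed

text \<open>A weight vector outside the socle, raised until it is singular modulo the socle, is made
  singular one class at a time. That vector would lie in the socle.\<close>

lemma socle_eq_UNIV: "socle = UNIV"
proof (rule ccontr)
  assume "socle \<noteq> UNIV"
  then obtain x where "x \<notin> socle" by blast
  obtain y \<phi> where y: "y \<notin> socle" "has_weight \<phi> y"
    by (rule weight_vector_outside[OF submodule_simps(2)[OF submodule_socle] \<open>x \<notin> socle\<close>]) (rule that)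
  obtain w where w: "foldr E w y \<notin> socle" "\<And>i. E i (foldr E w y) \<in> socle"
    by (rule raise[OF submodule_socle y(1)]) (rule that)
  let ?\<psi> = "\<lambda>g. \<phi> g * word_weight \<chi> w g"
  have "\<exists>v. has_weight ?\<psi> v \<and> v \<notin> socle \<and> (\<forall>j. E j v \<in> socle) \<and> (\<forall>j\<in>\<Union>(q_class ` I). E j v = 0)"
    if "finite I" for I
    using that
  proof (induction I rule: finite_induct)
    case empty
    show ?case using w has_weight_E[OF y(2), of w] by auto
  next
    case (insert i I)
    then obtain v where v: "has_weight ?\<psi> v" "v \<notin> socle" "\<And>j. E j v \<in> socle"
      "\<And>j. j \<in> \<Union>(q_class ` I) \<Longrightarrow> E j v = 0" by blast
    have "\<Union>(q_class ` insert i I) = \<Union>(q_class ` I) \<union> q_class i" by auto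
    then show ?case
      using kill_class[where i = i and Z = "\<Union>(q_class ` I)", OF v] by (simp only:)
  qed
  from this[of UNIV] obtain v where v: "has_weight ?\<psi> v" "v \<notin> socle" "\<forall>j\<in>\<Union>(q_class ` UNIV). E j v = 0"
    by auto
  then have "singular v" using self_q_class unfolding singular_def weight_vector_def by blast
  then show False using singular_in_socle v(2) by blast
qed

lemma span_simple: "span (\<Union>{S. simple S}) = UNIV"
proof -
  have "foldr F w v \<in> span (\<Union>{S. simple S})" if v: "singular v" for w v
  proof (cases "v = 0")
    case False
    have "foldr F w v \<in> generated v" unfolding generated_def by (rule span_base) blast
    then show ?thesis using simple_generated[OF v False] by (intro span_base) blast
  qed (simp add: F_word_simps span_zero)
  then have "socle \<subseteq> span (\<Union>{S. simple S})"
    unfolding socle_def by (intro span_minimal) auto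
  then show ?thesis using socle_eq_UNIV by blast
qed

end

section \<open>Eigenvectors and sums of simple submodules\<close>

text \<open>For p of least degree with p(T) x = 0 and a root c of p, write p as X - c times r; then
  r(T) x is a nonzero eigenvector.\<close>

lemma (in vector_space) eigenvector_exists:
  fixes T :: "'b \<Rightarrow> 'b"
  assumes closed: "\<And>p :: 'a poly. degree p > 0 \<Longrightarrow> \<exists>z. poly p z = 0"
    and fin: "\<exists>B. finite B \<and> span B = UNIV"
    and T: "endo scale T" and N: "subspace N" "\<And>x. x \<in> N \<Longrightarrow> T x \<in> N" "N \<noteq> {0}"
  shows "\<exists>x\<in>N. x \<noteq> 0 \<and> (\<exists>c. T x = scale c x)"
proof -
  obtain x where x: "x \<in> N" "x \<noteq> 0" using N(1,3) subspace_0 by blast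
  define ev where "ev p = (\<Sum>i\<le>degree p. scale (coeff p i) ((T ^^ i) x))" for p :: "'a poly"
  have Tn: "(T ^^ i) x \<in> N" for i by (induction i) (auto simp: x N)
  have ev_le: "ev p = (\<Sum>i\<le>n. scale (coeff p i) ((T ^^ i) x))" if "degree p \<le> n" for p n
    unfolding ev_def using that by (intro sum.mono_neutral_left) (auto simp: coeff_eq_0)
  obtain B where B: "finite B" "span B = UNIV" using fin by blast
  have "\<exists>p. p \<noteq> 0 \<and> ev p = 0"
  \<comment> \<open>Linear dependence is stated for sets of vectors, so coinciding powers are
    treated separately; they give a difference of two monomials.\<close>
  proof (cases "inj (\<lambda>i. (T ^^ i) x)")
    case False
    then obtain i j where ij: "i < j" "(T ^^ i) x = (T ^^ j) x"
      unfolding inj_def by (metis nat_neq_iff)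
    let ?p = "monom 1 j - monom 1 i :: 'a poly"
    have "coeff ?p j = 1" using ij(1) by simp
    then have "?p \<noteq> 0" by (metis coeff_0 zero_neq_one)
    have "degree ?p \<le> j" using ij(1) by (intro degree_diff_le) (auto simp: degree_monom_eq)
    then have "ev ?p = (\<Sum>k\<le>j. scale (coeff ?p k) ((T ^^ k) x))" by (rule ev_le)
    also have "\<dots> = (\<Sum>k\<le>j. (if k = j then (T ^^ j) x else 0) - (if k = i then (T ^^ i) x else 0))"
      using ij(1) by (intro sum.cong) auto
    also have "\<dots> = 0" using ij by (simp add: sum_subtractf)
    finally show ?thesis using \<open>?p \<noteq> 0\<close> by blast
  next
    case True
    let ?S = "(\<lambda>i. (T ^^ i) x) ` {..card B}"
    have inj: "inj_on (\<lambda>i. (T ^^ i) x) {..card B}" using True inj_on_subset by blast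
    have "card ?S = Suc (card B)" using inj by (simp add: card_image)
    then have "dependent ?S" using independent_span_bound[OF B(1), of ?S] B(2) by auto
    then obtain u y where u: "y \<in> ?S" "u y \<noteq> 0" "(\<Sum>v\<in>?S. scale (u v) v) = 0"
      unfolding dependent_finite[OF finite_imageI[OF finite_atMost]] by blast
    let ?p = "\<Sum>i\<le>card B. monom (u ((T ^^ i) x)) i"
    have coeff: "coeff ?p k = (if k \<le> card B then u ((T ^^ k) x) else 0)" for k
      by (simp add: coeff_sum)
    obtain k where k: "k \<le> card B" "y = (T ^^ k) x" using u(1) by auto
    then have "coeff ?p k \<noteq> 0" using u(2) coeff by simp
    then have "?p \<noteq> 0" by (metis coeff_0)
    have "degree ?p \<le> card B" by (rule degree_le) (simp add: coeff)
    then have "ev ?p = (\<Sum>i\<le>card B. scale (coeff ?p i) ((T ^^ i) x))" by (rule ev_le)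
    also have "\<dots> = (\<Sum>i\<le>card B. scale (u ((T ^^ i) x)) ((T ^^ i) x))"
      by (rule sum.cong) (auto simp: coeff)
    also have "\<dots> = 0" using u(3) unfolding sum.reindex[OF inj] by simp
    finally show ?thesis using \<open>?p \<noteq> 0\<close> by blast
  qed
  then obtain p where p: "p \<noteq> 0" "ev p = 0" "\<And>r. r \<noteq> 0 \<Longrightarrow> ev r = 0 \<Longrightarrow> degree p \<le> degree r"
    using ex_has_least_nat[of "\<lambda>p. p \<noteq> 0 \<and> ev p = 0" _ degree] by blast
  have "degree p > 0"
  proof (rule ccontr)
    assume "\<not> degree p > 0"
    then obtain a where "p = [:a:]" by (metis degree_eq_zeroE gr0I)
    then show False using p(1,2) x(2) by (simp add: ev_def)
  qed
  then obtain c where "poly p c = 0" using closed by blast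
  then obtain r where r: "p = [:- c, 1:] * r" unfolding poly_eq_0_iff_dvd by blast
  then have "r \<noteq> 0" using p(1) by auto
  then have deg: "degree p = Suc (degree r)" unfolding r by (subst degree_mult_eq) auto
  then have nz: "ev r \<noteq> 0" using p(3)[OF \<open>r \<noteq> 0\<close>] by auto
  have "T (ev r) - scale c (ev r) = ev p"
  proof -
    have co: "coeff p 0 = - c * coeff r 0" "coeff p (Suc i) = coeff r i - c * coeff r (Suc i)" for i
      by (simp_all add: r)
    have "ev p = scale (coeff p 0) x + (\<Sum>i\<le>degree r. scale (coeff p (Suc i)) (T ((T ^^ i) x)))"
      unfolding ev_def deg sum.atMost_Suc_shift by simp
    also have "\<dots> = (\<Sum>i\<le>degree r. scale (coeff r i) (T ((T ^^ i) x)))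
        - scale c (scale (coeff r 0) x + (\<Sum>i\<le>degree r. scale (coeff r (Suc i)) ((T ^^ Suc i) x)))"
      unfolding co by (simp add: scale_left_diff_distrib sum_subtractf scale_right_distrib scale_sum_right)
    also have "scale (coeff r 0) x + (\<Sum>i\<le>degree r. scale (coeff r (Suc i)) ((T ^^ Suc i) x)) = ev r"
      by (subst ev_le[of r "Suc (degree r)"]) (simp, simp only: sum.atMost_Suc_shift, simp)
    also have "(\<Sum>i\<le>degree r. scale (coeff r i) (T ((T ^^ i) x))) = T (ev r)"
      by (simp add: ev_def endo_simps[OF T])
    finally show ?thesis ..
  qed
  then have "T (ev r) = scale c (ev r)" using p(2) by simp
  moreover have "ev r \<in> N" unfolding ev_def by (intro subspace_sum[OF N(1)] subspace_scale[OF N(1)] Tn)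
  ultimately show ?thesis using nz by blast
qed

section \<open>Direct sums of simple submodules\<close>

context alg_module
begin

lemma is_submodule_span_Union:
  assumes "\<And>S. S \<in> \<S> \<Longrightarrow> is_submodule S"
  shows "is_submodule (span (\<Union>\<S>))"
  unfolding is_submodule_def
proof (intro conjI ballI)
  fix a x assume a: "a \<in> carrier A" and x: "x \<in> span (\<Union>\<S>)"
  show "act a x \<in> span (\<Union>\<S>)"
  proof (rule endo_span[OF _ _ subspace_span x])
    show "endo scale (act a)" using a by (simp add: endo_iff act_add_right act_scale_right)
    show "act a s \<in> span (\<Union>\<S>)" if "s \<in> \<Union>\<S>" for s
      using that assms a unfolding is_submodule_def by (intro span_base) blast
  qed
qed simp

text \<open>The submodules are added one at a time. One that lies in the sum so far is dropped; any
  other meets it in a proper submodule of itself, hence in 0.\<close>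

lemma independent_simple_family:
  assumes "finite \<T>" "\<And>S. S \<in> \<T> \<Longrightarrow> simple_submodule S"
  shows "\<exists>\<S>\<subseteq>\<T>. span (\<Union>\<S>) = span (\<Union>\<T>) \<and> (\<forall>S\<in>\<S>. S \<inter> span (\<Union>(\<S> - {S})) = {0})"
  using assms
proof (induction \<T> rule: finite_induct)
  case (insert S0 \<T>)
  then obtain \<S> where \<S>: "\<S> \<subseteq> \<T>" "span (\<Union>\<S>) = span (\<Union>\<T>)" "\<forall>S\<in>\<S>. S \<inter> span (\<Union>(\<S> - {S})) = {0}"
    by blast
  have simple: "simple_submodule S" if "S \<in> insert S0 \<S>" for S using that insert.prems \<S>(1) by blast
  have sub: "subspace S" if "S \<in> insert S0 \<S>" for S
    using simple[OF that] by (simp add: simple_submodule_def is_submodule_def)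
  have span_insert_Un: "span (\<Union>(insert S0 \<S>')) = {x + y | x y. x \<in> S0 \<and> y \<in> span (\<Union>\<S>')}" for \<S>'
  proof -
    have "span S0 = S0" using sub[of S0] by (simp only: span_eq_iff insertI1)
    then show ?thesis using span_Un[of S0 "\<Union>\<S>'"] by (simp only: Union_insert)
  qed
  show ?case
  proof (cases "S0 \<subseteq> span (\<Union>\<S>)")
    case True
    have "span (\<Union>(insert S0 \<T>)) \<subseteq> span (\<Union>\<S>)"
      using True \<S>(2) by (intro span_minimal) (auto intro: span_base)
    moreover have "span (\<Union>\<S>) \<subseteq> span (\<Union>(insert S0 \<T>))" using \<S>(1) by (intro span_mono) blast
    ultimately show ?thesis using \<S> by (intro exI[of _ \<S>]) blast
  next
    case False
    have "is_submodule (span (\<Union>\<S>))"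
      by (rule is_submodule_span_Union) (use simple in \<open>auto simp: simple_submodule_def\<close>)
    then have "is_submodule (S0 \<inter> span (\<Union>\<S>))"
      using simple[of S0] by (auto simp: simple_submodule_def is_submodule_def intro: subspace_inter)
    then have inter: "S0 \<inter> span (\<Union>\<S>) = {0}"
      using simple[of S0] False unfolding simple_submodule_def by blast
    have "S0 \<notin> \<S>" using False by (auto intro: span_base)
    have "S \<inter> span (\<Union>(insert S0 \<S> - {S})) = {0}" if S: "S \<in> insert S0 \<S>" for S
    proof (cases "S = S0")
      case True
      then show ?thesis using inter \<open>S0 \<notin> \<S>\<close> by simp
    next
      case False
      then have "insert S0 \<S> - {S} = insert S0 (\<S> - {S})" and S\<S>: "S \<in> \<S>" using S by auto
      have "x = 0" if x: "x \<in> S" "x \<in> span (\<Union>(insert S0 (\<S> - {S})))" for x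
      proof -
        obtain s y where sy: "x = s + y" "s \<in> S0" "y \<in> span (\<Union>(\<S> - {S}))"
          using x(2) unfolding span_insert_Un by blast
        have "y \<in> span (\<Union>\<S>)" using sy(3) span_mono[of "\<Union>(\<S> - {S})" "\<Union>\<S>"] by blast
        moreover have "x \<in> span (\<Union>\<S>)" using x(1) S\<S> by (intro span_base) blast
        ultimately have "x - y \<in> span (\<Union>\<S>)" by (intro span_diff)
        then have "s = 0" using sy inter by auto
        then show "x = 0" using sy x(1) \<S>(3) S\<S> by auto
      qed
      moreover have "0 \<in> S" "0 \<in> span (\<Union>(insert S0 (\<S> - {S})))"
        using sub[OF S] subspace_0 span_zero by auto
      ultimately show ?thesis unfolding \<open>insert S0 \<S> - {S} = insert S0 (\<S> - {S})\<close> by blast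
    qed
    moreover have "span (\<Union>(insert S0 \<S>)) = span (\<Union>(insert S0 \<T>))"
      unfolding span_insert_Un \<S>(2) ..
    ultimately show ?thesis using \<S>(1) by (intro exI[of _ "insert S0 \<S>"]) blast
  qed
qed auto

lemma semisimple_if_span_simple:
  assumes "finite_dimensional" "span (\<Union>{S. simple_submodule S}) = UNIV"
  shows semisimple
proof -
  obtain B where B: "finite B" "span B = UNIV" using assms(1) by (auto simp: finite_dimensional_def)
  have "\<exists>\<T>. finite \<T> \<and> \<T> \<subseteq> {S. simple_submodule S} \<and> b \<in> span (\<Union>\<T>)" for b
  proof -
    have "b \<in> span (\<Union>{S. simple_submodule S})" using assms(2) by simp
    then obtain t r where t: "finite t" "t \<subseteq> \<Union>{S. simple_submodule S}" "b = (\<Sum>s\<in>t. scale (r s) s)"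
      unfolding span_explicit by auto
    then have "\<forall>s\<in>t. \<exists>S. simple_submodule S \<and> s \<in> S" by blast
    then obtain f where f: "\<forall>s\<in>t. simple_submodule (f s) \<and> s \<in> f s" by (rule bchoice[THEN exE])
    have "b \<in> span (\<Union>(f ` t))" unfolding t(3) using f by (intro span_sum span_scale span_base) blast
    then show ?thesis using f t(1) by (intro exI[of _ "f ` t"]) auto
  qed
  then have "\<forall>b. \<exists>\<T>. finite \<T> \<and> \<T> \<subseteq> {S. simple_submodule S} \<and> b \<in> span (\<Union>\<T>)" ..
  then obtain \<T> where \<T>: "\<forall>b. finite (\<T> b) \<and> \<T> b \<subseteq> {S. simple_submodule S} \<and> b \<in> span (\<Union>(\<T> b))"
    by (rule choice[THEN exE])
  let ?\<T> = "\<Union>b\<in>B. \<T> b"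
  have "finite ?\<T>" using B(1) \<T> by blast
  moreover have "simple_submodule S" if "S \<in> ?\<T>" for S using that \<T> by blast
  ultimately obtain \<S> where \<S>: "\<S> \<subseteq> ?\<T>" "span (\<Union>\<S>) = span (\<Union>?\<T>)" "\<forall>S\<in>\<S>. S \<inter> span (\<Union>(\<S> - {S})) = {0}"
    using independent_simple_family[of ?\<T>] by blast
  have "b \<in> span (\<Union>?\<T>)" if "b \<in> B" for b
  proof -
    have "span (\<Union>(\<T> b)) \<subseteq> span (\<Union>?\<T>)" using that by (intro span_mono) blast
    then show ?thesis using \<T> by blast
  qed
  then have "span (\<Union>?\<T>) = UNIV" using span_minimal[of B "span (\<Union>?\<T>)"] B(2) by auto
  then show ?thesis
    unfolding semisimple_def using \<S> \<T> by (intro exI[of _ \<S>]) blast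
qed

end

section \<open>Modules over the algebra of a reduced datum\<close>

text \<open>\<open>rep\<close> pulls the action back to the twisted algebra, where J acts by zero,
  so that cosets disappear from all later arguments.\<close>

locale twisted_quotient_module =
  alg_module scale "quotient_algebra (twisted_algebra m e \<sigma>) J" act
  for scale :: "'k::field \<Rightarrow> 'm::ab_group_add \<Rightarrow> 'm"
    and m :: "'b \<Rightarrow> 'b \<Rightarrow> 'b" and e :: 'b and \<sigma> :: "'b \<Rightarrow> 'b \<Rightarrow> 'k"
    and J :: "('b \<Rightarrow>\<^sub>0 'k) set" and act :: "('b \<Rightarrow>\<^sub>0 'k) set \<Rightarrow> 'm \<Rightarrow> 'm" +
  assumes ideal: "ideal J (twisted_algebra m e \<sigma>)"
begin

abbreviation R :: "('k, 'b \<Rightarrow>\<^sub>0 'k) module"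
  where "R \<equiv> twisted_algebra m e \<sigma>"

sublocale J: ideal J R by (rule ideal)

definition rep :: "('b \<Rightarrow>\<^sub>0 'k) \<Rightarrow> 'm \<Rightarrow> 'm"
  where "rep a = act (J +>\<^bsub>R\<^esub> a)"

lemma carrier_quotient: "X \<in> carrier (quotient_algebra R J) \<longleftrightarrow> (\<exists>a. X = J +>\<^bsub>R\<^esub> a)"
  by (auto simp: quotient_algebra_def FactRing_def A_RCOSETS_def')

lemma coset_in_carrier: "J +>\<^bsub>R\<^esub> a \<in> carrier (quotient_algebra R J)"
  using carrier_quotient by blast

lemma rep_endo: "endo scale (rep a)"
  by (simp add: endo_iff rep_def act_add_right act_scale_right coset_in_carrier)

lemma rep_add: "rep (a + b) x = rep a x + rep b x"
proof -
  have "(J +>\<^bsub>R\<^esub> a) \<oplus>\<^bsub>quotient_algebra R J\<^esub> (J +>\<^bsub>R\<^esub> b) = J +>\<^bsub>R\<^esub> (a + b)"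
    using J.a_rcos_sum[of a b] by (simp add: quotient_algebra_def FactRing_def)
  then show ?thesis using act_add_left[OF coset_in_carrier coset_in_carrier, of a b x] by (simp add: rep_def)
qed

lemma rep_mult: "rep (a \<otimes>\<^bsub>R\<^esub> b) x = rep a (rep b x)"
proof -
  have "(J +>\<^bsub>R\<^esub> a) \<otimes>\<^bsub>quotient_algebra R J\<^esub> (J +>\<^bsub>R\<^esub> b) = J +>\<^bsub>R\<^esub> (a \<otimes>\<^bsub>R\<^esub> b)"
    using J.rcoset_mult_add[of a b] by (simp add: quotient_algebra_def FactRing_def)
  then show ?thesis using act_mult[OF coset_in_carrier coset_in_carrier, of a b x] by (simp add: rep_def)
qed

lemma rep_one: "rep \<one>\<^bsub>R\<^esub> x = x"
  using act_one by (simp add: rep_def quotient_algebra_def FactRing_def)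

lemma ideal_scale: "a \<in> J \<Longrightarrow> pm_scale c a \<in> J"
proof -
  assume a: "a \<in> J"
  have "pm_scale c (\<one>\<^bsub>R\<^esub> \<otimes>\<^bsub>R\<^esub> a) \<in> J"
    unfolding twisted_mult_scale(1)[symmetric] by (rule J.I_l_closed[OF a]) simp
  also have "\<one>\<^bsub>R\<^esub> \<otimes>\<^bsub>R\<^esub> a = a" by (rule J.l_one) simp
  finally show ?thesis .
qed

lemma rep_scale: "rep (pm_scale c a) x = scale c (rep a x)"
proof -
  \<comment> \<open>Scalar multiplication in the quotient is a union over all representatives; they
    have to give the same coset.\<close>
  have "J +>\<^bsub>R\<^esub> pm_scale c y = J +>\<^bsub>R\<^esub> pm_scale c a" if y: "y \<in> J +>\<^bsub>R\<^esub> a" for y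
  proof -
    obtain j where j: "j \<in> J" "y = j + a" using y by (auto simp: a_r_coset_def')
    have "pm_scale c y \<in> J +>\<^bsub>R\<^esub> pm_scale c a"
      using ideal_scale[OF j(1), of c] by (auto simp: j(2) pm.scale_right_distrib a_r_coset_def')
    then show ?thesis
      by (rule J.a_repr_independence[symmetric, OF _ _ J.a_subgroup]) simp
  qed
  moreover have "a \<in> J +>\<^bsub>R\<^esub> a" by (rule J.a_rcos_self) simp
  ultimately have "(\<Union>y\<in>J +>\<^bsub>R\<^esub> a. J +>\<^bsub>R\<^esub> pm_scale c y) = J +>\<^bsub>R\<^esub> pm_scale c a" by blast
  then have "c \<odot>\<^bsub>quotient_algebra R J\<^esub> (J +>\<^bsub>R\<^esub> a) = J +>\<^bsub>R\<^esub> pm_scale c a"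
    by (simp add: quotient_algebra_def)
  then show ?thesis using act_scale_left[OF coset_in_carrier, of c a x] by (simp add: rep_def)
qed

lemma rep_zero [simp]: "rep 0 x = 0"
  using rep_scale[of 0 0 x] by simp

lemma rep_ideal:
  assumes "a \<in> J" shows "rep a x = 0"
proof -
  have "a \<in> J +>\<^bsub>R\<^esub> 0" using assms by (simp add: a_r_coset_def')
  then have "J +>\<^bsub>R\<^esub> a = J +>\<^bsub>R\<^esub> 0"
    by (rule J.a_repr_independence[symmetric, OF _ _ J.a_subgroup]) simp
  then show ?thesis using rep_zero[of x] by (simp add: rep_def)
qed

lemma rep_single: "rep (Poly_Mapping.single b c) x = scale c (rep (Poly_Mapping.single b 1) x)"
proof -
  have "Poly_Mapping.single b c = pm_scale c (Poly_Mapping.single b 1)"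
    by (rule poly_mapping_eqI) (simp add: lookup_single when_def)
  then show ?thesis by (simp add: rep_scale)
qed

lemma is_submodule_rep: "is_submodule N \<longleftrightarrow> subspace N \<and> (\<forall>a. \<forall>x\<in>N. rep a x \<in> N)"
  unfolding is_submodule_def rep_def carrier_quotient Ball_def by blast

end

section \<open>Characters and Cartan type\<close>

lemma is_character_nonzero:
  assumes "is_character \<chi>" shows "\<chi> g \<noteq> 0"
proof
  assume "\<chi> g = 0"
  moreover have "\<chi> (g + - g) = \<chi> g * \<chi> (- g)" "\<chi> 0 = 1"
    using assms unfolding is_character_def by blast+
  ultimately show False by simp
qed

lemma is_character_inverse: "is_character \<chi> \<Longrightarrow> is_character (\<lambda>g. inverse (\<chi> g))"
  by (simp add: is_character_def)

text \<open>Unless \<open>a i j\<close> is 0, both \<open>a i j\<close> and \<open>a j i\<close> are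
  negative, and \<open>\<chi> j (K i) * \<chi> i (K j)\<close> is a negative power of both diagonal
  entries, which makes these commensurable.\<close>

lemma cartan_orthogonal:
  assumes cartan: "cartan_type K \<chi> a"
    and not_comm: "\<not> commensurable (\<chi> i (K i)) (\<chi> j (K j))"
  shows "\<chi> j (K i) * \<chi> i (K j) = 1"
proof -
  have a: "generalized_cartan_matrix a"
    and q: "\<chi> j (K i) * \<chi> i (K j) = \<chi> i (K i) powi a i j" "\<chi> i (K j) * \<chi> j (K i) = \<chi> j (K j) powi a j i"
    using cartan unfolding cartan_type_def braiding_matrix_def by blast+
  have "i \<noteq> j" using not_comm commensurable_refl by metis
  show ?thesis
  proof (cases "a i j = 0")
    case True
    then show ?thesis using q(1) by simp
  next
    case False
    have "a i j \<le> 0" "a j i \<le> 0" "a j i \<noteq> 0"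
      using a \<open>i \<noteq> j\<close> not_sym[OF \<open>i \<noteq> j\<close>] False unfolding generalized_cartan_matrix_def by blast+
    then have "a i j < 0" "a j i < 0" using False by linarith+
    moreover have "\<chi> i (K i) powi a i j = \<chi> j (K j) powi a j i" using q by (simp add: mult.commute)
    ultimately have "\<chi> i (K i) ^ nat (- a i j) = \<chi> j (K j) ^ nat (- a j i)"
      by (simp add: power_int_def power_inverse)
    then have "commensurable (\<chi> i (K i)) (\<chi> j (K j))"
      using \<open>a i j < 0\<close> \<open>a j i < 0\<close> unfolding commensurable_def
      by (intro exI[of _ "nat (- a i j)"] exI[of _ "nat (- a j i)"]) simp
    then show ?thesis using not_comm by simp
  qed
qed

section \<open>From a module over U to a weighted representation\<close>

locale U_module =
  fixes K L :: "'n::finite \<Rightarrow> 'g::ab_group_add"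
    and \<chi> :: "'n \<Rightarrow> 'g \<Rightarrow> 'k::{alg_closed_field, field_char_0}"
    and a :: "'n \<Rightarrow> 'n \<Rightarrow> int"
    and l :: "'n \<Rightarrow> 'k"
    and scale :: "'k \<Rightarrow> 'm::ab_group_add \<Rightarrow> 'm"
    and act :: "(('n + 'n) list \<times> 'g \<Rightarrow>\<^sub>0 'k) set \<Rightarrow> 'm \<Rightarrow> 'm"
  assumes datum: "reduced_YD_datum L K \<chi>"
    and generic_K: "generic_datum K \<chi>"
    and regular_\<chi>: "regular_datum \<chi>"
    and cartan: "cartan_type K \<chi> a"
    and linking: "linking_parameter l"
    and U_mod: "alg_module scale (U_algebra L K \<chi> l) act"
    and fin_dim: "alg_module.finite_dimensional scale"
    and group_semisimple: "alg_module.semisimple scale group_algebra (\<lambda>p. act (group_algebra_to_U L K \<chi> l p))"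
begin

abbreviation VW_character :: "'n + 'n \<Rightarrow> 'g \<Rightarrow> 'k"
  where "VW_character \<equiv> case_sum \<chi> (inverse_characters \<chi>)"

lemma characters: "is_character (\<chi> i)" "is_character (inverse_characters \<chi> i)" "is_character (VW_character s)"
proof -
  show 1: "is_character (\<chi> i)" for i using datum by (simp add: reduced_YD_datum_def)
  show 2: "is_character (inverse_characters \<chi> i)" for i
    using is_character_inverse[OF 1[of i]] by (simp add: inverse_characters_def[abs_def])
  show "is_character (VW_character s)" using 1 2 by (cases s) auto
qed

lemma VW_ring: "ring (VW_bosonization \<chi>)"
  unfolding VW_bosonization_def by (rule bosonization_ring) (rule characters)

lemma U_ideal_ideal: "ideal (U_ideal L K \<chi> l) (VW_bosonization \<chi>)"
  unfolding U_ideal_def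
  by (rule ring.genideal_ideal[OF VW_ring]) (simp add: VW_bosonization_def bosonization_def)

lemma U_relations_in_ideal: "U_relations L K \<chi> l \<subseteq> U_ideal L K \<chi> l"
  unfolding U_ideal_def
  by (rule ring.genideal_self[OF VW_ring]) (simp add: VW_bosonization_def bosonization_def)

sublocale twisted_quotient_module scale "\<lambda>(u, g) (v, h). (u @ v, g + h)" "([], 0)"
  "\<lambda>(u, g) (v, h). word_character VW_character v g" "U_ideal L K \<chi> l" act
  unfolding twisted_quotient_module_def twisted_quotient_module_axioms_def
  using U_mod U_ideal_ideal
  by (simp add: U_algebra_def VW_bosonization_def bosonization_def)

lemma VW_bosonization_alt: "VW_bosonization \<chi> = R"
  by (simp add: VW_bosonization_def bosonization_def)

lemma rep_word: "rep (Poly_Mapping.single (w, g) 1) x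
    = foldr (\<lambda>s. rep (Poly_Mapping.single ([s], 0) 1)) w (rep (Poly_Mapping.single ([], g) 1) x)"
proof (induction w)
  case (Cons s w)
  have "word_character VW_character w 0 = 1"
    using word_character_char[of VW_character w] characters(3) by (simp add: is_character_def)
  then have "Poly_Mapping.single (s # w, g) 1 = Poly_Mapping.single ([s], 0) 1 \<otimes>\<^bsub>R\<^esub> Poly_Mapping.single (w, g) 1"
    by simp
  then show ?case by (simp only: rep_mult Cons foldr.simps comp_apply)
qed simp

text \<open>Dividing by l_i removes the linking parameter from the commutation relation of E and
  F.\<close>

definition E :: "'n \<Rightarrow> 'm \<Rightarrow> 'm" where "E i x = scale (inverse (l i)) (rep (v_gen i) x)"

definition F :: "'n \<Rightarrow> 'm \<Rightarrow> 'm" where "F i = rep (w_gen i)"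

definition kact :: "'g \<Rightarrow> 'm \<Rightarrow> 'm" where "kact g = rep (Poly_Mapping.single ([], g) 1)"

definition q :: "'n \<Rightarrow> 'n \<Rightarrow> 'k" where "q i j = \<chi> j (K i)"

lemma l_nonzero [simp]: "l i \<noteq> 0"
  using linking by (simp add: linking_parameter_def)

lemma \<chi>_nonzero [simp]: "\<chi> i g \<noteq> 0"
  by (rule is_character_nonzero[OF characters(1)])

lemma rep_v_gen: "rep (v_gen i) x = scale (l i) (E i x)"
  by (simp add: E_def)

lemma VW_word_character_single: "word_character VW_character [s] g = VW_character s g"
  by (simp add: word_character_def)

lemma kact_E: "kact g (E i x) = scale (\<chi> i g) (E i (kact g x))"
proof -
  have "Poly_Mapping.single ([], g) 1 \<otimes>\<^bsub>R\<^esub> v_gen i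
      = pm_scale (\<chi> i g) (v_gen i \<otimes>\<^bsub>R\<^esub> Poly_Mapping.single ([], g) 1)"
    by (rule poly_mapping_eqI) (simp add: v_gen_def VW_word_character_single lookup_single when_def)
  then have "kact g (rep (v_gen i) x) = scale (\<chi> i g) (rep (v_gen i) (kact g x))"
    unfolding kact_def by (simp only: rep_mult[symmetric] rep_scale)
  then show ?thesis by (simp add: E_def endo_simps[OF rep_endo] kact_def mult.commute)
qed

lemma kact_F: "kact g (F i x) = scale (inverse (\<chi> i g)) (F i (kact g x))"
proof -
  have "Poly_Mapping.single ([], g) 1 \<otimes>\<^bsub>R\<^esub> w_gen i
      = pm_scale (inverse (\<chi> i g)) (w_gen i \<otimes>\<^bsub>R\<^esub> Poly_Mapping.single ([], g) 1)"
    by (rule poly_mapping_eqI)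
      (simp add: w_gen_def VW_word_character_single inverse_characters_def lookup_single when_def)
  then show ?thesis
    unfolding kact_def F_def by (simp only: rep_mult[symmetric] rep_scale)
qed

lemma kact_plus: "kact (g + h) x = kact g (kact h x)"
proof -
  have "Poly_Mapping.single ([], g + h) 1
      = Poly_Mapping.single ([], g) 1 \<otimes>\<^bsub>R\<^esub> Poly_Mapping.single ([], h) (1 :: 'k)" by simp
  then show ?thesis by (simp only: kact_def rep_mult)
qed

lemma kact_zero: "kact 0 x = x"
  using rep_one by (simp add: kact_def)

lemma rep_minus: "rep (b - c) x = rep b x - rep c x"
  using rep_add[of "b - c" c x] by (simp add: algebra_simps)

lemma E_F: "E i (F j x) = scale (inverse (q i j)) (F j (E i x)) + (if i = j then kact (K i + L i) x - x else 0)"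
proof -
  have "linking_relation L K \<chi> l i j \<in> U_ideal L K \<chi> l"
    using U_relations_in_ideal unfolding U_relations_def by blast
  then have "rep (linking_relation L K \<chi> l i j) x = 0" by (rule rep_ideal)
  moreover have "rep (linking_relation L K \<chi> l i j) x
    = rep (v_gen i) (F j x) - scale (inverse (q i j)) (F j (rep (v_gen i) x))
      - (if i = j then scale (l i) (kact (K i + L i) x - x) else 0)"
    unfolding linking_relation_def VW_bosonization_alt rep_minus rep_scale rep_mult F_def q_def
    by (simp add: rep_minus rep_scale rep_one kact_def del: twisted_algebra_sel(2))
  ultimately have "rep (v_gen i) (F j x) = scale (inverse (q i j)) (F j (rep (v_gen i) x))
      + (if i = j then scale (l i) (kact (K i + L i) x - x) else 0)"
    by (simp add: algebra_simps)
  then show ?thesis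
    unfolding E_def by (auto simp: scale_right_distrib endo_simps[OF rep_endo] F_def mult.commute)
qed

lemma E_word: "foldr E w z
    = scale (prod_list (map (\<lambda>i. inverse (l i)) w)) (rep (Poly_Mapping.single (map Inl w, 0) 1) z)"
proof (induction w)
  case Nil
  show ?case using kact_zero[of z] by (simp add: kact_def)
next
  case (Cons i w)
  have "rep (Poly_Mapping.single (map Inl (i # w), 0) 1) z = rep (v_gen i) (rep (Poly_Mapping.single (map Inl w, 0) 1) z)"
    using rep_word[of "map Inl (i # w)" 0 z] rep_word[of "map Inl w" 0 z] by (simp add: v_gen_def)
  then show ?case using Cons by (simp add: E_def endo_simps[OF rep_endo])
qed

lemma F_word: "foldr F w z = rep (Poly_Mapping.single (map Inr w, 0) 1) z"
proof (induction w)
  case Nil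
  show ?case using kact_zero[of z] by (simp add: kact_def)
next
  case (Cons i w)
  have "rep (Poly_Mapping.single (map Inr (i # w), 0) 1) z = rep (w_gen i) (rep (Poly_Mapping.single (map Inr w, 0) 1) z)"
    using rep_word[of "map Inr (i # w)" 0 z] rep_word[of "map Inr w" 0 z] by (simp add: w_gen_def)
  then show ?case using Cons by (simp add: F_def)
qed

lemma tensor_inclusion_sum:
  "rep (tensor_inclusion f (\<Sum>w\<in>A. Poly_Mapping.single w (c w))) z
    = (\<Sum>w\<in>A. scale (c w) (rep (Poly_Mapping.single (map f w, 0) 1) z))"
proof -
  have "rep (tensor_inclusion f (Poly_Mapping.single w d)) z
      = scale d (rep (Poly_Mapping.single (map f w, 0) 1) z)" for w d
    unfolding tensor_inclusion_def
    by (subst linear_extension_superset[of "{w}"]) (auto simp: rep_scale)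
  then show ?thesis
    by (induction A rule: infinite_finite_induct)
      (auto simp: tensor_inclusion_def linear_extension_add rep_add linear_extension_def[of _ 0])
qed

lemma functional_single_sum: "functional f (\<Sum>w\<in>A. Poly_Mapping.single w (c w)) = (\<Sum>w\<in>A. c w * f w)"
  by (simp add: functional_sum)

text \<open>Rescaling the generators multiplies each word by a scalar depending only on its letters,
  so coefficients in the radical stay there.\<close>

lemma radical_E:
  assumes "\<And>x. (\<Sum>w\<in>A. c w * word_form q x w) = 0"
  shows "(\<Sum>w\<in>A. scale (c w) (foldr E w z)) = 0"
proof -
  let ?l = "\<lambda>w. prod_list (map (\<lambda>i. inverse (l i)) w)"
  let ?p = "\<Sum>w\<in>A. Poly_Mapping.single w (c w * ?l w)"
  have "(\<Sum>w\<in>A. c w * ?l w * word_form q x w) = ?l x * (\<Sum>w\<in>A. c w * word_form q x w)" for x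
    unfolding sum_distrib_left
  proof (rule sum.cong[OF refl])
    fix w
    have "?l w * word_form q x w = ?l x * word_form q x w"
      by (rule word_form_mult_cong, rule prod_list_map_mset_cong, simp)
    then show "c w * ?l w * word_form q x w = ?l x * (c w * word_form q x w)"
      by (metis mult.assoc mult.left_commute)
  qed
  then have "?p \<in> form_radical q"
    by (simp add: form_radical_def functional_single_sum assms)
  then have "?p \<in> nichols_ideal K \<chi>"
    using form_radical_subset_nichols_ideal[of \<chi> K, OF characters(1)] by (auto simp: q_def[abs_def])
  then have "tensor_inclusion Inl ?p \<in> U_ideal L K \<chi> l"
    using U_relations_in_ideal unfolding U_relations_def by blast
  then have "rep (tensor_inclusion Inl ?p) z = 0" by (rule rep_ideal)
  then show ?thesis by (simp add: tensor_inclusion_sum E_word)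
qed

lemma radical_F:
  assumes "\<And>x. (\<Sum>w\<in>A. c w * word_form q x w) = 0"
  shows "(\<Sum>w\<in>A. scale (c w) (foldr F w z)) = 0"
proof -
  let ?p = "\<Sum>w\<in>A. Poly_Mapping.single w (c w)"
  have "?p \<in> form_radical q"
    by (simp add: form_radical_def functional_single_sum assms)
  then have "?p \<in> form_radical (\<lambda>i j. inverse (q j i))"
    using form_radical_inverse[of q] by (auto simp: q_def)
  \<comment> \<open>The braiding matrix of W, because \<chi>_j(L_i) = \<chi>_i(K_j).\<close>
  also have "(\<lambda>i j. inverse (q j i)) = (\<lambda>i j. inverse_characters \<chi> j (L i))"
    using datum by (auto simp: reduced_YD_datum_def q_def inverse_characters_def)
  finally have "?p \<in> nichols_ideal L (inverse_characters \<chi>)"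
    using form_radical_subset_nichols_ideal[of "inverse_characters \<chi>" L, OF characters(2)] by blast
  then have "tensor_inclusion Inr ?p \<in> U_ideal L K \<chi> l"
    using U_relations_in_ideal unfolding U_relations_def by blast
  then have "rep (tensor_inclusion Inr ?p) z = 0" by (rule rep_ideal)
  then show ?thesis by (simp add: tensor_inclusion_sum F_word)
qed

lemma finite_spanning: "\<exists>B. finite B \<and> span B = UNIV"
  using fin_dim by (simp add: finite_dimensional_def)

lemma group_inclusion_single: "group_inclusion (Poly_Mapping.single g c) = (Poly_Mapping.single ([], g) c :: ('n + 'n) list \<times> 'g \<Rightarrow>\<^sub>0 'k)"
  unfolding group_inclusion_def
  by (subst linear_extension_superset[of "{g}"]) (auto intro!: poly_mapping_eqI simp: lookup_single when_def)

lemma group_inclusion_add: "group_inclusion (p + p') = group_inclusion p + group_inclusion p'"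
  by (simp add: group_inclusion_def linear_extension_add)

lemma group_inclusion_scale: "group_inclusion (pm_scale c p) = pm_scale c (group_inclusion p)"
  by (simp add: group_inclusion_def linear_extension_scale)

lemma group_inclusion_zero: "group_inclusion 0 = 0"
  by (simp add: group_inclusion_def linear_extension_def)

lemma group_inclusion_mult: "group_inclusion (p * p') = group_inclusion p \<otimes>\<^bsub>R\<^esub> group_inclusion p'"
proof (induction p rule: poly_mapping_additive_induct)
  case (1 g c)
  show ?case
  proof (induction p' rule: poly_mapping_additive_induct)
    case (1 h d)
    then show ?case by (simp add: group_inclusion_single mult_single)
  qed (simp_all add: group_inclusion_zero group_inclusion_add distrib_left twisted_mult_add_right)
qed (simp_all add: group_inclusion_zero group_inclusion_add distrib_right twisted_mult_add_left)

lemma group_module: "alg_module scale group_algebra (\<lambda>p. act (group_algebra_to_U L K \<chi> l p))"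
proof -
  have *: "act (group_algebra_to_U L K \<chi> l p) = rep (group_inclusion p)" for p
    by (simp add: group_algebra_to_U_def rep_def VW_bosonization_alt)
  have one: "group_inclusion 1 = \<one>\<^bsub>R\<^esub>"
    using group_inclusion_single[of 0 1] by (simp add: single_one)
  show ?thesis
    unfolding *
    by unfold_locales
      (simp_all add: group_algebra_def endo_simps[OF rep_endo] group_inclusion_add rep_add
        group_inclusion_mult rep_mult one rep_one group_inclusion_scale rep_scale
        del: twisted_algebra_sel(2))
qed

text \<open>Schur's argument for commuting operators: in a simple submodule over the group algebra
  an eigenspace of one group element is a nonzero submodule, hence everything. So every vector of a
  simple submodule is a weight vector.\<close>

lemma weight_span: "span {x. \<exists>\<psi>. \<forall>g. kact g x = scale (\<psi> g) x} = UNIV"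
proof -
  interpret G: alg_module scale group_algebra "\<lambda>p. act (group_algebra_to_U L K \<chi> l p)"
    by (rule group_module)
  have rep: "act (group_algebra_to_U L K \<chi> l p) = rep (group_inclusion p)" for p
    by (simp add: group_algebra_to_U_def rep_def VW_bosonization_alt)
  have sub: "G.is_submodule N \<longleftrightarrow> subspace N \<and> (\<forall>g. \<forall>x\<in>N. kact g x \<in> N)" for N
  proof
    assume "G.is_submodule N"
    then have "subspace N" "\<And>p x. x \<in> N \<Longrightarrow> rep (group_inclusion p) x \<in> N"
      unfolding G.is_submodule_def by (simp_all add: rep group_algebra_def)
    from this(1) this(2)[of _ "Poly_Mapping.single _ 1"]
    show "subspace N \<and> (\<forall>g. \<forall>x\<in>N. kact g x \<in> N)" by (simp add: group_inclusion_single kact_def)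
  next
    assume N: "subspace N \<and> (\<forall>g. \<forall>x\<in>N. kact g x \<in> N)"
    have "rep (group_inclusion p) x \<in> N" if "x \<in> N" for p x
    proof (induction p rule: poly_mapping_additive_induct)
      case (1 g c)
      have "rep (group_inclusion (Poly_Mapping.single g c)) x = scale c (kact g x)"
        unfolding group_inclusion_single kact_def by (rule rep_single)
      then show ?case using N that subspace_scale by simp
    qed (use N in \<open>simp_all add: group_inclusion_zero group_inclusion_add rep_add subspace_0 subspace_add\<close>)
    then show "G.is_submodule N" using N unfolding G.is_submodule_def by (simp add: rep)
  qed
  have weight: "\<exists>\<psi>. \<forall>g. kact g x = scale (\<psi> g) x" if S: "G.simple_submodule S" "x \<in> S" for S x
  proof -
    have sS: "subspace S" and kS: "\<And>g x. x \<in> S \<Longrightarrow> kact g x \<in> S" and "S \<noteq> {0}"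
      and min: "\<And>N. G.is_submodule N \<Longrightarrow> N \<subseteq> S \<Longrightarrow> N = {0} \<or> N = S"
      using S(1) by (auto simp: G.simple_submodule_def sub)
    have "\<exists>c. kact g x = scale c x" for g
    proof -
      have k: "endo scale (kact g)" for g by (simp add: kact_def rep_endo)
      obtain y c where y: "y \<in> S" "y \<noteq> 0" "kact g y = scale c y"
        using eigenvector_exists[OF alg_closed_imp_poly_has_root finite_spanning k sS kS \<open>S \<noteq> {0}\<close>] by blast
      let ?N = "{x \<in> S. kact g x = scale c x}"
      have "G.is_submodule ?N"
        unfolding sub
      proof (intro conjI allI ballI)
        show "subspace ?N"
          using sS by (auto simp: subspace_def endo_simps[OF k] scale_right_distrib mult.commute)
        fix g' x assume x: "x \<in> ?N"
        have "kact g (kact g' x) = kact g' (kact g x)"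
          by (simp only: kact_plus[symmetric] add.commute)
        then show "kact g' x \<in> ?N" using x kS by (simp add: endo_simps[OF k])
      qed
      then have "?N = S" using min[of ?N] y by blast
      then show ?thesis using S(2) by blast
    qed
    then show ?thesis by (rule choice[OF allI])
  qed
  obtain \<S> where \<S>: "\<forall>S\<in>\<S>. G.simple_submodule S" "span (\<Union>\<S>) = UNIV"
    using group_semisimple unfolding G.semisimple_def by blast
  have "\<Union>\<S> \<subseteq> {x. \<exists>\<psi>. \<forall>g. kact g x = scale (\<psi> g) x}" using \<S>(1) weight by blast
  from span_mono[OF this] show ?thesis unfolding \<S>(2) by blast
qed

sublocale W: weighted_rep scale q E F kact "\<lambda>i. K i + L i" \<chi>
proof (intro weighted_rep.intro linked_rep.intro group_rep.intro weighted_rep_axioms.intro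
    linked_rep_axioms.intro group_rep_axioms.intro)
  have L: "\<chi> j (L i) = q j i" for i j
    using datum by (simp add: reduced_YD_datum_def q_def)
  have h: "\<chi> j (K i + L i) = q i j * q j i" for i j
    using characters(1)[of j] by (simp add: is_character_def L) (simp add: q_def)
  show "q i j \<noteq> 0" for i j by (simp add: q_def)
  show "endo scale (E i)" for i
    by (simp add: endo_iff E_def endo_simps[OF rep_endo] scale_right_distrib mult.commute)
  show "endo scale (F i)" for i by (simp add: F_def rep_endo)
  have kact: "endo scale (kact g)" for g by (simp add: kact_def rep_endo)
  show "endo scale (kact (K i + L i))" for i by (rule kact)
  show "endo scale (kact g)" for g by (rule kact)
  show "kact (K i + L i) (E j x) = scale (q i j * q j i) (E j (kact (K i + L i) x))" for i j x
    by (simp add: kact_E h)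
  show "kact (K i + L i) (F j x) = scale (inverse (q i j * q j i)) (F j (kact (K i + L i) x))" for i j x
    by (simp add: kact_F h)
  show "0 < n \<Longrightarrow> q i i ^ n \<noteq> 1" for i n
    using generic_K by (simp add: generic_datum_def braiding_matrix_def q_def)
  show "q i j * q j i = 1" if "\<not> commensurable (q i i) (q j j)" for i j
    using cartan_orthogonal[OF cartan, of i j] that by (simp add: q_def)
  show "\<chi> j (K i + L i) = q i j * q j i" for i j by (rule h)
qed (rule vector_space_axioms E_F radical_E radical_F kact_zero kact_plus finite_spanning weight_span
    \<chi>_nonzero kact_E kact_F regular_\<chi>; assumption)+

lemma is_submodule_iff: "is_submodule N \<longleftrightarrow> W.submodule N"
proof
  assume "is_submodule N"
  then have sN: "subspace N" and N: "\<And>b x. x \<in> N \<Longrightarrow> rep b x \<in> N"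
    unfolding is_submodule_rep by blast+
  show "W.submodule N"
    unfolding W.submodule_def W.stable_def kact_def E_def F_def
    by (intro conjI allI ballI sN subspace_scale[OF sN] N)
next
  assume N: "W.submodule N"
  note sN = W.submodule_simps(2)[OF N]
  have v: "rep (v_gen i) x \<in> N" if "x \<in> N" for i x
    unfolding rep_v_gen by (rule subspace_scale[OF sN W.submodule_simps(3)[OF N that]])
  have w: "rep (w_gen i) x \<in> N" if "x \<in> N" for i x
    using W.submodule_simps(4)[OF N that] by (simp add: F_def)
  have letter: "rep (Poly_Mapping.single ([s], 0) 1) x \<in> N" if "x \<in> N" for s x
  proof (cases s)
    case (Inl i)
    then show ?thesis using v[OF that, of i] by (simp only: v_gen_def)
  next
    case (Inr i)
    then show ?thesis using w[OF that, of i] by (simp only: w_gen_def)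
  qed
  have word: "rep (Poly_Mapping.single (w, g) 1) x \<in> N" if "x \<in> N" for w g x
  proof (subst rep_word, induction w)
    case Nil
    show ?case using W.submodule_simps(5)[OF N that, of g] by (simp add: kact_def)
  next
    case (Cons s w)
    show ?case using letter[OF Cons] by simp
  qed
  have "rep b x \<in> N" if x: "x \<in> N" for b x
  proof (induction b rule: poly_mapping_additive_induct)
    case (1 z c)
    show ?case
      using subspace_scale[OF sN word[OF x, of "fst z" "snd z"], of c] unfolding rep_single[of z c] by simp
  qed (simp_all add: rep_add subspace_0[OF sN] subspace_add[OF sN])
  then show "is_submodule N" using sN by (simp add: is_submodule_rep)
qed

lemma simple_submodule_iff: "simple_submodule S \<longleftrightarrow> W.simple S"
  by (simp add: simple_submodule_def W.simple_def is_submodule_iff)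

lemma U_semisimple: semisimple
  using W.span_simple fin_dim by (intro semisimple_if_span_simple) (simp_all add: simple_submodule_iff)

end

theorem corollary4p18:
  fixes K L :: "'n::finite \<Rightarrow> 'g::ab_group_add"
    and \<chi> :: "'n \<Rightarrow> 'g \<Rightarrow> 'k::{alg_closed_field, field_char_0}"
    and a :: "'n \<Rightarrow> 'n \<Rightarrow> int"
    and l :: "'n \<Rightarrow> 'k"
    and scale :: "'k \<Rightarrow> 'm::ab_group_add \<Rightarrow> 'm"
    and act :: "(('n + 'n) list \<times> 'g \<Rightarrow>\<^sub>0 'k) set \<Rightarrow> 'm \<Rightarrow> 'm"
  assumes "reduced_YD_datum L K \<chi>"
    and "generic_datum K \<chi>"
    and "regular_datum \<chi>"
    and "cartan_type K \<chi> a"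
    and "linking_parameter l"
    and "alg_module scale (U_algebra L K \<chi> l) act"
    and "alg_module.finite_dimensional scale"
    and "alg_module.semisimple scale group_algebra (\<lambda>p. act (group_algebra_to_U L K \<chi> l p))"
  shows "alg_module.semisimple scale (U_algebra L K \<chi> l) act"
proof -
  interpret U_module K L \<chi> a l scale act
    by (rule U_module.intro) (fact assms)+
  show ?thesis
    using U_semisimple by (simp add: U_algebra_def VW_bosonization_alt)
qed

end
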